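(* Let $p$ be a tree-structured graphical model (Gaussian or discrete) that is Markov on a latent tree $T_p=(W,E_p)$ with $W=V\cup H$, $m=|V|\ge 3$, and let $\mathbf{D}=[d_{ij}]_{i,j\in V}$ be the matrix of its information distances between observed nodes. If $T_p\in\mathcal{T}_{\ge 3}$ and $\mathbf{D}$ is available, then the recursive grouping algorithm RG, run on input $(V,\mathbf{D})$, outputs the true latent tree $T_p$ correctly (up to the names of the hidden nodes) in time $O(\mathrm{diam}(T_p)\, m^3)$.
   Context: **Latent trees.** A latent tree is a tree with node set $W=V\cup H$ (disjoint), where $V$ is the set of observed nodes, $m=|V|$, and $H$ is the set of hidden nodes. $\mathcal{T}_{\ge 3}$ (minimal latent trees) is the set of latent trees in which every hidden node has at least three neighbors (so all leaves are observed, but observed nodes may be internal). $\mathrm{diam}(T)$ is the diameter of $T$ in number of edges. **Models.** A random vector $(X_i)_{i\in W}$ with distribution $p$ is Markov on $T_p$ if each $X_i$ is conditionally independent of all other variables given its neighbors in $T_p$. Either $p$ is a zero-mean Gaussian (all $X_i$ scalar), or all $X_i$ take values in a common finite alphabet $\mathcal{X}=\{1,\dots,K\}$. **Information distances.** Gaussian: $d_{ij}=-\log|\rho_{ij}|$, with $\rho_{ij}$ the correlation coefficient. Discrete: $d_{ij}=-\log\frac{|\det \mathbf{J}^{ij}|}{\sqrt{\det\mathbf{M}^i\det\mathbf{M}^j}}$, with $J^{ij}_{ab}=p(x_i=a,x_j=b)$ and $\mathbf{M}^i$ diagonal with $M^i_{aa}=p(x_i=a)$. Standing assumption (C2): there are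 constants $0<l,u<\infty$ with $l\le d_{ij}\le u$ for all $(i,j)\in E_p$. It is known that these distances are additive on $T_p$: $d_{kl}=\sum_{(i,j)\in \mathrm{Path}((k,l);E_p)}d_{ij}$ for all $k,l\in W$. **TestNodeRelationships** (on a set $Y$ of nodes with known pairwise distances). Put $\Phi_{ijk}=d_{ik}-d_{jk}$. For a pair $i,j\in Y$: (1) if $\Phi_{ijk}=d_{ij}$ for all $k\in Y\setminus\{i,j\}$, declare $i$ a leaf with parent $j$; if $\Phi_{ijk}=-d_{ij}$ for all such $k$, declare $j$ a leaf with parent $i$; (2) if $\Phi_{ijk}$ is constant over $k\in Y\setminus\{i,j\}$ but equal to neither $d_{ij}$ nor $-d_{ij}$, declare $i,j$ leaf nodes and siblings (same parent); (3) otherwise declare neither. **Algorithm RG**, input $(V,\mathbf{D})$. 1. Set the active set $Y:=V$. 2. Compute $\Phi_{ijk}=d_{ik}-d_{jk}$ for all $i,j,k\in Y$. 3. Using TestNodeRelationships on $Y$, let $\{\Pi_l\}_{l=1}^L$ be the coarsest partition of $Y$ such that for every $\Pi_l$ with $|\Pi_l|\ge2$, any two nodes in $\Pi_l$ are either siblings that are leaf nodes or have a parent-child relationship in which the child is a leaf. Set $Y_{\mathrm{new}}:=\bigcup_{l:|\Pi_l|=1}\Pi_l$. 4. For each $l$ with $|\Pi_l|\ge 2$: if $\Pi_l$ contains a parent node $u$, connect $u$ to all other nodes of $\Pi_l$ and add $u$ to $Y_{\mathrm{new}}$; otherwise introduce a new hidden node $h$, connect $h$ (as a parent) to every node in $\Pi_l$,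 and add $h$ to $Y_{\mathrm{new}}$. 5. Set $Y_{\mathrm{old}}:=Y$ and $Y:=Y_{\mathrm{new}}$. 6. For each new hidden node $h\in Y$, with $\mathcal{C}(h)$ its set of children: for $i,j\in\mathcal{C}(h)$ and any $k\in Y_{\mathrm{old}}\setminus\{i,j\}$ set $d_{ih}=\frac12(d_{ij}+\Phi_{ijk})$; for any other $l\in Y$, using a child $i\in\mathcal{C}(h)$, set $d_{hl}=d_{il}-d_{ih}$ if $l\in Y_{\mathrm{old}}$, and $d_{hl}=d_{ik}-d_{ih}-d_{lk}$ with $k\in\mathcal{C}(l)$ otherwise. 7. If $|Y|\ge3$ return to step 2. If $|Y|=2$, connect the two remaining nodes by an edge and stop. If $|Y|=1$, stop. Running time counts elementary arithmetic operations and comparisons on real numbers.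
   Formalization: In the discrete case p is also required to factorize over the edges of T_p; conditional independence of each X_i given its neighbors alone does not give additive distances when p has zero probabilities (there are counterexamples on a path of five observed nodes). *)

theory Defs
  imports
    "HOL-Probability.Probability"
    "HOL-Library.State_Monad"
    "HOL-Library.While_Combinator"
    "HOL-Library.Disjoint_Sets"
    "Jordan_Normal_Form.Determinant"
begin

section \<open>Undirected trees\<close>

text \<open>
  An undirected simple graph is a vertex set \<open>W\<close> with a set \<open>E\<close> of two-element subsets of \<open>W\<close>.
\<close>

definition simple_path :: "'v set set \<Rightarrow> 'v list \<Rightarrow> bool" where
  "simple_path E xs \<longleftrightarrow> xs \<noteq> [] \<and> distinct xs \<and> successively (\<lambda>u v. {u, v} \<in> E) xs"

definition is_tree :: "'v set \<Rightarrow> 'v set set \<Rightarrow> bool" where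
  "is_tree W E \<longleftrightarrow>
     finite W \<and> W \<noteq> {} \<and>
     (\<forall>e\<in>E. \<exists>u\<in>W. \<exists>v\<in>W. u \<noteq> v \<and> e = {u, v}) \<and>
     (\<forall>u\<in>W. \<forall>v\<in>W. \<exists>xs. simple_path E xs \<and> hd xs = u \<and> last xs = v) \<and>
     \<not> (\<exists>xs. simple_path E xs \<and> 3 \<le> length xs \<and> {last xs, hd xs} \<in> E)"

definition neighbors :: "'v set set \<Rightarrow> 'v \<Rightarrow> 'v set" where
  "neighbors E i = {j. {i, j} \<in> E}"

definition graph_dist :: "'v set set \<Rightarrow> 'v \<Rightarrow> 'v \<Rightarrow> nat" where
  "graph_dist E u v =
     (LEAST n. \<exists>xs. simple_path E xs \<and> hd xs = u \<and> last xs = v \<and> length xs = Suc n)"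

definition diam :: "'v set \<Rightarrow> 'v set set \<Rightarrow> nat" where
  "diam W E = Max {graph_dist E u v | u v. u \<in> W \<and> v \<in> W}"

definition latent_tree :: "'v set \<Rightarrow> 'v set \<Rightarrow> 'v set set \<Rightarrow> bool" where
  "latent_tree V H E \<longleftrightarrow> V \<inter> H = {} \<and> is_tree (V \<union> H) E"

definition minimal_latent_tree :: "'v set \<Rightarrow> 'v set \<Rightarrow> 'v set set \<Rightarrow> bool" where
  "minimal_latent_tree V H E \<longleftrightarrow> latent_tree V H E \<and> (\<forall>h\<in>H. 3 \<le> card (neighbors E h))"


section \<open>Markov models and information distances\<close>

definition generated_by :: "'s measure \<Rightarrow> 'b measure \<Rightarrow> ('v \<Rightarrow> 's \<Rightarrow> 'b) \<Rightarrow> 'v set \<Rightarrow> 's measure" where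
  "generated_by M N X A =
     vimage_algebra (space M) (\<lambda>\<omega>. \<lambda>i\<in>A. X i \<omega>) (Pi\<^sub>M A (\<lambda>_. N))"

definition cond_indep :: "'s measure \<Rightarrow> 's measure \<Rightarrow> 's measure \<Rightarrow> 's measure \<Rightarrow> bool" where
  "cond_indep M F G S \<longleftrightarrow>
     (\<forall>A\<in>sets F. \<forall>B\<in>sets G. AE \<omega> in M.
        real_cond_exp M S (indicator (A \<inter> B)) \<omega> =
        real_cond_exp M S (indicator A) \<omega> * real_cond_exp M S (indicator B) \<omega>)"

definition markov_on ::
  "'s measure \<Rightarrow> 'b measure \<Rightarrow> ('v \<Rightarrow> 's \<Rightarrow> 'b) \<Rightarrow> 'v set \<Rightarrow> 'v set set \<Rightarrow> bool" where
  "markov_on M N X W E \<longleftrightarrow>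
     (\<forall>i\<in>W. cond_indep M (generated_by M N X {i}) (generated_by M N X (W - {i}))
                          (generated_by M N X (neighbors E i)))"

text \<open>
  Joint Gaussianity: every linear combination is normal; \<open>\<sigma> = 0\<close> is the point mass at \<open>0\<close>, so
  singular covariance matrices are not excluded.
\<close>

definition zero_mean_gaussian :: "'s measure \<Rightarrow> ('v \<Rightarrow> 's \<Rightarrow> real) \<Rightarrow> 'v set \<Rightarrow> bool" where
  "zero_mean_gaussian M X W \<longleftrightarrow>
     (\<forall>a :: 'v \<Rightarrow> real. \<exists>\<sigma>\<ge>0.
        distr M borel (\<lambda>\<omega>. \<Sum>i\<in>W. a i * X i \<omega>) =
        (if \<sigma> = 0 then return borel 0 else density lborel (normal_density 0 \<sigma>)))"

definition gaussian_model ::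
  "'s measure \<Rightarrow> ('v \<Rightarrow> 's \<Rightarrow> real) \<Rightarrow> 'v set \<Rightarrow> 'v set set \<Rightarrow> bool" where
  "gaussian_model M X W E \<longleftrightarrow>
     prob_space M \<and> (\<forall>i\<in>W. X i \<in> M \<rightarrow>\<^sub>M borel) \<and>
     zero_mean_gaussian M X W \<and> markov_on M borel X W E"

text \<open>
  An undirected graphical model is a distribution that factorizes over its graph.  For a discrete
  distribution with zero probabilities the single-node Markov property \<^const>\<open>markov_on\<close> does not
  imply this, not even on a path and with all edge distances positive and finite, and then
  information distances need not be additive; so the factorization is stated separately.  The
  potential of an edge sees the configuration only at the ends of that edge.
\<close>

definition factorizes_on ::
  "'s measure \<Rightarrow> 'b set \<Rightarrow> ('v \<Rightarrow> 's \<Rightarrow> 'b) \<Rightarrow> 'v set \<Rightarrow> 'v set set \<Rightarrow> bool" where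
  "factorizes_on M A X W E \<longleftrightarrow>
     (\<exists>\<psi> :: 'v set \<Rightarrow> ('v \<Rightarrow> 'b) \<Rightarrow> real.
        (\<forall>e x. 0 \<le> \<psi> e x) \<and>
        (\<forall>x \<in> W \<rightarrow> A. measure M {\<omega> \<in> space M. \<forall>i\<in>W. X i \<omega> = x i} =
                      (\<Prod>e\<in>E. \<psi> e (restrict x e))))"

definition discrete_model ::
  "'s measure \<Rightarrow> nat \<Rightarrow> ('v \<Rightarrow> 's \<Rightarrow> nat) \<Rightarrow> 'v set \<Rightarrow> 'v set set \<Rightarrow> bool" where
  "discrete_model M K X W E \<longleftrightarrow>
     prob_space M \<and> (\<forall>i\<in>W. X i \<in> M \<rightarrow>\<^sub>M count_space {1..K}) \<and>
     factorizes_on M {1..K} X W E \<and> markov_on M (count_space {1..K}) X W E"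

definition covariance :: "'s measure \<Rightarrow> ('s \<Rightarrow> real) \<Rightarrow> ('s \<Rightarrow> real) \<Rightarrow> real" where
  "covariance M X Y = (LINT \<omega>|M. (X \<omega> - (LINT \<omega>'|M. X \<omega>')) * (Y \<omega> - (LINT \<omega>'|M. Y \<omega>')))"

definition correlation :: "'s measure \<Rightarrow> ('s \<Rightarrow> real) \<Rightarrow> ('s \<Rightarrow> real) \<Rightarrow> real" where
  "correlation M X Y = covariance M X Y / sqrt (covariance M X X * covariance M Y Y)"

text \<open>
  Where a distance is infinite or undefined (zero correlation, singular joint matrix, degenerate
  marginal), \<open>ln 0 = 0\<close> and \<open>x / 0 = 0\<close> give the value \<open>0\<close>.  On an edge this is ruled out by a
  positive lower bound on the edge distances.
\<close>

definition gaussian_dist :: "'s measure \<Rightarrow> ('v \<Rightarrow> 's \<Rightarrow> real) \<Rightarrow> 'v \<Rightarrow> 'v \<Rightarrow> real" where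
  "gaussian_dist M X i j = - ln \<bar>correlation M (X i) (X j)\<bar>"

text \<open>Matrices are indexed from \<open>0\<close> and the alphabet from \<open>1\<close>.\<close>

definition joint_matrix :: "'s measure \<Rightarrow> nat \<Rightarrow> ('v \<Rightarrow> 's \<Rightarrow> nat) \<Rightarrow> 'v \<Rightarrow> 'v \<Rightarrow> real mat" where
  "joint_matrix M K X i j =
     Matrix.mat K K (\<lambda>(a, b). measure M {\<omega> \<in> space M. X i \<omega> = Suc a \<and> X j \<omega> = Suc b})"

definition marginal_matrix :: "'s measure \<Rightarrow> nat \<Rightarrow> ('v \<Rightarrow> 's \<Rightarrow> nat) \<Rightarrow> 'v \<Rightarrow> real mat" where
  "marginal_matrix M K X i =
     Matrix.mat K K (\<lambda>(a, b). if a = b then measure M {\<omega> \<in> space M. X i \<omega> = Suc a} else 0)"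

definition discrete_dist :: "'s measure \<Rightarrow> nat \<Rightarrow> ('v \<Rightarrow> 's \<Rightarrow> nat) \<Rightarrow> 'v \<Rightarrow> 'v \<Rightarrow> real" where
  "discrete_dist M K X i j =
     - ln (\<bar>Determinant.det (joint_matrix M K X i j)\<bar> /
           sqrt (Determinant.det (marginal_matrix M K X i) *
                 Determinant.det (marginal_matrix M K X j)))"


section \<open>Counting operations on real numbers\<close>

text \<open>
  The state is the number of operations performed so far.  The algorithm touches reals only through
  the four operations below; moving and storing reals, and all work on nodes, lists, truth values
  and declared relationships, is free.
\<close>

type_synonym 'a counted = "(nat, 'a) state"

definition tick :: "'a \<Rightarrow> 'a counted" where
  "tick x = do { State_Monad.update Suc; State_Monad.return x }"

definition real_add :: "real \<Rightarrow> real \<Rightarrow> real counted" where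
  "real_add x y = tick (x + y)"

definition real_sub :: "real \<Rightarrow> real \<Rightarrow> real counted" where
  "real_sub x y = tick (x - y)"

definition real_div :: "real \<Rightarrow> real \<Rightarrow> real counted" where
  "real_div x y = tick (x / y)"

definition real_eq :: "real \<Rightarrow> real \<Rightarrow> bool counted" where
  "real_eq x y = tick (x = y)"

definition for_all :: "('a \<Rightarrow> bool counted) \<Rightarrow> 'a list \<Rightarrow> bool counted" where
  "for_all p xs = do { bs \<leftarrow> State_Monad.traverse_list p xs; State_Monad.return (list_all id bs) }"

text \<open>The table returned is unspecified outside the listed keys.\<close>

definition tabulate :: "('k \<Rightarrow> 'a counted) \<Rightarrow> 'k list \<Rightarrow> ('k \<Rightarrow> 'a) counted" where
  "tabulate f ks =
     do { vs \<leftarrow> State_Monad.traverse_list f ks;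
          State_Monad.return (\<lambda>k. the (map_of (zip ks vs) k)) }"

primrec iterate :: "('k \<Rightarrow> 'a \<Rightarrow> 'a counted) \<Rightarrow> 'k list \<Rightarrow> 'a \<Rightarrow> 'a counted" where
  "iterate f [] x = State_Monad.return x"
| "iterate f (k # ks) x = do { y \<leftarrow> f k x; iterate f ks y }"


section \<open>Recursive grouping\<close>

datatype 'v node = Observed 'v | Hidden nat

type_synonym 'v dist_table = "'v node \<Rightarrow> 'v node \<Rightarrow> real"

text \<open>Verdict of the relationship test on an ordered pair \<open>(i, j)\<close>.\<close>

datatype verdict =
    FirstLeafOfSecond
  | SecondLeafOfFirst
  | LeafSiblings
  | Neither

text \<open>
  In the third branch the two constants \<open>d i j\<close> and \<open>- d i j\<close> have already been excluded.
  With three or more active nodes \<open>ks\<close> is nonempty.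
\<close>

definition test_node_relationships ::
  "'v dist_table \<Rightarrow> ('v node \<times> 'v node \<times> 'v node \<Rightarrow> real) \<Rightarrow> 'v node list \<Rightarrow>
   'v node \<Rightarrow> 'v node \<Rightarrow> verdict counted" where
  "test_node_relationships d \<Phi> Y i j =
     (let ks = filter (\<lambda>k. k \<noteq> i \<and> k \<noteq> j) Y in
      do {
        p \<leftarrow> for_all (\<lambda>k. real_eq (\<Phi> (i, j, k)) (d i j)) ks;
        if p then State_Monad.return FirstLeafOfSecond
        else do {
          m \<leftarrow> real_sub 0 (d i j);
          q \<leftarrow> for_all (\<lambda>k. real_eq (\<Phi> (i, j, k)) m) ks;
          if q then State_Monad.return SecondLeafOfFirst
          else do {
            c \<leftarrow> for_all (\<lambda>k. real_eq (\<Phi> (i, j, k)) (\<Phi> (i, j, hd ks))) ks;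
            State_Monad.return (if c then LeafSiblings else Neither)
          }
        }
      })"

definition leaf_partition :: "('a \<Rightarrow> 'a \<Rightarrow> bool) \<Rightarrow> 'a set \<Rightarrow> 'a set set \<Rightarrow> bool" where
  "leaf_partition R A P \<longleftrightarrow>
     partition_on A P \<and> (\<forall>B\<in>P. \<forall>i\<in>B. \<forall>j\<in>B. i \<noteq> j \<longrightarrow> R i j)"

definition coarsest_leaf_partition :: "('a \<Rightarrow> 'a \<Rightarrow> bool) \<Rightarrow> 'a set \<Rightarrow> 'a set set" where
  "coarsest_leaf_partition R A =
     (THE P. leaf_partition R A P \<and> (\<forall>Q. leaf_partition R A Q \<longrightarrow> refines A Q P))"

definition partition_blocks :: "('a \<Rightarrow> 'a \<Rightarrow> bool) \<Rightarrow> 'a list \<Rightarrow> 'a list list" where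
  "partition_blocks R Y =
     (let P = coarsest_leaf_partition R (set Y) in
      remdups (map (\<lambda>i. filter (\<lambda>j. \<exists>B\<in>P. i \<in> B \<and> j \<in> B) Y) Y))"

definition declared_parent :: "('v node \<times> 'v node \<Rightarrow> verdict) \<Rightarrow> 'v node \<Rightarrow> 'v node \<Rightarrow> bool" where
  "declared_parent \<tau> u i \<longleftrightarrow>
     u \<noteq> i \<and> (\<tau> (i, u) = FirstLeafOfSecond \<or> \<tau> (u, i) = SecondLeafOfFirst)"

text \<open>
  Grouping of the blocks.  The accumulator holds the new active set, the edges found so far, the new
  hidden nodes with their children, and the first unused hidden name.
\<close>

definition group_block ::
  "('v node \<times> 'v node \<Rightarrow> verdict) \<Rightarrow> 'v node list \<Rightarrow>
   'v node list \<times> 'v node set set \<times> ('v node \<times> 'v node list) list \<times> nat \<Rightarrow>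
   'v node list \<times> 'v node set set \<times> ('v node \<times> 'v node list) list \<times> nat" where
  "group_block \<tau> B = (\<lambda>(Y', F, C, n).
     if length B < 2 then (B @ Y', F, C, n)
     else case filter (\<lambda>u. \<exists>i\<in>set B. declared_parent \<tau> u i) B of
       u # _ \<Rightarrow> (u # Y', F \<union> (\<lambda>v. {u, v}) ` (set B - {u}), C, n)
     | [] \<Rightarrow> (Hidden n # Y', F \<union> (\<lambda>v. {Hidden n, v}) ` set B, (Hidden n, B) # C, Suc n))"

definition set_dist :: "'v node \<Rightarrow> 'v node \<Rightarrow> real \<Rightarrow> 'v dist_table \<Rightarrow> 'v dist_table" where
  "set_dist a b x d = (\<lambda>i j. if (i, j) = (a, b) \<or> (i, j) = (b, a) then x else d i j)"

text \<open>
  \<open>pick\<close> resolves the free choices ``any \<open>k\<close>'' and ``a child \<open>i\<close>''.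
\<close>

definition child_distances ::
  "('v node list \<Rightarrow> 'v node) \<Rightarrow> ('v node \<times> 'v node \<times> 'v node \<Rightarrow> real) \<Rightarrow> 'v node list \<Rightarrow>
   ('v node \<times> 'v node list) list \<Rightarrow> 'v dist_table \<Rightarrow> 'v dist_table counted" where
  "child_distances pick \<Phi> Y C =
     iterate (\<lambda>(h, i, j) d.
         let k = pick (filter (\<lambda>k. k \<noteq> i \<and> k \<noteq> j) Y) in
         do {
           s \<leftarrow> real_add (d i j) (\<Phi> (i, j, k));
           x \<leftarrow> real_div s 2;
           State_Monad.return (set_dist i h x d)
         })
       [(h, i, j). (h, B) \<leftarrow> C, i \<leftarrow> B, j \<leftarrow> B, i \<noteq> j]"

definition other_distances ::
  "('v node list \<Rightarrow> 'v node) \<Rightarrow> 'v node list \<Rightarrow> 'v node list \<Rightarrow>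
   ('v node \<times> 'v node list) list \<Rightarrow> 'v dist_table \<Rightarrow> 'v dist_table counted" where
  "other_distances pick Y Y' C =
     iterate (\<lambda>(h, B, l) d.
         let i = pick B in
         if l \<in> set Y then
           do {
             x \<leftarrow> real_sub (d i l) (d i h);
             State_Monad.return (set_dist h l x d)
           }
         else
           let k = pick (the (map_of C l)) in
           do {
             y \<leftarrow> real_sub (d i k) (d i h);
             x \<leftarrow> real_sub y (d l k);
             State_Monad.return (set_dist h l x d)
           })
       [(h, B, l). (h, B) \<leftarrow> C, l \<leftarrow> Y', l \<noteq> h]"

record 'v rg_state =
  active :: "'v node list"
  distances :: "'v dist_table"
  edges :: "'v node set set"
  next_hidden :: nat

text \<open>
  One round.  The distances from all new hidden nodes to their children are computed first, because
  the distance between two new hidden nodes uses both.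
\<close>

definition rg_round :: "('v node list \<Rightarrow> 'v node) \<Rightarrow> 'v rg_state \<Rightarrow> 'v rg_state counted" where
  "rg_round pick s =
     (let Y = active s; d = distances s in
      do {
        \<Phi> \<leftarrow> tabulate (\<lambda>(i, j, k). real_sub (d i k) (d j k)) [(i, j, k). i \<leftarrow> Y, j \<leftarrow> Y, k \<leftarrow> Y];
        \<tau> \<leftarrow> tabulate (\<lambda>(i, j). test_node_relationships d \<Phi> Y i j)
               [(i, j). i \<leftarrow> Y, j \<leftarrow> Y, i \<noteq> j];
        let (Y', F, C, n) =
          fold (group_block \<tau>) (partition_blocks (\<lambda>i j. \<tau> (i, j) \<noteq> Neither) Y)
            ([], edges s, [], next_hidden s);
        d1 \<leftarrow> child_distances pick \<Phi> Y C d;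
        d2 \<leftarrow> other_distances pick Y Y' C d1;
        State_Monad.return \<lparr>active = Y', distances = d2, edges = F, next_hidden = n\<rparr>
      })"

definition rg_init :: "'v list \<Rightarrow> ('v \<Rightarrow> 'v \<Rightarrow> real) \<Rightarrow> 'v rg_state" where
  "rg_init vs D =
     \<lparr>active = map Observed vs,
      distances = (\<lambda>a b. case (a, b) of (Observed i, Observed j) \<Rightarrow> D i j | _ \<Rightarrow> undefined),
      edges = {}, next_hidden = 0\<rparr>"

definition rg_output :: "'v list \<Rightarrow> 'v rg_state \<Rightarrow> 'v node set \<times> 'v node set set" where
  "rg_output vs s =
     (Observed ` set vs \<union> Hidden ` {..<next_hidden s},
      edges s \<union> (case active s of [a, b] \<Rightarrow> {{a, b}} | _ \<Rightarrow> {}))"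

text \<open>
  The result is the output graph and the number of operations on reals; it is \<^const>\<open>None\<close> if the
  loop does not terminate.
\<close>

definition recursive_grouping ::
  "('v node list \<Rightarrow> 'v node) \<Rightarrow> 'v list \<Rightarrow> ('v \<Rightarrow> 'v \<Rightarrow> real) \<Rightarrow>
   (('v node set \<times> 'v node set set) \<times> nat) option" where
  "recursive_grouping pick vs D =
     map_option (map_prod (rg_output vs) id)
       (while_option (\<lambda>(s, t). 3 \<le> length (active s)) (\<lambda>(s, t). run_state (rg_round pick s) t)
         (rg_init vs D, 0))"

text \<open>Equality of the output with the tree \<open>(V \<union> H, E)\<close> up to the names of the hidden nodes.\<close>

definition recovers ::
  "'v node set \<times> 'v node set set \<Rightarrow> 'v set \<Rightarrow> 'v set \<Rightarrow> 'v set set \<Rightarrow> bool" where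
  "recovers G V H E \<longleftrightarrow>
     (\<exists>f. bij_betw f (fst G) (V \<union> H) \<and> (\<forall>v\<in>V. Observed v \<in> fst G \<and> f (Observed v) = v) \<and>
          (`) f ` snd G = E)"

end

theory Submission
  imports Defs
begin

text \<open>
  Information distances are additive along the paths of the tree. Both for Gaussian and for discrete
  models this is shown by removing leaves: the leaf \<open>i\<close> at \<open>j\<close> depends on the rest only through
  \<open>X\<^sub>j\<close>, so \<open>e\<^bsup>-d\<^esup>\<close> is multiplicative through \<open>j\<close>, and the model property passes to the remaining
  tree.

  In every round the edges not yet found form a subtree in which every vertex that is not active
  is a hidden vertex with all its neighbours. Every branch of the subtree therefore contains an
  active vertex. Two active vertices have constant \<open>\<Phi>\<close> exactly if they have the same root, where
  the root of a leaf is its neighbour and any other vertex is its own root; the blocks are the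
  classes of this relation. The leaf at either end of a longest path of the subtree never forms a
  singleton block, so each round decreases the diameter.
\<close>

section \<open>Paths in trees\<close>

text \<open>The two models enter only through \<open>metric_tree\<close>; all statements about the
  algorithm follow from positive additive distances. On the probabilistic side the obstacle is
  degeneracy. A Gaussian vector may have a singular covariance, so there is no joint density and no
  inverse covariance to work with: projections are built by Gram-Schmidt, uncorrelatedness is turned
  into a vanishing conditional expectation by characteristic functions, and what passes to smaller
  trees is only a linear relation between covariances. Discrete configurations may have probability
  zero, so what passes on is a factorization with vertex potentials, and division is confined to
  places where single-vertex marginals are positive. On the combinatorial side the obstacle is that
  the tests see active vertices only. The degree condition supplies, at every vertex not yet found,
  an active vertex in a third branch; it serves as a witness at which a wrong verdict would
  contradict the positivity of some distance.\<close>

lemma simple_path_Cons: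
  "simple_path E (x # xs) \<longleftrightarrow> xs = [] \<or> simple_path E xs \<and> x \<notin> set xs \<and> {x, hd xs} \<in> E"
  by (cases xs) (auto simp: simple_path_def)

lemma simple_path_appendD:
  assumes "simple_path E (xs @ ys)"
  shows "xs \<noteq> [] \<Longrightarrow> simple_path E xs" "ys \<noteq> [] \<Longrightarrow> simple_path E ys"
  using assms by (auto simp: simple_path_def successively_append_iff)

lemma simple_path_rev: "simple_path E (rev xs) \<longleftrightarrow> simple_path E xs"
  by (simp add: simple_path_def successively_rev insert_commute)

locale tree =
  fixes W :: "'v set" and E :: "'v set set"
  assumes is_tree: "is_tree W E"
begin

lemma finite_vertices: "finite W"
  and vertices_nonempty: "W \<noteq> {}"
  and edgeE: "\<And>e. e \<in> E \<Longrightarrow> \<exists>u\<in>W. \<exists>v\<in>W. u \<noteq> v \<and> e = {u, v}"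
  and connected: "\<And>u v. u \<in> W \<Longrightarrow> v \<in> W \<Longrightarrow> \<exists>xs. simple_path E xs \<and> hd xs = u \<and> last xs = v"
  and no_cycle: "\<And>xs. simple_path E xs \<Longrightarrow> 3 \<le> length xs \<Longrightarrow> {last xs, hd xs} \<notin> E"
  using is_tree unfolding is_tree_def by blast+

lemma edge_in: "{u, v} \<in> E \<Longrightarrow> u \<in> W \<and> v \<in> W \<and> u \<noteq> v"
  using edgeE[of "{u, v}"] by (metis doubleton_eq_iff)

lemma finite_edges: "finite E"
  by (rule finite_subset[of _ "Pow W"]) (use edgeE finite_vertices in auto)

text \<open>
  Two paths that leave a vertex along different edges and meet again close a cycle at their first
  meeting point.
\<close>

lemma simple_path_unique:
  assumes "simple_path E xs" "simple_path E ys" "hd xs = hd ys" "last xs = last ys"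
  shows "xs = ys"
  using assms
proof (induction xs arbitrary: ys)
  case Nil
  then show ?case by (simp add: simple_path_def)
next
  case (Cons u xs)
  from Cons.prems(2,3) obtain zs where ys: "ys = u # zs"
    by (cases ys) (auto simp: simple_path_def)
  show ?case
  proof (cases "xs = [] \<or> zs = []")
    case True
    then show ?thesis using Cons.prems ys
      by (auto simp: simple_path_def split: if_splits)
  next
    case False
    then have xs: "simple_path E xs" "u \<notin> set xs" "{u, hd xs} \<in> E" and
      zs: "simple_path E zs" "u \<notin> set zs" "{u, hd zs} \<in> E"
      using Cons.prems ys by (auto simp: simple_path_Cons)
    have l: "last xs = last zs" using Cons.prems(4) ys False by simp
    show ?thesis
    proof (cases "hd xs = hd zs")
      case True
      then show ?thesis using Cons.IH[OF xs(1) zs(1) _ l] ys by simp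
    next
      case ne: False
      have "\<exists>z\<in>set xs. z \<in> set zs" using l False by (metis last_in_set)
      then obtain p z p' where p: "xs = p @ z # p'" "z \<in> set zs" "\<forall>y\<in>set p. y \<notin> set zs"
        using split_list_first_prop[of xs "\<lambda>z. z \<in> set zs"] by blast
      then obtain q q' where q: "zs = q @ z # q'" by (meson split_list)
      let ?c = "u # p @ z # rev q"
      have 1: "simple_path E (p @ [z])"
        using simple_path_appendD(1)[of E "p @ [z]" p'] xs(1) p(1) by simp
      have 2: "simple_path E (q @ [z])"
        using simple_path_appendD(1)[of E "q @ [z]" q'] zs(1) q by simp
      then have 3: "simple_path E (z # rev q)"
        using simple_path_rev[of E "q @ [z]"] by simp
      have d: "set p \<inter> set q = {}" using p(3) q by auto
      have 4: "simple_path E (p @ z # rev q)"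
        using 1 3 d unfolding simple_path_def by (auto simp: successively_append_iff)
      have hd: "hd (p @ z # rev q) = hd xs" using p(1) by (cases p) auto
      have 5: "simple_path E ?c"
        using 4 xs(2,3) zs(2) p(1) q hd by (subst simple_path_Cons) auto
      have "last ?c = hd zs" using q by (cases q) auto
      \<comment> \<open>If both were empty, \<open>z\<close> would be the head of both lists. So the
        closed path has at least three vertices.\<close>
      moreover have "p \<noteq> [] \<or> q \<noteq> []" using ne p(1) q by auto
      then have "3 \<le> length ?c" by (cases p; cases q) auto
      ultimately show ?thesis using no_cycle[OF 5] zs(3) by (simp add: insert_commute)
    qed
  qed
qed

definition path :: "'v \<Rightarrow> 'v \<Rightarrow> 'v list" where
  "path u v = (SOME xs. simple_path E xs \<and> hd xs = u \<and> last xs = v)"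

lemma path:
  assumes "u \<in> W" "v \<in> W"
  shows "simple_path E (path u v)" "hd (path u v) = u" "last (path u v) = v"
  using someI_ex[OF connected[OF assms]] unfolding path_def by auto

lemma path_eqI: "simple_path E xs \<Longrightarrow> hd xs = u \<Longrightarrow> last xs = v \<Longrightarrow> u \<in> W \<Longrightarrow> v \<in> W \<Longrightarrow> path u v = xs"
  using path[of u v] by (auto intro: simple_path_unique)

lemma path_rev: "u \<in> W \<Longrightarrow> v \<in> W \<Longrightarrow> path v u = rev (path u v)"
  using path[of u v]
  by (intro path_eqI) (auto simp: simple_path_rev hd_rev last_rev)

text \<open>The direction of \<open>v\<close> at \<open>u\<close>: vertices other than
  \<open>u\<close> lie in the same branch at \<open>u\<close> iff these values agree. Tree geometry
  is expressed by directions and hop counts rather than by whole paths. For \<open>u = v\<close> the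
  value is the unspecified \<open>hd []\<close>.\<close>

definition next_vertex :: "'v \<Rightarrow> 'v \<Rightarrow> 'v" where
  "next_vertex u v = hd (tl (path u v))"

abbreviation hops :: "'v \<Rightarrow> 'v \<Rightarrow> nat" where
  "hops \<equiv> graph_dist E"

lemma hops_path:
  assumes "u \<in> W" "v \<in> W"
  shows "Suc (hops u v) = length (path u v)"
proof -
  have l: "length (path u v) \<noteq> 0" using path(1)[OF assms] by (simp add: simple_path_def)
  have "hops u v = length (path u v) - 1"
    unfolding graph_dist_def
  proof (rule Least_equality)
    show "\<exists>xs. simple_path E xs \<and> hd xs = u \<and> last xs = v \<and> length xs = Suc (length (path u v) - 1)"
      using path[OF assms] l by (intro exI[of _ "path u v"]) simp
  next
    fix y assume "\<exists>xs. simple_path E xs \<and> hd xs = u \<and> last xs = v \<and> length xs = Suc y"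
    then show "length (path u v) - 1 \<le> y" using path_eqI[OF _ _ _ assms] by auto
  qed
  with l show ?thesis by simp
qed

lemma path_Cons:
  assumes "u \<in> W" "v \<in> W" "u \<noteq> v"
  shows "next_vertex u v \<in> W" "{u, next_vertex u v} \<in> E"
    "path u v = u # path (next_vertex u v) v" "u \<notin> set (path (next_vertex u v) v)"
proof -
  obtain xs where xs: "path u v = u # xs"
    using path[OF assms(1,2)] by (cases "path u v") (auto simp: simple_path_def)
  with assms(3) path(3)[OF assms(1,2)] have ne: "xs \<noteq> []" by auto
  have n: "next_vertex u v = hd xs" by (simp add: next_vertex_def xs)
  have p: "simple_path E xs" "u \<notin> set xs" "{u, hd xs} \<in> E"
    using path(1)[OF assms(1,2)] ne unfolding xs simple_path_Cons by auto
  show e: "{u, next_vertex u v} \<in> E" using p n by simp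
  then show w: "next_vertex u v \<in> W" using edge_in by blast
  have "path (next_vertex u v) v = xs"
    using path(3)[OF assms(1,2)] xs ne p n w assms by (intro path_eqI) auto
  then show "path u v = u # path (next_vertex u v) v" "u \<notin> set (path (next_vertex u v) v)"
    using xs p by auto
qed

lemma hops_next: "u \<in> W \<Longrightarrow> v \<in> W \<Longrightarrow> u \<noteq> v \<Longrightarrow> hops u v = Suc (hops (next_vertex u v) v)"
  using hops_path[of u v] hops_path[of "next_vertex u v" v] path_Cons[of u v] by simp

lemma hops_sym: "u \<in> W \<Longrightarrow> v \<in> W \<Longrightarrow> hops u v = hops v u"
  using hops_path[of u v] hops_path[of v u] path_rev[of u v] by simp

lemma hops_self [simp]: "u \<in> W \<Longrightarrow> hops u u = 0"
  using hops_path[of u u] path_eqI[of "[u]" u u] by (simp add: simple_path_def)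

text \<open>An edge at \<open>u\<close> that is not the first step towards \<open>v\<close> leads
  away from \<open>v\<close>: if \<open>q\<close> were on the path, its initial segment up to
  \<open>q\<close> would close a cycle with this edge. So \<open>q\<close> put in front of the path
  is again a path.\<close>

lemma next_back:
  assumes "{u, q} \<in> E" "v \<in> W" "u \<noteq> v" "q \<noteq> next_vertex u v"
  shows "next_vertex q v = u" "q \<noteq> v"
proof -
  have uq: "u \<in> W" "q \<in> W" "u \<noteq> q" using assms(1) edge_in by auto
  have q: "q \<notin> set (path u v)"
  proof
    assume "q \<in> set (path u v)"
    then obtain p p' where p: "path u v = p @ q # p'" by (meson split_list)
    have pc: "path u v = u # path (next_vertex u v) v" using path_Cons uq assms by simp
    from p pc uq obtain p1 where p1: "p = u # p1" by (cases p) auto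
    have "simple_path E (p @ [q])"
      using simple_path_appendD(1)[of E "p @ [q]" p'] path(1)[OF uq(1) assms(2)] p by simp
    moreover have "p1 \<noteq> []"
      using assms(4) p p1 unfolding next_vertex_def by auto
    then have "3 \<le> length (p @ [q])" using p1 by (cases p1) auto
    ultimately show False using no_cycle[of "p @ [q]"] p1 assms(1) by (simp add: insert_commute)
  qed
  have ne: "path u v \<noteq> []" using path(1)[OF uq(1) assms(2)] by (simp add: simple_path_def)
  have "path q v = q # path u v"
    using uq assms path[OF uq(1) assms(2)] q ne
    by (intro path_eqI) (auto simp: simple_path_Cons insert_commute)
  then show "next_vertex q v = u"
    using ne path(2)[OF uq(1) assms(2)] by (simp add: next_vertex_def)
  show "q \<noteq> v" using q ne path(3)[OF uq(1) assms(2)] last_in_set by metis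
qed

text \<open>Otherwise \<open>next_back\<close>, with \<open>q\<close> as its own target, would yield
  \<open>q \<noteq> q\<close>.\<close>

lemma next_vertex_neighbor:
  assumes "{u, q} \<in> E"
  shows "next_vertex u q = q"
proof (rule ccontr)
  assume "next_vertex u q \<noteq> q"
  then show False using next_back(2)[of u q q] assms edge_in[OF assms] by auto
qed

text \<open>If the step \<open>w\<close> from \<open>u\<close> towards \<open>j\<close> did not lead
  towards \<open>i\<close>, it would lead away from \<open>i\<close>. Counting hops then gives
  \<open>hops w i = hops w j + 3\<close>, although \<open>i\<close> and \<open>j\<close> are
  adjacent.\<close>

lemma next_vertex_extend:
  assumes "i \<in> W" "u \<in> W" "i \<noteq> u" "next_vertex i u = j" "u \<noteq> j"
  shows "next_vertex u i = next_vertex u j"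
proof (rule ccontr)
  assume ne: "next_vertex u i \<noteq> next_vertex u j"
  let ?w = "next_vertex u j"
  have j: "j \<in> W" "{i, j} \<in> E" using path_Cons assms by auto
  have w: "?w \<in> W" "{u, ?w} \<in> E" using path_Cons assms j by auto
  have 1: "next_vertex ?w i = u" "?w \<noteq> i"
    using next_back[of u ?w i] w assms ne by auto
  have 2: "hops ?w i = Suc (hops u i)" using hops_next[of ?w i] 1 w assms by auto
  have 3: "hops u i = Suc (hops u j)"
    using hops_next[of i u] assms hops_sym[of u i] hops_sym[of j u] j by simp
  have 4: "hops u j = Suc (hops ?w j)" using hops_next[of u j] assms j by simp
  show False
  proof (cases "?w = j")
    case True
    then have "hops ?w i = Suc 0"
      using hops_next[of j i] next_vertex_neighbor[of j i] j edge_in[OF j(2)] assms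
      by (auto simp: insert_commute)
    then show ?thesis using 2 3 by simp
  next
    case False
    show ?thesis
    proof (cases "next_vertex j ?w = i")
      case True
      then have "hops j ?w = Suc (hops i ?w)" using hops_next[of j ?w] j w False by auto
      then show ?thesis using 2 3 4 hops_sym[of j ?w] hops_sym[of i ?w] j w assms by simp
    next
      case F: False
      then have "next_vertex i ?w = j" using next_back[of j i ?w] j w False by (auto simp: insert_commute)
      then have "hops i ?w = Suc (hops j ?w)" using hops_next[of i ?w] 1 w assms by auto
      then show ?thesis using 2 3 4 hops_sym[of j ?w] hops_sym[of i ?w] j w assms by simp
    qed
  qed
qed

text \<open>Vertices in different branches at \<open>x\<close> are joined only through
  \<open>x\<close>, so the path to \<open>b\<close> starts like the path to \<open>x\<close>. The
  induction moves \<open>a\<close> towards \<open>x\<close>; by \<open>next_vertex_extend\<close> it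
  stays in its branch until it arrives.\<close>

lemma next_vertex_through:
  assumes "a \<in> W" "x \<in> W" "b \<in> W" "a \<noteq> x" "b \<noteq> x" "next_vertex x a \<noteq> next_vertex x b"
  shows "a \<noteq> b \<and> next_vertex a b = next_vertex a x"
  using assms
proof (induction "hops a x" arbitrary: a)
  case 0
  then show ?case using hops_next[of a x] by simp
next
  case (Suc n)
  define c where "c = next_vertex a x"
  have c: "c \<in> W" "{a, c} \<in> E" using path_Cons Suc.prems c_def by auto
  have ab: "a \<noteq> b" using Suc.prems by auto
  show ?case
  proof (cases "c = x")
    case True
    then have "next_vertex x a = a" using c next_vertex_neighbor by (simp add: insert_commute)
    then show ?thesis
      using next_back[of x a b] True c Suc.prems ab c_def by (auto simp: insert_commute)
  next
    case False
    have h: "n = hops c x" using Suc.hyps(2) hops_next[of a x] Suc.prems c_def by simp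
    have nx: "next_vertex x a = next_vertex x c"
      using next_vertex_extend[of a x c] Suc.prems c_def False by auto
    have IH: "c \<noteq> b" "next_vertex c b = next_vertex c x"
      using Suc.hyps(1)[OF h] Suc.prems c False nx by auto
    have "next_vertex c x \<noteq> a"
    proof
      assume "next_vertex c x = a"
      then have "hops c x = Suc (hops a x)" using hops_next[of c x] c Suc.prems False by simp
      then show False using h Suc.hyps(2) by simp
    qed
    then have "next_vertex a b = c"
      using next_back[of c a b] IH c Suc.prems by (auto simp: insert_commute)
    then show ?thesis using ab c_def by simp
  qed
qed

end

section \<open>Positive additive distances on a tree\<close>

locale metric_tree = tree +
  fixes d :: "'a \<Rightarrow> 'a \<Rightarrow> real"
  assumes d_self [simp]: "d u u = 0"
    and d_sym: "d u v = d v u"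
    and d_edge: "{u, v} \<in> E \<Longrightarrow> 0 < d u v"
    and additive: "u \<in> W \<Longrightarrow> v \<in> W \<Longrightarrow> u \<noteq> v \<Longrightarrow> d u v = d u (next_vertex u v) + d (next_vertex u v) v"
begin

lemma d_pos: "u \<in> W \<Longrightarrow> v \<in> W \<Longrightarrow> u \<noteq> v \<Longrightarrow> 0 < d u v"
proof (induction "hops u v" arbitrary: u)
  case 0
  then show ?case using hops_next[of u v] by simp
next
  case (Suc n)
  have "0 \<le> d (next_vertex u v) v"
    using Suc.hyps(1)[of "next_vertex u v"] Suc.hyps(2) hops_next[of u v] Suc.prems path_Cons(1)[of u v]
    by (cases "next_vertex u v = v") auto
  then show ?case using additive[of u v] d_edge[of u "next_vertex u v"] path_Cons(2)[of u v] Suc.prems by auto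
qed

text \<open>The locale splits off only the first edge of a path. Walking from \<open>a\<close> to
  \<open>x\<close> edge by edge, the paths to \<open>x\<close> and to \<open>b\<close> share every
  step, so the same edge lengths are split off both distances.\<close>

lemma d_through:
  assumes "a \<in> W" "x \<in> W" "b \<in> W" "a \<noteq> x" "b \<noteq> x" "next_vertex x a \<noteq> next_vertex x b"
  shows "d a b = d a x + d x b"
  using assms
proof (induction "hops a x" arbitrary: a)
  case 0
  then show ?case using hops_next[of a x] by simp
next
  case (Suc n)
  define c where "c = next_vertex a x"
  have c: "c \<in> W" "{a, c} \<in> E" using path_Cons Suc.prems c_def by auto
  have n: "a \<noteq> b" "next_vertex a b = c" using next_vertex_through[of a x b] Suc.prems c_def by auto
  have *: "d a b = d a c + d c b" "d a x = d a c + d c x"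
    using additive[of a b] additive[of a x] n Suc.prems c_def by auto
  show ?case
  proof (cases "c = x")
    case True
    then show ?thesis using *(1) by simp
  next
    case False
    have h: "n = hops c x" using Suc.hyps(2) hops_next[of a x] Suc.prems c_def by simp
    have "next_vertex x a = next_vertex x c"
      using next_vertex_extend[of a x c] Suc.prems c_def False by auto
    then show ?thesis using Suc.hyps(1)[OF h] Suc.prems c False * by auto
  qed
qed

end

section \<open>Subtrees and leaf removal\<close>

context tree
begin

lemma hops_farther:
  assumes "{u, q} \<in> E" "v \<in> W" "u \<noteq> v" "q \<noteq> next_vertex u v"
  shows "hops q v = Suc (hops u v)"
  using next_back[OF assms] hops_next[of q v] edge_in[OF assms(1)] assms(2) by auto

text \<open>Convexity: closure under first steps gives, by iteration, closure under whole paths.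
  Distances and directions inside \<open>U\<close> are therefore those of the full tree.\<close>

definition subtree :: "'v set \<Rightarrow> bool" where
  "subtree U \<longleftrightarrow> U \<subseteq> W \<and> U \<noteq> {} \<and> (\<forall>u\<in>U. \<forall>v\<in>U. u \<noteq> v \<longrightarrow> next_vertex u v \<in> U)"

text \<open>In a subtree with two vertices each is a leaf at the other. This symmetric case is
  excluded by \<open>leaf_parent_not_leaf\<close> as long as three vertices are active.\<close>

definition leaf :: "'v set \<Rightarrow> 'v \<Rightarrow> 'v \<Rightarrow> bool" where
  "leaf U i j \<longleftrightarrow> i \<in> U \<and> neighbors E i \<inter> U = {j}"

lemma subtree_all: "subtree W"
  using vertices_nonempty path_Cons(1) by (auto simp: subtree_def)

lemma subtree_finite: "subtree U \<Longrightarrow> finite U"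
  using finite_vertices finite_subset by (auto simp: subtree_def)

lemma neighbors_iff: "j \<in> neighbors E i \<longleftrightarrow> {i, j} \<in> E"
  by (simp add: neighbors_def)

lemma subtree_next:
  assumes "subtree U" "u \<in> U" "v \<in> U" "u \<noteq> v"
  shows "next_vertex u v \<in> U" "{u, next_vertex u v} \<in> E" "next_vertex u v \<in> neighbors E u \<inter> U"
  using assms path_Cons[of u v] by (auto simp: subtree_def neighbors_iff)

lemma leafD:
  assumes "leaf U i j"
  shows "i \<in> U" "j \<in> U" "{i, j} \<in> E" "i \<noteq> j" "\<And>q. {i, q} \<in> E \<Longrightarrow> q \<in> U \<Longrightarrow> q = j"
  using assms edge_in[of i j] by (auto simp: leaf_def neighbors_def)

lemma leaf_next:
  assumes "subtree U" "leaf U i j" "k \<in> U" "k \<noteq> i"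
  shows "next_vertex i k = j"
  using subtree_next[OF assms(1) leafD(1)[OF assms(2)] assms(3)] leafD(5)[OF assms(2)] assms(4) by auto

lemma next_next_ne:
  assumes "u \<in> W" "v \<in> W" "u \<noteq> v" "next_vertex u v \<noteq> v"
  shows "next_vertex (next_vertex u v) v \<noteq> u"
  using hops_next[of u v] hops_next[of "next_vertex u v" v] path_Cons(1)[of u v] assms by auto

text \<open>A path in \<open>U\<close> cannot pass through a leaf, since it would enter and leave by
  different neighbours. So any set of leaves can be removed at once, as long as something
  remains.\<close>

lemma subtree_remove_leaves:
  assumes U: "subtree U" and L: "\<And>i. i \<in> L \<Longrightarrow> \<exists>j. leaf U i j" and ne: "U - L \<noteq> {}"
  shows "subtree (U - L)"
  unfolding subtree_def
proof (intro conjI ballI impI)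
  show "U - L \<subseteq> W" "U - L \<noteq> {}" using U ne by (auto simp: subtree_def)
next
  fix u v assume uv: "u \<in> U - L" "v \<in> U - L" "u \<noteq> v"
  let ?i = "next_vertex u v"
  have i: "?i \<in> U" "{u, ?i} \<in> E" using subtree_next[OF U] uv by auto
  show "?i \<in> U - L"
  proof (rule ccontr)
    assume "\<not> ?thesis"
    then have iL: "?i \<in> L" using i by auto
    then obtain j where j: "leaf U ?i j" using L by blast
    have "?i \<noteq> v" using iL uv by auto
    then have "next_vertex ?i v = j" using leaf_next[OF U j] uv by auto
    moreover have "u = j" using leafD(5)[OF j] i uv by (auto simp: insert_commute)
    ultimately show False using next_next_ne[of u v] U uv \<open>?i \<noteq> v\<close> by (auto simp: subtree_def)
  qed
qed

text \<open>Any neighbour other than the next vertex towards \<open>v\<close> leads away from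
  \<open>v\<close> and would be farther.\<close>

lemma farthest_is_leaf:
  assumes U: "subtree U" and u: "u \<in> U" "v \<in> U" "u \<noteq> v" and max: "\<And>w. w \<in> U \<Longrightarrow> hops w v \<le> hops u v"
  shows "leaf U u (next_vertex u v)"
proof -
  have UW: "U \<subseteq> W" using U by (simp add: subtree_def)
  have "q = next_vertex u v" if "{u, q} \<in> E" "q \<in> U" for q
  proof (rule ccontr)
    assume "q \<noteq> next_vertex u v"
    then have "hops q v = Suc (hops u v)" using hops_farther[OF that(1)] u UW by blast
    then show False using max[OF that(2)] by simp
  qed
  then have "neighbors E u \<inter> U \<subseteq> {next_vertex u v}" by (auto simp only: neighbors_def)
  then show ?thesis using subtree_next(3)[OF U u] u by (auto simp: leaf_def)
qed

lemma ex_leaf: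
  assumes U: "subtree U" and 2: "2 \<le> card U"
  shows "\<exists>i j. leaf U i j"
proof -
  obtain v where v: "v \<in> U" using U by (auto simp: subtree_def)
  have fin: "finite U" by (rule subtree_finite[OF U])
  have "U \<noteq> {v}" using 2 by auto
  then obtain w where w: "w \<in> U" "w \<noteq> v" using v by blast
  obtain u where u: "u \<in> U" "hops u v = Max ((\<lambda>u. hops u v) ` U)"
    using Max_in[of "(\<lambda>u. hops u v) ` U"] fin v by fastforce
  have m: "hops w' v \<le> hops u v" if "w' \<in> U" for w'
    using u that fin by simp
  have UW: "U \<subseteq> W" using U by (simp add: subtree_def)
  have "0 < hops w v" using hops_next[of w v] w v UW by (metis subsetD zero_less_Suc)
  then have "u \<noteq> v" using m[OF w(1)] v UW by (metis hops_self leD subsetD)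
  then show ?thesis using farthest_is_leaf[OF U u(1) v] m by blast
qed

text \<open>The induction common to both models. \<open>P\<close> is the model property restricted
  to a subtree, and a step has to factor only the values at the removed leaf through its neighbour;
  pairs of remaining vertices are left to the induction.\<close>

lemma leaf_elimination:
  fixes r :: "'v \<Rightarrow> 'v \<Rightarrow> real"
  assumes sym: "\<And>u v. r u v = r v u"
    and init: "P W"
    and step: "\<And>U i j. subtree U \<Longrightarrow> leaf U i j \<Longrightarrow> P U \<Longrightarrow>
      P (U - {i}) \<and> (\<forall>k\<in>U - {i, j}. r i k = r i j * r j k)"
    and uv: "u \<in> W" "v \<in> W" "u \<noteq> v" "next_vertex u v \<noteq> v"
  shows "r u v = r u (next_vertex u v) * r (next_vertex u v) v"
proof -
  have "\<forall>u\<in>U. \<forall>v\<in>U. u \<noteq> v \<longrightarrow> next_vertex u v \<noteq> v \<longrightarrow>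
      r u v = r u (next_vertex u v) * r (next_vertex u v) v" if "subtree U" "P U" for U
    using that
  proof (induction "card U" arbitrary: U)
    case 0
    then show ?case using subtree_finite[of U] by auto
  next
    case (Suc n)
    note U = Suc.prems(1)
    have UW: "U \<subseteq> W" using U by (simp add: subtree_def)
    show ?case
    proof (cases "n = 0")
      case True
      then have "card U = 1" using Suc by simp
      then show ?thesis by (auto simp: card_1_singleton_iff)
    next
      case False
      then have "2 \<le> card U" using Suc.hyps(2) by simp
      then obtain i j where ij: "leaf U i j" using ex_leaf[OF U] by auto
      note l = leafD[OF ij]
      have U': "subtree (U - {i})"
        by (rule subtree_remove_leaves[OF U]) (use ij l(2,4) in auto)
      have st: "P (U - {i})" "\<And>k. k \<in> U - {i, j} \<Longrightarrow> r i k = r i j * r j k"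
        using step[OF U ij Suc.prems(2)] by auto
      have card: "n = card (U - {i})" using Suc.hyps(2) l(1) subtree_finite[OF U] by simp
      note IH = Suc.hyps(1)[OF card U' st(1)]
      show ?thesis
      proof (intro ballI impI)
        fix u v assume uv: "u \<in> U" "v \<in> U" "u \<noteq> v" "next_vertex u v \<noteq> v"
        let ?w = "next_vertex u v"
        consider "u = i" | "v = i" "u \<noteq> i" | "u \<noteq> i" "v \<noteq> i" by blast
        then show "r u v = r u ?w * r ?w v"
        proof cases
          case 1
          then have "?w = j" using leaf_next[OF U ij] uv by auto
          then show ?thesis using st(2)[of v] 1 uv by auto
        next
          \<comment> \<open>The path ends in the leaf. Both \<open>r u i\<close> and
            \<open>r ?w i\<close> factor through \<open>j\<close>, and the induction hypothesis
            splits \<open>r u j\<close> at \<open>?w\<close>; the factor \<open>r j i\<close> is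
            common to both sides.\<close>
          case 2
          have uj: "u \<noteq> j" using 2 uv next_vertex_neighbor[of u i] l(3) by (auto simp: insert_commute)
          have "next_vertex i u = j" using leaf_next[OF U ij] uv 2 by auto
          then have w: "?w = next_vertex u j"
            using next_vertex_extend[of i u j] uv UW 2 uj by blast
          have 1: "r u v = r u j * r j i" using st(2)[of u] uv 2 uj by (simp add: sym[of u i] sym[of u j] sym[of j i])
          show ?thesis
          proof (cases "?w = j")
            case True
            then show ?thesis using 1 2 by simp
          next
            case False
            have "?w \<in> U - {i, j}" using False uv 2 subtree_next[OF U uv(1,2,3)] by auto
            then have "r ?w i = r ?w j * r j i"
              using st(2)[of ?w] by (simp add: sym[of ?w i] sym[of ?w j] sym[of j i])
            moreover have "r u j = r u ?w * r ?w j"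
              using IH uv uj 2 l(2,4) w False by auto
            ultimately show ?thesis using 1 2 by simp
          qed
        next
          case 3
          then show ?thesis using IH uv by auto
        qed
      qed
    qed
  qed
  then show ?thesis using subtree_all init uv by blast
qed

text \<open>Multiplicativity is asked only of non-adjacent pairs, since for an edge it would amount
  to \<open>r v v = 1\<close>. It carries positivity from the edges to all pairs, which justifies
  the logarithm of a product.\<close>

lemma metric_tree_of_multiplicative:
  fixes r :: "'v \<Rightarrow> 'v \<Rightarrow> real"
  assumes sym: "\<And>u v. r u v = r v u"
    and edge: "\<And>u v. {u, v} \<in> E \<Longrightarrow> 0 < r u v \<and> r u v < 1"
    and mult: "\<And>u v. u \<in> W \<Longrightarrow> v \<in> W \<Longrightarrow> u \<noteq> v \<Longrightarrow> next_vertex u v \<noteq> v \<Longrightarrow>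
      r u v = r u (next_vertex u v) * r (next_vertex u v) v"
  shows "metric_tree W E (\<lambda>u v. if u = v then 0 else - ln (r u v))"
proof
  have pos: "0 < r u v" if "u \<in> W" "v \<in> W" "u \<noteq> v" for u v
    using that
  proof (induction "hops u v" arbitrary: u)
    case 0
    then show ?case using hops_next[of u v] by simp
  next
    case (Suc n)
    then show ?case
      using edge[of u "next_vertex u v"] path_Cons[of u v] hops_next[of u v] mult[of u v]
      by (cases "next_vertex u v = v") auto
  qed
  show "(if u = v then 0 else - ln (r u v)) =
      (if u = next_vertex u v then 0 else - ln (r u (next_vertex u v))) +
      (if next_vertex u v = v then 0 else - ln (r (next_vertex u v) v))"
    if "u \<in> W" "v \<in> W" "u \<noteq> v" for u v
  proof -
    have "u \<noteq> next_vertex u v" using path_Cons(2)[OF that] edge_in by blast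
    then show ?thesis
      using mult[OF that] that pos[of u "next_vertex u v"] pos[of "next_vertex u v" v] path_Cons(1)[OF that]
      by (auto simp: ln_mult)
  qed
qed (use sym edge in \<open>auto dest: edge_in\<close>)

text \<open>
  The linear Markov property survives the removal of a leaf because no edge carries
  correlation \<open>\<plusminus>1\<close>.
\<close>

lemma multiplicative_of_linear_markov:
  fixes C :: "'v \<Rightarrow> 'v \<Rightarrow> real"
  assumes sym: "\<And>u v. C u v = C v u"
    and pos: "\<And>u. u \<in> W \<Longrightarrow> 0 < C u u"
    and edge: "\<And>u v. {u, v} \<in> E \<Longrightarrow> C u v \<noteq> 0 \<and> (C u v)\<^sup>2 < C u u * C v v"
    and null: "\<And>N c k. N \<subseteq> W \<Longrightarrow> k \<in> W \<Longrightarrow> (\<And>k. k \<in> N \<Longrightarrow> (\<Sum>j\<in>N. c j * C j k) = 0) \<Longrightarrow>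
      (\<Sum>j\<in>N. c j * C j k) = 0"
    and markov: "\<And>i. i \<in> W \<Longrightarrow> \<exists>c. \<forall>k\<in>W - {i}. C i k = (\<Sum>j\<in>neighbors E i. c j * C j k)"
    and uv: "u \<in> W" "v \<in> W" "u \<noteq> v" "next_vertex u v \<noteq> v"
  defines "r \<equiv> \<lambda>u v. \<bar>C u v / sqrt (C u u * C v v)\<bar>"
  shows "r u v = r u (next_vertex u v) * r (next_vertex u v) v"
proof -
  \<comment> \<open>The linear shadow of the Markov property: inside \<open>U\<close> the
    covariances of \<open>i\<close> are a fixed combination of those of its neighbours.\<close>
  define P where "P U \<longleftrightarrow> (\<forall>i\<in>U. \<exists>c. \<forall>k\<in>U - {i}. C i k = (\<Sum>j\<in>neighbors E i \<inter> U. c j * C j k))" for U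
  show ?thesis
  proof (rule leaf_elimination[where P = P, OF _ _ _ uv])
    show "r u v = r v u" for u v using sym[of u v] by (simp add: r_def mult.commute)
  next
    have "neighbors E i \<inter> W = neighbors E i" for i using edge_in by (auto simp: neighbors_def)
    then show "P W" using markov by (simp add: P_def)
  next
    fix U i j assume U: "subtree U" and ij: "leaf U i j" and P: "P U"
    note l = leafD[OF ij]
    have UW: "U \<subseteq> W" using U by (simp add: subtree_def)
    then have pj: "C j j > 0" "C i i > 0" using l(1,2) pos by auto
    obtain c where c: "\<And>k. k \<in> U - {i} \<Longrightarrow> C i k = c j * C j k"
      using P ij unfolding P_def leaf_def by force
    define a where "a = c j"
    have a: "C i k = a * C j k" if "k \<in> U - {i}" for k using c that a_def by simp
    have aj: "C i j = a * C j j" using a l(2,4) by auto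
    have "r i k = r i j * r j k" if k: "k \<in> U - {i, j}" for k
    proof -
      have pk: "C k k > 0" using k UW pos by auto
      have "C i k / sqrt (C i i * C k k) =
          (C i j / sqrt (C i i * C j j)) * (C j k / sqrt (C j j * C k k))"
        using a[of k] aj k pj pk by (simp add: real_sqrt_mult field_simps)
      then show ?thesis unfolding r_def abs_mult[symmetric] by simp
    qed
    moreover have "P (U - {i})"
      unfolding P_def
    proof
      fix x assume x: "x \<in> U - {i}"
      obtain b where b: "\<And>k. k \<in> U - {x} \<Longrightarrow> C x k = (\<Sum>j\<in>neighbors E x \<inter> U. b j * C j k)"
        using P x unfolding P_def by blast
      let ?N = "neighbors E x \<inter> (U - {i})"
      show "\<exists>c. \<forall>k\<in>U - {i} - {x}. C x k = (\<Sum>j\<in>?N. c j * C j k)"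
      proof (cases "x = j")
        case False
        then have "neighbors E x \<inter> U = ?N" using l(5)[of x] x by (auto simp: neighbors_iff insert_commute)
        then show ?thesis using b by auto
      next
        case x: True
        have "neighbors E j \<inter> U = insert i ?N" using l(1-4) x by (auto simp: neighbors_iff insert_commute)
        moreover have "finite ?N" using subtree_finite[OF U] by simp
        ultimately have b': "C j k = b i * C i k + (\<Sum>j\<in>?N. b j * C j k)" if "k \<in> U - {j}" for k
          using b[of k] that x by simp
        \<comment> \<open>Substituting \<open>C i k = a * C j k\<close> eliminates the leaf from the
          relation at \<open>j\<close>, which can be solved for \<open>C j k\<close> unless
          \<open>a * b i = 1\<close>.\<close>
        have e: "(1 - a * b i) * C j k = (\<Sum>j\<in>?N. b j * C j k)" if "k \<in> U - {i, j}" for k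
          using b'[of k] a[of k] that by (simp add: algebra_simps)
        \<comment> \<open>If \<open>a * b i = 1\<close>, the combination over \<open>?N\<close> is
          orthogonal to its own terms, hence to everything. Then \<open>C j i = b i * C i i\<close>,
          and with \<open>C i j = a * C j j\<close> the edge would satisfy
          \<open>(C i j)\<^sup>2 = C i i * C j j\<close>.\<close>
        have ab: "a * b i \<noteq> 1"
        proof
          assume ab: "a * b i = 1"
          have NU: "?N \<subseteq> U - {i, j}" using x edge_in[of j j] by (auto simp: neighbors_iff)
          have "(\<Sum>j\<in>?N. b j * C j k) = 0" if "k \<in> W" for k
          proof (rule null)
            show "?N \<subseteq> W" using UW by auto
            show "(\<Sum>j\<in>?N. b j * C j k) = 0" if "k \<in> ?N" for k using e[of k] ab that NU by auto
          qed (use that in auto)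
          then have "C j i = b i * C i i" using b'[of i] l(1-4) UW by auto
          then have "(C i j)\<^sup>2 = (a * b i) * (C i i * C j j)"
            using aj sym[of i j] by (simp add: power2_eq_square)
          then show False using edge[OF l(3)] ab by simp
        qed
        show ?thesis
        proof (intro exI ballI)
          fix k assume k: "k \<in> U - {i} - {x}"
          have "C j k = (\<Sum>j\<in>?N. b j * C j k) / (1 - a * b i)"
            using e[of k] k x ab by (auto simp: field_simps)
          also have "\<dots> = (\<Sum>j\<in>?N. (b j / (1 - a * b i)) * C j k)" by (simp add: sum_divide_distrib)
          finally show "C x k = (\<Sum>j\<in>?N. (b j / (1 - a * b i)) * C j k)" using x by simp
        qed
      qed
    qed
    ultimately show "P (U - {i}) \<and> (\<forall>k\<in>U - {i, j}. r i k = r i j * r j k)" by blast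
  qed
qed

end

section \<open>Characteristic functions and conditional independence\<close>

context prob_space
begin

lemma integrable_mult_iexp [intro]:
  fixes Y :: "'a \<Rightarrow> complex"
  assumes [measurable]: "integrable M Y" "X \<in> borel_measurable M"
  shows "integrable M (\<lambda>\<omega>. Y \<omega> * iexp (X \<omega>))"
  by (rule Bochner_Integration.integrable_bound[OF assms(1)]) (auto simp: norm_mult)

lemma integrable_mult_indicator_comp [intro]:
  fixes Y :: "'a \<Rightarrow> 'b :: {real_normed_algebra_1, second_countable_topology, banach}"
  assumes [measurable]: "integrable M Y" "X \<in> borel_measurable M" "B \<in> sets borel"
  shows "integrable M (\<lambda>\<omega>. Y \<omega> * indicator B (X \<omega> :: real))"
  by (rule Bochner_Integration.integrable_bound[OF assms(1)]) (auto simp: indicator_def)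

text \<open>
  The positive and the negative part of \<open>Y\<close>, normalised, push forward to distributions with the
  same characteristic function.
\<close>

lemma integral_indicator_eq_0_of_char:
  fixes X Y :: "'a \<Rightarrow> real"
  assumes Y [measurable]: "integrable M Y" and X [measurable]: "X \<in> borel_measurable M"
    and char: "\<And>b. (CLINT \<omega>|M. of_real (Y \<omega>) * iexp (b * X \<omega>)) = 0"
    and B [measurable]: "B \<in> sets borel"
  shows "(LINT \<omega>|M. Y \<omega> * indicator B (X \<omega>)) = 0"
proof -
  define P where "P = (\<lambda>\<omega>. max 0 (Y \<omega>))"
  define N where "N = (\<lambda>\<omega>. max 0 (- Y \<omega>))"
  have PN: "integrable M P" "integrable M N" "\<And>\<omega>. 0 \<le> P \<omega>" "\<And>\<omega>. 0 \<le> N \<omega>" "\<And>\<omega>. Y \<omega> = P \<omega> - N \<omega>"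
    using Y by (auto simp: P_def N_def)
  note [measurable] = PN(1,2)
  define c where "c = (LINT \<omega>|M. P \<omega>)"
  \<comment> \<open>Frequency zero shows that the positive and the negative part have the same mass,
    so one constant normalises both.\<close>
  have "(LINT \<omega>|M. Y \<omega>) = 0" using char[of 0] by simp
  then have cN: "c = (LINT \<omega>|M. N \<omega>)" using PN by (simp add: c_def)
  have c0: "0 \<le> c" unfolding c_def by (intro integral_nonneg_AE) (use PN in auto)
  show ?thesis
  proof (cases "c = 0")
    \<comment> \<open>No normalisation is possible here, but then \<open>Y\<close> vanishes almost
      everywhere.\<close>
    case True
    then have "AE \<omega> in M. P \<omega> = 0" "AE \<omega> in M. N \<omega> = 0"
      using integral_nonneg_eq_0_iff_AE[of M P] integral_nonneg_eq_0_iff_AE[of M N] PN c_def cN by auto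
    then have "AE \<omega> in M. Y \<omega> * indicator B (X \<omega>) = 0" by eventually_elim (use PN in auto)
    then show ?thesis by (rule integral_eq_zero_AE)
  next
    case False
    with c0 have c: "c > 0" by simp
    define \<mu> where "\<mu> f = distr (density M (\<lambda>\<omega>. ennreal (f \<omega> / c))) borel X" for f :: "'a \<Rightarrow> real"
    have int: "integral\<^sup>L (\<mu> f) g = (LINT \<omega>|M. (f \<omega> / c) *\<^sub>R g (X \<omega>))"
      if [measurable]: "integrable M f" "g \<in> borel_measurable borel" and "\<And>\<omega>. 0 \<le> f \<omega>"
      for f and g :: "real \<Rightarrow> 'b :: {banach, second_countable_topology}"
      unfolding \<mu>_def using that(3) c
      by (subst integral_distr, simp, simp) (subst integral_density, auto)
    have dist: "real_distribution (\<mu> f)"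
      if [measurable]: "integrable M f" and f: "\<And>\<omega>. 0 \<le> f \<omega>" "integral\<^sup>L M f = c" for f
    proof -
      have "prob_space (density M (\<lambda>\<omega>. ennreal (f \<omega> / c)))"
      proof
        have "(\<integral>\<^sup>+ \<omega>. ennreal (f \<omega> / c) \<partial>M) = ennreal (LINT \<omega>|M. f \<omega> / c)"
          by (rule nn_integral_eq_integral) (use that c in auto)
        then show "emeasure (density M (\<lambda>\<omega>. ennreal (f \<omega> / c))) (space (density M (\<lambda>\<omega>. ennreal (f \<omega> / c)))) = 1"
          using f c by (subst emeasure_density) (auto cong: nn_integral_cong)
      qed
      then have "prob_space (\<mu> f)"
        unfolding \<mu>_def by (rule prob_space.prob_space_distr) simp
      then show ?thesis
        by (auto simp: real_distribution_def real_distribution_axioms_def \<mu>_def)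
    qed
    have "char (\<mu> P) = char (\<mu> N)"
    proof
      fix t
      have "char (\<mu> f) t = (CLINT \<omega>|M. of_real (f \<omega>) * iexp (t * X \<omega>)) / of_real c"
        if "integrable M f" "\<And>\<omega>. 0 \<le> f \<omega>" for f
        using that unfolding char_def by (subst int) (auto simp: scaleR_conv_of_real)
      moreover have "(CLINT \<omega>|M. of_real (P \<omega>) * iexp (t * X \<omega>)) = (CLINT \<omega>|M. of_real (N \<omega>) * iexp (t * X \<omega>))"
      proof -
        have i: "complex_integrable M (\<lambda>\<omega>. of_real (P \<omega>) * iexp (t * X \<omega>))"
          "complex_integrable M (\<lambda>\<omega>. of_real (N \<omega>) * iexp (t * X \<omega>))"
          by (rule integrable_mult_iexp; use PN in simp)+
        have "(CLINT \<omega>|M. of_real (P \<omega>) * iexp (t * X \<omega>)) - (CLINT \<omega>|M. of_real (N \<omega>) * iexp (t * X \<omega>)) =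
            (CLINT \<omega>|M. of_real (Y \<omega>) * iexp (t * X \<omega>))"
          by (subst Bochner_Integration.integral_diff[OF i, symmetric]) (simp add: PN(5) left_diff_distrib)
        then show ?thesis using char[of t] by simp
      qed
      ultimately show "char (\<mu> P) t = char (\<mu> N) t" using PN by simp
    qed
    then have eq: "\<mu> P = \<mu> N"
      by (intro Levy_uniqueness dist) (use PN c_def cN in auto)
    have "(LINT \<omega>|M. f \<omega> * indicator B (X \<omega>)) = c * (LINT x|\<mu> f. indicator B x)"
      if "integrable M f" "\<And>\<omega>. 0 \<le> f \<omega>" for f
      using that c by (subst int) auto
    then have "(LINT \<omega>|M. P \<omega> * indicator B (X \<omega>)) = (LINT \<omega>|M. N \<omega> * indicator B (X \<omega>))"
      using PN eq by simp
    then show ?thesis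
      using PN integrable_mult_indicator_comp[OF PN(1) X B] integrable_mult_indicator_comp[OF PN(2) X B]
      by (simp add: left_diff_distrib)
  qed
qed

text \<open>Real and imaginary part are combinations of \<open>Y\<close> and its conjugate.
  Conjugation turns the hypothesis at frequency \<open>- b\<close> into the one for the conjugate at
  \<open>b\<close>, so the real case applies to both parts.\<close>

lemma complex_integral_indicator_eq_0_of_char:
  fixes X :: "'a \<Rightarrow> real" and Y :: "'a \<Rightarrow> complex"
  assumes Y [measurable]: "integrable M Y" and X [measurable]: "X \<in> borel_measurable M"
    and char: "\<And>b. (CLINT \<omega>|M. Y \<omega> * iexp (b * X \<omega>)) = 0"
    and B [measurable]: "B \<in> sets borel"
  shows "(CLINT \<omega>|M. Y \<omega> * indicator B (X \<omega>)) = 0"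
proof -
  have cnj: "(CLINT \<omega>|M. cnj (Y \<omega>) * iexp (b * X \<omega>)) = 0" for b
  proof -
    have "(CLINT \<omega>|M. cnj (Y \<omega>) * iexp (b * X \<omega>)) = (CLINT \<omega>|M. cnj (Y \<omega> * iexp ((- b) * X \<omega>)))"
      by (simp add: exp_cnj)
    also have "\<dots> = cnj (CLINT \<omega>|M. Y \<omega> * iexp (- b * X \<omega>))"
      by (rule Bochner_Integration.integral_cnj)
    also have "\<dots> = 0" by (simp only: char[of "- b"] complex_cnj_zero)
    finally show ?thesis .
  qed
  have i: "integrable M (\<lambda>\<omega>. Y \<omega> * iexp (b * X \<omega>))" "integrable M (\<lambda>\<omega>. cnj (Y \<omega>) * iexp (b * X \<omega>))" for b
    by (rule integrable_mult_iexp; use Y in simp)+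
  have "(CLINT \<omega>|M. of_real (Re (Y \<omega>)) * iexp (b * X \<omega>)) =
      (CLINT \<omega>|M. (Y \<omega> * iexp (b * X \<omega>) + cnj (Y \<omega>) * iexp (b * X \<omega>)) / 2)" for b
    by (intro Bochner_Integration.integral_cong refl)
      (simp add: distrib_right[symmetric] complex_add_cnj)
  then have 1: "(CLINT \<omega>|M. of_real (Re (Y \<omega>)) * iexp (b * X \<omega>)) = 0" for b
    using i char cnj by simp
  have Im: "of_real (Im z) = (z - cnj z) / (2 * \<i>)" for z by (simp add: complex_diff_cnj complex_eq_iff)
  have "(CLINT \<omega>|M. of_real (Im (Y \<omega>)) * iexp (b * X \<omega>)) =
      (CLINT \<omega>|M. (Y \<omega> * iexp (b * X \<omega>) - cnj (Y \<omega>) * iexp (b * X \<omega>)) / (2 * \<i>))" for b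
    by (intro Bochner_Integration.integral_cong refl)
      (simp only: Im left_diff_distrib times_divide_eq_left)
  then have 2: "(CLINT \<omega>|M. of_real (Im (Y \<omega>)) * iexp (b * X \<omega>)) = 0" for b
    using i char cnj by simp
  have "(LINT \<omega>|M. Re (Y \<omega>) * indicator B (X \<omega>)) = 0" "(LINT \<omega>|M. Im (Y \<omega>) * indicator B (X \<omega>)) = 0"
    using integral_indicator_eq_0_of_char[OF _ X 1 B] integral_indicator_eq_0_of_char[OF _ X 2 B] Y by auto
  moreover have "integrable M (\<lambda>\<omega>. Y \<omega> * indicator B (X \<omega>))"
    by (rule integrable_mult_indicator_comp[OF Y X B])
  moreover have "Re (Y \<omega> * indicator B (X \<omega>)) = Re (Y \<omega>) * indicator B (X \<omega>)"
    "Im (Y \<omega> * indicator B (X \<omega>)) = Im (Y \<omega>) * indicator B (X \<omega>)" for \<omega>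
    by (auto simp: indicator_def)
  ultimately show ?thesis by (simp add: complex_eq_iff flip: integral_Re integral_Im)
qed

text \<open>Frequencies are traded for indicators one coordinate at a time. The factor
  \<open>iexp (t * X n)\<close> is first absorbed into \<open>Y\<close> to apply the induction
  hypothesis, which forces complex weights; afterwards the product over \<open>I\<close> is absorbed
  instead and coordinate \<open>n\<close> is treated alone.\<close>

lemma complex_integral_indicators_eq_0_of_char:
  fixes X :: "'i \<Rightarrow> 'a \<Rightarrow> real" and Y :: "'a \<Rightarrow> complex"
  assumes "finite I" "integrable M Y" "\<And>i. i \<in> I \<Longrightarrow> X i \<in> borel_measurable M"
    and "\<And>b. (CLINT \<omega>|M. Y \<omega> * iexp (\<Sum>i\<in>I. b i * X i \<omega>)) = 0"
    and "\<And>i. i \<in> I \<Longrightarrow> B i \<in> sets borel"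
  shows "(CLINT \<omega>|M. Y \<omega> * (\<Prod>i\<in>I. indicator (B i) (X i \<omega>))) = 0"
  using assms
proof (induction I arbitrary: Y rule: finite_induct)
  case empty
  then show ?case by simp
next
  case (insert n I)
  note [measurable] = insert.prems(2)[of n, simplified]
  have [measurable]: "X i \<in> borel_measurable M" if "i \<in> I" for i using insert.prems(2) that by simp
  have [measurable]: "B n \<in> sets borel" "\<And>i. i \<in> I \<Longrightarrow> B i \<in> sets borel" using insert.prems(4) by auto
  note [measurable] = insert.prems(1)
  let ?P = "\<lambda>\<omega>. (\<Prod>i\<in>I. indicator (B i) (X i \<omega>)) :: complex"
  have P: "norm (?P \<omega>) \<le> 1" for \<omega>
    unfolding prod_norm[symmetric] by (intro prod_le_1) (auto simp: indicator_def)
  have int: "integrable M (\<lambda>\<omega>. Y \<omega> * ?P \<omega>)"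
    by (rule Bochner_Integration.integrable_bound[OF insert.prems(1)])
      (use P in \<open>auto simp: norm_mult intro!: mult_left_le\<close>)
  have "(CLINT \<omega>|M. (Y \<omega> * ?P \<omega>) * iexp (t * X n \<omega>)) = 0" for t
  proof -
    have "(CLINT \<omega>|M. (Y \<omega> * iexp (t * X n \<omega>)) * ?P \<omega>) = 0"
    proof (rule insert.IH)
      show "integrable M (\<lambda>\<omega>. Y \<omega> * iexp (t * X n \<omega>))"
        by (rule integrable_mult_iexp) (use insert.prems(1) in auto)
      fix b
      have "(\<Sum>i\<in>insert n I. (b(n := t)) i * X i \<omega>) = t * X n \<omega> + (\<Sum>i\<in>I. b i * X i \<omega>)" for \<omega>
        using insert.hyps by (subst sum.insert) (auto intro!: sum.cong)
      then show "(CLINT \<omega>|M. Y \<omega> * iexp (t * X n \<omega>) * iexp (\<Sum>i\<in>I. b i * X i \<omega>)) = 0"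
        using insert.prems(3)[of "b(n := t)"] by (simp add: exp_add[symmetric] distrib_left mult.assoc)
    qed (use insert.prems in auto)
    then show ?thesis by (simp add: mult_ac)
  qed
  from complex_integral_indicator_eq_0_of_char[OF int _ this, of "B n"]
  show ?case using insert.hyps by (simp add: mult_ac)
qed


text \<open>Orthogonality to all events of \<open>X\<close> says that the conditional expectation of
  \<open>Y\<close> given \<open>X\<close> is zero. Integrability of the product lets
  \<open>X\<close> be pulled out, even if it is unbounded.\<close>

lemma integral_mult_eq_0_of_indicators:
  fixes X Y :: "'a \<Rightarrow> real"
  assumes Y: "integrable M Y" and X [measurable]: "X \<in> borel_measurable M"
    and XY: "integrable M (\<lambda>\<omega>. X \<omega> * Y \<omega>)"
    and ind: "\<And>B. B \<in> sets borel \<Longrightarrow> (LINT \<omega>|M. Y \<omega> * indicator B (X \<omega>)) = 0"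
  shows "(LINT \<omega>|M. X \<omega> * Y \<omega>) = 0"
proof -
  let ?F = "vimage_algebra (space M) X borel"
  have sF: "sets ?F = {X -` B \<inter> space M | B. B \<in> sets borel}"
    by (rule sets_vimage_algebra2) simp
  have "subalgebra M ?F" unfolding subalgebra_def sF by auto
  then interpret F: finite_measure_subalgebra M ?F
    by unfold_locales
  have "AE \<omega> in M. real_cond_exp M ?F Y \<omega> = 0"
  proof (rule F.real_cond_exp_charact)
    fix A assume "A \<in> sets ?F"
    then obtain B where B: "A = X -` B \<inter> space M" "B \<in> sets borel" unfolding sF by auto
    have "(LINT \<omega>:A|M. Y \<omega>) = (LINT \<omega>|M. Y \<omega> * indicator B (X \<omega>))"
      unfolding set_lebesgue_integral_def B
      by (intro Bochner_Integration.integral_cong) (auto simp: indicator_def)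
    then show "(LINT \<omega>:A|M. Y \<omega>) = (LINT \<omega>:A|M. 0)" using ind B by simp
  qed (use Y in auto)
  then have "AE \<omega> in M. X \<omega> * real_cond_exp M ?F Y \<omega> = 0" by eventually_elim simp
  then have "(LINT \<omega>|M. X \<omega> * real_cond_exp M ?F Y \<omega>) = 0" by (rule integral_eq_zero_AE)
  moreover have "X \<in> borel_measurable ?F" by (rule measurable_vimage_algebra1) simp
  ultimately show ?thesis using F.real_cond_exp_intg(2)[OF XY] Y by simp
qed

section \<open>Sigma-algebras generated by families of variables\<close>

context
  fixes X :: "'i \<Rightarrow> 'a \<Rightarrow> 'b" and N :: "'b measure" and I :: "'i set"
  assumes meas: "\<And>i. i \<in> I \<Longrightarrow> X i \<in> M \<rightarrow>\<^sub>M N"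
begin

lemma measurable_restrict_family: "(\<lambda>\<omega>. \<lambda>i\<in>I. X i \<omega>) \<in> M \<rightarrow>\<^sub>M Pi\<^sub>M I (\<lambda>_. N)"
  using meas by (rule measurable_restrict)

lemma sets_generated_by:
  "sets (generated_by M N X I) = {(\<lambda>\<omega>. \<lambda>i\<in>I. X i \<omega>) -` A \<inter> space M | A. A \<in> sets (Pi\<^sub>M I (\<lambda>_. N))}"
  unfolding generated_by_def
  by (rule sets_vimage_algebra2) (use measurable_space[OF measurable_restrict_family] in auto)

lemma subalgebra_generated_by: "subalgebra M (generated_by M N X I)"
  using measurable_sets[OF measurable_restrict_family]
  unfolding subalgebra_def sets_generated_by by (auto simp: generated_by_def)

lemma measurable_generated_by:
  assumes "i \<in> I"
  shows "X i \<in> generated_by M N X I \<rightarrow>\<^sub>M N"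
proof -
  have "(\<lambda>\<omega>. \<lambda>i\<in>I. X i \<omega>) \<in> generated_by M N X I \<rightarrow>\<^sub>M Pi\<^sub>M I (\<lambda>_. N)"
    unfolding generated_by_def
    by (rule measurable_vimage_algebra1) (use measurable_space[OF measurable_restrict_family] in auto)
  from measurable_compose[OF this measurable_component_singleton[OF assms]]
  show ?thesis using assms by simp
qed

lemma vimage_generated_by:
  assumes "i \<in> I" "B \<in> sets N"
  shows "X i -` B \<inter> space M \<in> sets (generated_by M N X I)"
  using measurable_sets[OF measurable_generated_by[OF assms(1)] assms(2)]
  by (simp add: generated_by_def)

end

text \<open>A Dynkin argument. Rectangles are an intersection-stable generator, and the sets with
  vanishing integral are closed under disjoint countable unions and, since the full rectangle gives
  \<open>Y\<close> mean zero, under complements.\<close>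

lemma integral_indicator_generated_by_eq_0:
  fixes X :: "'i \<Rightarrow> 'a \<Rightarrow> real" and Y :: "'a \<Rightarrow> real"
  assumes I: "finite I" and Y: "integrable M Y" and X: "\<And>i. i \<in> I \<Longrightarrow> X i \<in> borel_measurable M"
    and rect: "\<And>B. (\<And>i. i \<in> I \<Longrightarrow> B i \<in> sets borel) \<Longrightarrow>
      (LINT \<omega>|M. Y \<omega> * (\<Prod>i\<in>I. indicator (B i) (X i \<omega>))) = 0"
    and A: "A \<in> sets (generated_by M borel X I)"
  shows "(LINT \<omega>|M. Y \<omega> * indicator A \<omega>) = 0"
proof -
  define T where "T = (\<lambda>\<omega>. \<lambda>i\<in>I. X i \<omega>)"
  let ?G = "prod_algebra I (\<lambda>_. borel :: real measure)"
  let ?\<Omega> = "\<Pi>\<^sub>E i\<in>I. (UNIV :: real set)"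
  have T: "T \<in> M \<rightarrow>\<^sub>M Pi\<^sub>M I (\<lambda>_. borel)" unfolding T_def by (rule measurable_restrict_family) (rule X)
  obtain B where B: "A = T -` B \<inter> space M" "B \<in> sets (Pi\<^sub>M I (\<lambda>_. borel))"
    using A sets_generated_by[of I X borel] X unfolding T_def by auto
  have sets: "sets (Pi\<^sub>M I (\<lambda>_. borel :: real measure)) = sigma_sets ?\<Omega> ?G" by (simp add: sets_PiM)
  have i: "integrable M (\<lambda>\<omega>. Y \<omega> * indicator B (T \<omega>))" if "B \<in> sigma_sets ?\<Omega> ?G" for B
  proof (rule Bochner_Integration.integrable_bound[OF Y])
    have "(\<lambda>\<omega>. indicator B (T \<omega>) :: real) \<in> borel_measurable M"
      by (rule measurable_compose[OF T]) (use that sets in \<open>auto intro: borel_measurable_indicator\<close>)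
    then show "(\<lambda>\<omega>. Y \<omega> * indicator B (T \<omega>)) \<in> borel_measurable M" using Y by auto
  qed (auto simp: indicator_def)
  have G: "?G \<subseteq> Pow ?\<Omega>" using prod_algebra_sets_into_space[of I "\<lambda>_. borel :: real measure"] by simp
  have Y0: "(LINT \<omega>|M. Y \<omega>) = 0" using rect[of "\<lambda>_. UNIV"] by simp
  have "(LINT \<omega>|M. Y \<omega> * indicator B (T \<omega>)) = 0"
    using Int_stable_prod_algebra[of I "\<lambda>_. borel"] G B(2)[unfolded sets]
  proof (induction rule: sigma_sets_induct_disjoint)
    case (basic R)
    then obtain B where R: "R = (\<Pi>\<^sub>E i\<in>I. B i)" "B \<in> (\<Pi> i\<in>I. sets borel)"
      by (auto simp: prod_algebra_eq_finite[OF I])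
    have e: "indicator R (T \<omega>) = (\<Prod>i\<in>I. indicator (B i) (X i \<omega>) :: real)" for \<omega>
      using I unfolding R T_def by (auto simp: indicator_def PiE_iff prod_zero_iff)
    show ?case unfolding e by (rule rect) (use R in auto)
  next
    case empty
    then show ?case by simp
  next
    case (compl R)
    have "indicator (?\<Omega> - R) (T \<omega>) = 1 - (indicator R (T \<omega>) :: real)" for \<omega>
      by (auto simp: indicator_def T_def)
    then show ?case using i[OF compl(1)] compl(2) Y0 Y by (simp add: right_diff_distrib)
  next
    case (union R)
    have dR: "disjoint_family (\<lambda>n. T -` R n \<inter> space M)"
      using union(1) by (auto simp: disjoint_family_on_def)
    have mR: "T -` R n \<inter> space M \<in> sets M" for n
      by (rule measurable_sets[OF T]) (use union(2) sets in auto)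
    have e: "(LINT \<omega>|M. Y \<omega> * indicator S (T \<omega>)) = (LINT \<omega>:T -` S \<inter> space M|M. Y \<omega>)" for S
      unfolding set_lebesgue_integral_def
      by (intro Bochner_Integration.integral_cong) (auto simp: indicator_def)
    have "(LINT \<omega>:(\<Union>n. T -` R n \<inter> space M)|M. Y \<omega>) = (\<Sum>n. LINT \<omega>:T -` R n \<inter> space M|M. Y \<omega>)"
    proof (rule lebesgue_integral_countable_add[OF mR])
      show "set_integrable M (\<Union>n. T -` R n \<inter> space M) Y"
        unfolding set_integrable_def
        by (rule integrable_mult_indicator[OF _ Y]) (rule sets.countable_UN, use mR in blast)
    qed (use dR in \<open>auto simp: disjoint_family_on_def\<close>)
    moreover have "(\<Union>n. T -` R n \<inter> space M) = T -` (\<Union>n. R n) \<inter> space M" by auto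
    ultimately show ?case using union(3) e by simp
  qed
  moreover have "(LINT \<omega>|M. Y \<omega> * indicator A \<omega>) = (LINT \<omega>|M. Y \<omega> * indicator B (T \<omega>))"
    unfolding B(1) by (intro Bochner_Integration.integral_cong) (auto simp: indicator_def)
  ultimately show ?thesis by simp
qed

text \<open>
  By conditional independence \<open>1\<^sub>B - E[1\<^sub>B | S]\<close> is orthogonal to every function of \<open>Y\<close>, so
  \<open>1\<^sub>B\<close> can be replaced by \<open>E[1\<^sub>B | S]\<close>.
\<close>

lemma integral_indicator_eq_0_of_cond_indep:
  fixes Y Z :: "'a \<Rightarrow> real"
  assumes F: "subalgebra M F" and G: "subalgebra M G" and S: "subalgebra M S"
    and ci: "cond_indep M F G S"
    and Y: "integrable M Y" and YF: "\<And>B. B \<in> sets borel \<Longrightarrow> Y -` B \<inter> space M \<in> sets F"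
    and Z: "integrable M Z" and ZS [measurable]: "Z \<in> borel_measurable S"
    and 0: "AE \<omega> in M. real_cond_exp M S (\<lambda>\<omega>. Y \<omega> - Z \<omega>) \<omega> = 0"
    and B: "B \<in> sets G"
  shows "(LINT \<omega>|M. (Y \<omega> - Z \<omega>) * indicator B \<omega>) = 0"
proof -
  interpret S: finite_measure_subalgebra M S using S by unfold_locales
  have BM [measurable]: "B \<in> sets M" using B G by (auto simp: subalgebra_def)
  note [measurable] = borel_measurable_integrable[OF Y] borel_measurable_integrable[OF Z]
  let ?e = "real_cond_exp M S (indicator B)"
  have ind: "integrable M (indicator D :: 'a \<Rightarrow> real)" if "D \<in> sets M" for D
    using that by (intro integrable_const_bound[of _ 1]) (auto simp: indicator_def)
  have iB: "integrable M (indicator B :: 'a \<Rightarrow> real)" by (rule ind[OF BM])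
  have e0: "AE \<omega> in M. 0 \<le> ?e \<omega>" by (rule S.real_cond_exp_ge_c[OF iB]) simp
  have e1: "AE \<omega> in M. ?e \<omega> \<le> 1" by (rule S.real_cond_exp_le_c[OF iB]) (simp add: indicator_def)
  \<comment> \<open>The conditional probability lies between 0 and 1, so multiplying by it preserves
    integrability.\<close>
  have ie: "integrable M (\<lambda>\<omega>. U \<omega> * ?e \<omega>)" if "integrable M U" for U :: "'a \<Rightarrow> real"
  proof (rule Bochner_Integration.integrable_bound[OF that])
    show "AE \<omega> in M. norm (U \<omega> * ?e \<omega>) \<le> norm (U \<omega>)"
      using e0 e1 by eventually_elim (auto simp: abs_mult intro: mult_left_le)
  qed (use that in auto)
  have iU: "integrable M (\<lambda>\<omega>. U \<omega> * indicator B \<omega>)" if "integrable M U" for U :: "'a \<Rightarrow> real"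
    using integrable_mult_indicator[OF BM that] by (simp add: mult.commute)
  have "(LINT \<omega>|M. Y \<omega> * (indicator B \<omega> - ?e \<omega>)) = 0"
  proof (rule integral_mult_eq_0_of_indicators)
    show "integrable M (\<lambda>\<omega>. indicator B \<omega> - ?e \<omega>)" using S.real_cond_exp_int(1)[OF iB] iB by auto
    show "integrable M (\<lambda>\<omega>. Y \<omega> * (indicator B \<omega> - ?e \<omega>))"
      using iU[OF Y] ie[OF Y] by (simp add: right_diff_distrib)
    fix C :: "real set" assume C: "C \<in> sets borel"
    define A where "A = Y -` C \<inter> space M"
    have A: "A \<in> sets F" unfolding A_def by (rule YF[OF C])
    then have AM [measurable]: "A \<in> sets M" using F by (auto simp: subalgebra_def)
    have iA: "integrable M (indicator A :: 'a \<Rightarrow> real)" by (rule ind[OF AM])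
    have iAB: "integrable M (indicator (A \<inter> B) :: 'a \<Rightarrow> real)" by (rule ind) simp
    have ie': "integrable M (\<lambda>\<omega>. ?e \<omega> * indicator A \<omega>)" using ie[OF iA] by (simp add: mult.commute)
    have "(LINT \<omega>|M. ?e \<omega> * indicator A \<omega>) = (LINT \<omega>|M. ?e \<omega> * real_cond_exp M S (indicator A) \<omega>)"
      by (rule S.real_cond_exp_intg(2)[symmetric, OF ie']) auto
    also have "\<dots> = (LINT \<omega>|M. real_cond_exp M S (indicator (A \<inter> B)) \<omega>)"
    proof (rule integral_cong_AE)
      have "AE \<omega> in M. real_cond_exp M S (indicator (A \<inter> B)) \<omega> = real_cond_exp M S (indicator A) \<omega> * ?e \<omega>"
        using ci A B unfolding cond_indep_def by blast
      then show "AE \<omega> in M. ?e \<omega> * real_cond_exp M S (indicator A) \<omega> = real_cond_exp M S (indicator (A \<inter> B)) \<omega>"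
        by eventually_elim simp
    qed auto
    also have "\<dots> = (LINT \<omega>|M. indicator (A \<inter> B) \<omega>)" by (rule S.real_cond_exp_int(2)[OF iAB])
    finally have 1: "(LINT \<omega>|M. ?e \<omega> * indicator A \<omega>) = (LINT \<omega>|M. indicator B \<omega> * indicator A \<omega>)"
      by (simp add: indicator_inter_arith mult.commute)
    have "(LINT \<omega>|M. (indicator B \<omega> - ?e \<omega>) * indicator C (Y \<omega>)) =
        (LINT \<omega>|M. indicator B \<omega> * indicator A \<omega> - ?e \<omega> * indicator A \<omega>)"
      by (intro Bochner_Integration.integral_cong) (auto simp: A_def indicator_def)
    also have "\<dots> = 0"
      using 1 ie' iU[OF iA] by (subst Bochner_Integration.integral_diff) (auto simp: mult.commute)
    finally show "(LINT \<omega>|M. (indicator B \<omega> - ?e \<omega>) * indicator C (Y \<omega>)) = 0" .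
  qed simp
  then have "(LINT \<omega>|M. Y \<omega> * indicator B \<omega>) = (LINT \<omega>|M. Y \<omega> * ?e \<omega>)"
    using iU[OF Y] ie[OF Y] by (simp add: right_diff_distrib)
  moreover have "(LINT \<omega>|M. Z \<omega> * indicator B \<omega>) = (LINT \<omega>|M. Z \<omega> * ?e \<omega>)"
    by (rule S.real_cond_exp_intg(2)[symmetric]) (use iU[OF Z] in auto)
  ultimately have "(LINT \<omega>|M. (Y \<omega> - Z \<omega>) * indicator B \<omega>) = (LINT \<omega>|M. (Y \<omega> - Z \<omega>) * ?e \<omega>)"
    using iU[OF Y] ie[OF Y] iU[OF Z] ie[OF Z] by (simp add: left_diff_distrib)
  also have "\<dots> = (LINT \<omega>|M. ?e \<omega> * (Y \<omega> - Z \<omega>))" by (simp add: mult.commute)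
  \<comment> \<open>\<open>?e\<close> is \<open>S\<close>-measurable, so \<open>Y - Z\<close> may be
    replaced by its conditional expectation.\<close>
  also have "\<dots> = (LINT \<omega>|M. ?e \<omega> * real_cond_exp M S (\<lambda>\<omega>. Y \<omega> - Z \<omega>) \<omega>)"
    using ie[of "\<lambda>\<omega>. Y \<omega> - Z \<omega>"] Y Z by (intro S.real_cond_exp_intg(2)[symmetric]) (auto simp: mult.commute)
  also have "\<dots> = 0" by (rule integral_eq_zero_AE) (use 0 in \<open>eventually_elim, simp\<close>)
  finally show ?thesis .
qed

end

section \<open>Gaussian models\<close>

locale gaussian_vector = prob_space M for M :: "'s measure" +
  fixes X :: "'v \<Rightarrow> 's \<Rightarrow> real" and W :: "'v set"
  assumes finite_W: "finite W"
    and X_measurable: "\<And>i. i \<in> W \<Longrightarrow> X i \<in> borel_measurable M"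
    and gaussian: "zero_mean_gaussian M X W"
begin

text \<open>The linear span, as functions rather than classes modulo null sets. Joint Gaussianity is
  used only through single members of it, each of which is centred normal or almost surely
  zero.\<close>

definition lin :: "('s \<Rightarrow> real) set" where
  "lin = {Y. \<exists>a. Y = (\<lambda>\<omega>. \<Sum>i\<in>W. a i * X i \<omega>)}"

lemma lin_X: "i \<in> W \<Longrightarrow> X i \<in> lin"
  unfolding lin_def using finite_W
  by (auto intro!: exI[of _ "\<lambda>k. if k = i then 1 else 0"] simp: if_distrib[of "\<lambda>a. a * _"] cong: if_cong)

lemma lin_add: "Y \<in> lin \<Longrightarrow> Z \<in> lin \<Longrightarrow> (\<lambda>\<omega>. Y \<omega> + Z \<omega>) \<in> lin"
  unfolding lin_def
proof safe
  fix a b show "\<exists>c. (\<lambda>\<omega>. (\<Sum>i\<in>W. a i * X i \<omega>) + (\<Sum>i\<in>W. b i * X i \<omega>)) = (\<lambda>\<omega>. \<Sum>i\<in>W. c i * X i \<omega>)"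
    by (intro exI[of _ "\<lambda>i. a i + b i"]) (simp add: distrib_right sum.distrib)
qed

lemma lin_scale: "Y \<in> lin \<Longrightarrow> (\<lambda>\<omega>. c * Y \<omega>) \<in> lin"
  unfolding lin_def
proof safe
  fix a show "\<exists>b. (\<lambda>\<omega>. c * (\<Sum>i\<in>W. a i * X i \<omega>)) = (\<lambda>\<omega>. \<Sum>i\<in>W. b i * X i \<omega>)"
    by (intro exI[of _ "\<lambda>i. c * a i"]) (simp add: sum_distrib_left mult.assoc)
qed

lemma lin_diff: "Y \<in> lin \<Longrightarrow> Z \<in> lin \<Longrightarrow> (\<lambda>\<omega>. Y \<omega> - Z \<omega>) \<in> lin"
  using lin_add[OF _ lin_scale[of Z "-1"]] by simp

lemma lin_sum: "N \<subseteq> W \<Longrightarrow> (\<lambda>\<omega>. \<Sum>j\<in>N. c j * X j \<omega>) \<in> lin"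
proof -
  assume N: "N \<subseteq> W"
  have "(\<Sum>j\<in>N. c j * X j \<omega>) = (\<Sum>i\<in>W. (if i \<in> N then c i else 0) * X i \<omega>)" for \<omega>
    using finite_W N by (simp add: if_distrib[of "\<lambda>a. a * _"] sum.If_cases Int_absorb1 cong: if_cong)
  then show ?thesis unfolding lin_def by auto
qed

text \<open>Writing the characteristic function with the second moment in place of
  \<open>\<sigma>\<close> covers the degenerate case, where \<open>Y\<close> vanishes almost surely,
  and makes it depend on covariances only. For \<open>\<sigma> > 0\<close> it is the standard normal
  one evaluated at \<open>\<sigma>\<close>.\<close>

lemma
  assumes "Y \<in> lin"
  shows lin_measurable [measurable_dest]: "Y \<in> borel_measurable M"
    and lin_integrable: "integrable M Y"
    and lin_integrable_square: "integrable M (\<lambda>\<omega>. Y \<omega> * Y \<omega>)"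
    and lin_mean: "(LINT \<omega>|M. Y \<omega>) = 0"
    and lin_char: "(CLINT \<omega>|M. iexp (Y \<omega>)) = of_real (exp (- (LINT \<omega>|M. Y \<omega> * Y \<omega>) / 2))"
proof -
  obtain a where Y: "Y = (\<lambda>\<omega>. \<Sum>i\<in>W. a i * X i \<omega>)" using assms by (auto simp: lin_def)
  show m [measurable]: "Y \<in> borel_measurable M" unfolding Y using X_measurable by auto
  obtain \<sigma> where \<sigma>: "0 \<le> \<sigma>" "distr M borel Y =
      (if \<sigma> = 0 then return borel 0 else density lborel (normal_density 0 \<sigma>))"
    using gaussian unfolding zero_mean_gaussian_def Y by blast
  have "integrable M Y \<and> integrable M (\<lambda>\<omega>. Y \<omega> * Y \<omega>) \<and> (LINT \<omega>|M. Y \<omega>) = 0 \<and>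
    (CLINT \<omega>|M. iexp (Y \<omega>)) = of_real (exp (- (LINT \<omega>|M. Y \<omega> * Y \<omega>) / 2))"
  proof (cases "\<sigma> = 0")
    case True
    have "AE x in distr M borel Y. x = 0" unfolding \<sigma>(2) using True by (simp add: AE_return pred_def)
    then have Y0: "AE \<omega> in M. Y \<omega> = 0" by (subst (asm) AE_distr_iff) auto
    have "(CLINT \<omega>|M. iexp (Y \<omega>)) = (CLINT \<omega>|M. 1)"
      by (rule integral_cong_AE) (use Y0 in \<open>auto elim: eventually_mono\<close>)
    moreover have "(LINT \<omega>|M. Y \<omega>) = 0" "(LINT \<omega>|M. Y \<omega> * Y \<omega>) = 0"
      by (rule integral_eq_zero_AE, use Y0 in \<open>eventually_elim, simp\<close>)+
    moreover have "AE \<omega> in M. norm (Y \<omega>) \<le> 0" "AE \<omega> in M. norm (Y \<omega> * Y \<omega>) \<le> 0"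
      using Y0 by (eventually_elim, simp)+
    then have "integrable M Y" "integrable M (\<lambda>\<omega>. Y \<omega> * Y \<omega>)"
      by (auto intro!: integrable_const_bound)
    ultimately show ?thesis by (simp add: prob_space)
  next
    case False
    then have s: "0 < \<sigma>" using \<sigma> by simp
    have D: "distributed M lborel Y (normal_density 0 \<sigma>)"
      using \<sigma> s unfolding distributed_def by (auto cong: distr_cong)
    then have "distributed M lborel (\<lambda>\<omega>. Y \<omega> / \<sigma>) std_normal_density"
      using normal_standard_normal_convert[OF s, of Y 0] by simp
    then have d: "distr M borel (\<lambda>\<omega>. Y \<omega> / \<sigma>) = std_normal_distribution"
      unfolding distributed_def by (auto cong: distr_cong)
    have "integrable M (\<lambda>\<omega>. Y \<omega> * Y \<omega>)"
      using integrable_normal_moment[OF s, of 0 2] distributed_integrable[OF D, of "\<lambda>x. x * x"]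
      by (simp add: power2_eq_square)
    moreover have "integrable M Y"
      using integrable_normal_moment_nz_1[OF s, of 0] distributed_integrable[OF D, of "\<lambda>x. x"] by simp
    moreover have E: "(LINT \<omega>|M. Y \<omega>) = 0" by (rule normal_distributed_expectation[OF s D])
    moreover have "(LINT \<omega>|M. Y \<omega> * Y \<omega>) = \<sigma>\<^sup>2"
      using normal_distributed_variance[OF s D] E by (simp add: power2_eq_square)
    moreover have "(CLINT \<omega>|M. iexp (Y \<omega>)) = of_real (exp (- \<sigma>\<^sup>2 / 2))"
    proof -
      have "of_real (exp (- \<sigma>\<^sup>2 / 2)) = char (distr M borel (\<lambda>\<omega>. Y \<omega> / \<sigma>)) \<sigma>"
        by (simp add: d char_std_normal_distribution)
      also have "\<dots> = (CLINT \<omega>|M. iexp (\<sigma> * (Y \<omega> / \<sigma>)))"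
        unfolding char_def by (subst integral_distr) auto
      also have "\<dots> = (CLINT \<omega>|M. iexp (Y \<omega>))" using s by simp
      finally show ?thesis by simp
    qed
    ultimately show ?thesis by simp
  qed
  then show "integrable M Y" "integrable M (\<lambda>\<omega>. Y \<omega> * Y \<omega>)" "(LINT \<omega>|M. Y \<omega>) = 0"
    "(CLINT \<omega>|M. iexp (Y \<omega>)) = of_real (exp (- (LINT \<omega>|M. Y \<omega> * Y \<omega>) / 2))" by auto
qed

text \<open>The covariance on \<open>lin\<close>, whose members are centred. It is in general only a
  semi-inner product; \<open>ip_null\<close> takes the place of definiteness.\<close>

definition ip :: "('s \<Rightarrow> real) \<Rightarrow> ('s \<Rightarrow> real) \<Rightarrow> real" where
  "ip Y Z = (LINT \<omega>|M. Y \<omega> * Z \<omega>)"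

text \<open>Polarization reduces products to squares of members of \<open>lin\<close>.\<close>

lemma lin_integrable_mult:
  assumes "Y \<in> lin" "Z \<in> lin"
  shows "integrable M (\<lambda>\<omega>. Y \<omega> * Z \<omega>)"
proof -
  have "integrable M (\<lambda>\<omega>. ((Y \<omega> + Z \<omega>) * (Y \<omega> + Z \<omega>) - Y \<omega> * Y \<omega> - Z \<omega> * Z \<omega>) / 2)"
    using lin_integrable_square[OF lin_add[OF assms]] lin_integrable_square assms by auto
  then show ?thesis by (simp add: algebra_simps)
qed

lemma ip_sym: "ip Y Z = ip Z Y"
  by (simp add: ip_def mult.commute)

lemma ip_add: "Y \<in> lin \<Longrightarrow> Y' \<in> lin \<Longrightarrow> Z \<in> lin \<Longrightarrow> ip (\<lambda>\<omega>. Y \<omega> + Y' \<omega>) Z = ip Y Z + ip Y' Z"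
  by (simp add: ip_def distrib_right lin_integrable_mult)

lemma ip_diff: "Y \<in> lin \<Longrightarrow> Y' \<in> lin \<Longrightarrow> Z \<in> lin \<Longrightarrow> ip (\<lambda>\<omega>. Y \<omega> - Y' \<omega>) Z = ip Y Z - ip Y' Z"
  by (simp add: ip_def left_diff_distrib lin_integrable_mult)

lemma ip_scale: "ip (\<lambda>\<omega>. c * Y \<omega>) Z = c * ip Y Z"
  by (simp add: ip_def mult.assoc)

lemma ip_sum:
  assumes "N \<subseteq> W" "Z \<in> lin"
  shows "ip (\<lambda>\<omega>. \<Sum>j\<in>N. c j * X j \<omega>) Z = (\<Sum>j\<in>N. c j * ip (X j) Z)"
proof -
  have "ip (\<lambda>\<omega>. \<Sum>j\<in>N. c j * X j \<omega>) Z = (LINT \<omega>|M. (\<Sum>j\<in>N. c j * (X j \<omega> * Z \<omega>)))"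
    by (simp add: ip_def sum_distrib_right mult.assoc)
  also have "\<dots> = (\<Sum>j\<in>N. c j * ip (X j) Z)"
    using assms lin_X lin_integrable_mult by (subst Bochner_Integration.integral_sum) (auto simp: ip_def subset_iff)
  finally show ?thesis .
qed

lemma ip_nonneg: "0 \<le> ip Y Y"
  by (simp add: ip_def)

lemma ip_null:
  assumes Y: "Y \<in> lin" and 0: "ip Y Y = 0"
  shows "ip Z Y = 0"
proof -
  have "AE \<omega> in M. Y \<omega> * Y \<omega> = 0"
    using 0 integral_nonneg_eq_0_iff_AE[OF lin_integrable_square[OF Y]] by (simp add: ip_def)
  then have "AE \<omega> in M. Z \<omega> * Y \<omega> = 0" by eventually_elim simp
  then show ?thesis unfolding ip_def by (rule integral_eq_zero_AE)
qed

text \<open>Gram-Schmidt, because the Gram matrix may be singular. \<open>Q\<close> is the part of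
  \<open>X n\<close> orthogonal to the earlier variables, and the residual \<open>R\<close> of
  \<open>Y\<close> is corrected along \<open>Q\<close>.\<close>

lemma ex_projection:
  assumes "N \<subseteq> W" "Y \<in> lin"
  shows "\<exists>c. \<forall>k\<in>N. ip (\<lambda>\<omega>. Y \<omega> - (\<Sum>j\<in>N. c j * X j \<omega>)) (X k) = 0"
proof -
  have "finite N" using assms(1) finite_W finite_subset by auto
  then show ?thesis using assms
  proof (induction N arbitrary: Y rule: finite_induct)
    case empty
    then show ?case by simp
  next
    case (insert n N)
    have N: "N \<subseteq> W" and n: "X n \<in> lin" using insert.prems lin_X by auto
    obtain c where c: "\<And>k. k \<in> N \<Longrightarrow> ip (\<lambda>\<omega>. Y \<omega> - (\<Sum>j\<in>N. c j * X j \<omega>)) (X k) = 0"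
      using insert.IH[OF N insert.prems(2)] by blast
    obtain b where b: "\<And>k. k \<in> N \<Longrightarrow> ip (\<lambda>\<omega>. X n \<omega> - (\<Sum>j\<in>N. b j * X j \<omega>)) (X k) = 0"
      using insert.IH[OF N n] by blast
    define R where "R = (\<lambda>\<omega>. Y \<omega> - (\<Sum>j\<in>N. c j * X j \<omega>))"
    define Q where "Q = (\<lambda>\<omega>. X n \<omega> - (\<Sum>j\<in>N. b j * X j \<omega>))"
    \<comment> \<open>A null \<open>Q\<close> is orthogonal to everything by \<open>ip_null\<close>,
      so it contributes no new direction and the coefficient 0 is right.\<close>
    define e where "e = (if ip Q Q = 0 then 0 else ip R Q / ip Q Q)"
    have l: "R \<in> lin" "Q \<in> lin" "(\<lambda>\<omega>. \<Sum>j\<in>N. b j * X j \<omega>) \<in> lin"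
      unfolding R_def Q_def using N n insert.prems by (auto intro!: lin_diff lin_sum)
    have lc: "(\<lambda>\<omega>. R \<omega> - e * Q \<omega>) \<in> lin" by (intro lin_diff lin_scale l)
    have eq: "(\<lambda>\<omega>. R \<omega> - e * Q \<omega>) =
        (\<lambda>\<omega>. Y \<omega> - (\<Sum>j\<in>insert n N. (if j = n then e else c j - e * b j) * X j \<omega>))"
    proof
      fix \<omega>
      have "(\<Sum>j\<in>N. (if j = n then e else c j - e * b j) * X j \<omega>) = (\<Sum>j\<in>N. (c j - e * b j) * X j \<omega>)"
        using insert.hyps by (intro sum.cong) auto
      then show "R \<omega> - e * Q \<omega> = Y \<omega> - (\<Sum>j\<in>insert n N. (if j = n then e else c j - e * b j) * X j \<omega>)"
        using insert.hyps unfolding R_def Q_def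
        by (simp add: algebra_simps sum_subtractf sum_distrib_left)
    qed
    have k: "ip (\<lambda>\<omega>. R \<omega> - e * Q \<omega>) (X k) = 0" if "k \<in> N" for k
      using c[OF that] b[OF that] that N l lin_X[of k]
      by (subst ip_diff) (auto simp: R_def[symmetric] Q_def[symmetric] ip_scale intro: lin_scale)
    have "ip (\<lambda>\<omega>. R \<omega> - e * Q \<omega>) Q = 0"
      using ip_null[OF l(2), of R] by (subst ip_diff[OF l(1) lin_scale[OF l(2)] l(2)]) (simp add: ip_scale e_def)
    moreover have "ip (\<lambda>\<omega>. \<Sum>j\<in>N. b j * X j \<omega>) (\<lambda>\<omega>. R \<omega> - e * Q \<omega>) = 0"
      using k by (subst ip_sum[OF N lc]) (simp add: ip_sym[of "X _"])
    moreover have "X n = (\<lambda>\<omega>. Q \<omega> + (\<Sum>j\<in>N. b j * X j \<omega>))" by (simp add: Q_def)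
    ultimately have "ip (X n) (\<lambda>\<omega>. R \<omega> - e * Q \<omega>) = 0"
      using ip_add[OF l(2,3) lc] by (metis add_0 ip_sym)
    then have "\<forall>k\<in>insert n N. ip (\<lambda>\<omega>. R \<omega> - e * Q \<omega>) (X k) = 0" using k ip_sym by auto
    then show ?case unfolding eq by - (rule exI)
  qed
qed

text \<open>For orthogonal summands the second moments add, and the characteristic function is an
  exponential of the second moment.\<close>

lemma char_add:
  assumes Y: "Y \<in> lin" and Z: "Z \<in> lin" and orth: "ip Y Z = 0"
  shows "(CLINT \<omega>|M. iexp (Y \<omega> + Z \<omega>)) = (CLINT \<omega>|M. iexp (Y \<omega>)) * (CLINT \<omega>|M. iexp (Z \<omega>))"
proof -
  define S where "S = (\<lambda>\<omega>. Y \<omega> + Z \<omega>)"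
  have S: "S \<in> lin" unfolding S_def by (rule lin_add[OF Y Z])
  have "ip S S = ip Y S + ip Z S" using ip_add[OF Y Z S] by (simp only: S_def)
  also have "ip Y S = ip Y Y" using ip_add[OF Y Z Y] orth ip_sym[of Y S] ip_sym[of Y Z] unfolding S_def by linarith
  also have "ip Z S = ip Z Z" using ip_add[OF Y Z Z] orth ip_sym[of Z S] unfolding S_def by linarith
  finally have "- ip S S / 2 = - ip Y Y / 2 + - ip Z Z / 2" by simp
  then have "exp (- ip S S / 2) = exp (- ip Y Y / 2) * exp (- ip Z Z / 2)" by (simp only: exp_add)
  then show ?thesis
    using lin_char[OF S] lin_char[OF Y] lin_char[OF Z] unfolding ip_def[symmetric] S_def
    by (simp only: of_real_mult)
qed

text \<open>
  Uncorrelated jointly Gaussian variables have a product characteristic function; transferring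
  one coordinate at a time gives \<open>E[R | X\<^sub>N] = 0\<close>.
\<close>

lemma cond_exp_residual_eq_0:
  assumes N: "N \<subseteq> W" and R: "R \<in> lin" and orth: "\<And>j. j \<in> N \<Longrightarrow> ip R (X j) = 0"
  shows "AE \<omega> in M. real_cond_exp M (generated_by M borel X N) R \<omega> = 0"
proof -
  let ?S = "generated_by M borel X N"
  have XN: "\<And>i. i \<in> N \<Longrightarrow> X i \<in> borel_measurable M" using N X_measurable by auto
  have fin: "finite N" using N finite_W finite_subset by auto
  have [measurable]: "R \<in> borel_measurable M" by (rule lin_measurable[OF R])
  have iexp_int: "complex_integrable M (\<lambda>\<omega>. iexp (Y \<omega>))" if "Y \<in> lin" for Y
    using integrable_mult_iexp[of "\<lambda>_. 1" Y] lin_measurable[OF that] by simp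
  \<comment> \<open>\<open>t * R\<close> is orthogonal to every combination of the
    \<open>X j\<close>, so the centred exponential of \<open>R\<close> is orthogonal to all
    exponentials in the conditioning variables.\<close>
  have char: "(CLINT \<omega>|M. (iexp (t * R \<omega>) - (CLINT \<omega>|M. iexp (t * R \<omega>))) * iexp (\<Sum>j\<in>N. b j * X j \<omega>)) = 0" for t b
  proof -
    let ?Z = "\<lambda>\<omega>. \<Sum>j\<in>N. b j * X j \<omega>"
    have Z: "?Z \<in> lin" by (rule lin_sum[OF N])
    have tR: "(\<lambda>\<omega>. t * R \<omega>) \<in> lin" by (rule lin_scale[OF R])
    have tRZ: "(\<lambda>\<omega>. t * R \<omega> + ?Z \<omega>) \<in> lin" by (rule lin_add[OF tR Z])
    have o: "ip ?Z (\<lambda>\<omega>. t * R \<omega>) = 0"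
      using orth by (subst ip_sum[OF N tR]) (simp add: ip_sym[of "X _"] ip_scale)
    then have "(CLINT \<omega>|M. iexp (t * R \<omega> + ?Z \<omega>)) = (CLINT \<omega>|M. iexp (t * R \<omega>)) * (CLINT \<omega>|M. iexp (?Z \<omega>))"
      by (intro char_add tR Z) (simp only: ip_sym)
    moreover have "(CLINT \<omega>|M. (iexp (t * R \<omega>) - (CLINT \<omega>|M. iexp (t * R \<omega>))) * iexp (?Z \<omega>)) =
        (CLINT \<omega>|M. iexp (t * R \<omega> + ?Z \<omega>) - (CLINT \<omega>|M. iexp (t * R \<omega>)) * iexp (?Z \<omega>))"
      by (simp add: left_diff_distrib exp_add distrib_left)
    ultimately show ?thesis using iexp_int[OF tRZ] iexp_int[OF Z]
      by (subst (asm) Bochner_Integration.integral_diff) auto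
  qed
  have rect: "(LINT \<omega>|M. R \<omega> * (\<Prod>j\<in>N. indicator (B j) (X j \<omega>))) = 0"
    if B: "\<And>j. j \<in> N \<Longrightarrow> B j \<in> sets borel" for B
  proof -
    define P where "P = (\<lambda>\<omega>. (\<Prod>j\<in>N. indicator (B j) (X j \<omega>)) :: real)"
    have P [measurable]: "P \<in> borel_measurable M"
      unfolding P_def using B XN by (intro borel_measurable_prod measurable_compose[OF _ borel_measurable_indicator]) auto
    have P01: "0 \<le> P \<omega>" "P \<omega> \<le> 1" for \<omega>
      unfolding P_def by (auto intro!: prod_nonneg prod_le_1 simp: indicator_def)
    have iP: "integrable M P" by (rule integrable_const_bound[of _ 1]) (use P01 in auto)
    \<comment> \<open>The roles are now exchanged: \<open>P\<close> becomes the weight and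
      \<open>R\<close> the variable. Subtracting the mean \<open>p\<close> makes the transforms of
      \<open>P - p\<close> along \<open>R\<close> vanish; at the end \<open>p\<close> drops out
      because \<open>R\<close> has mean zero.\<close>
    define p where "p = (LINT \<omega>|M. P \<omega>)"
    have iPp: "integrable M (\<lambda>\<omega>. P \<omega> - p)" using iP by simp
    have "(CLINT \<omega>|M. of_real (P \<omega> - p) * iexp (t * R \<omega>)) = 0" for t
    proof -
      have tR: "(\<lambda>\<omega>. t * R \<omega>) \<in> lin" by (rule lin_scale[OF R])
      let ?\<phi> = "CLINT \<omega>|M. iexp (t * R \<omega>)"
      have "(CLINT \<omega>|M. (iexp (t * R \<omega>) - ?\<phi>) * (\<Prod>j\<in>N. indicator (B j) (X j \<omega>))) = 0"
        by (rule complex_integral_indicators_eq_0_of_char[OF fin _ XN char B])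
          (use iexp_int[OF tR] in auto)
      moreover have "(\<Prod>j\<in>N. indicator (B j) (X j \<omega>)) = complex_of_real (P \<omega>)" for \<omega>
        unfolding P_def by (auto simp: indicator_def intro!: prod.cong)
      ultimately have 1: "(CLINT \<omega>|M. (iexp (t * R \<omega>) - ?\<phi>) * of_real (P \<omega>)) = 0" by simp
      have i1: "complex_integrable M (\<lambda>\<omega>. of_real (P \<omega>) * iexp (t * R \<omega>))"
        by (rule integrable_mult_iexp[OF integrable_of_real[OF iP]]) simp
      have i2: "complex_integrable M (\<lambda>\<omega>. ?\<phi> * of_real (P \<omega>))"
        by (intro integrable_mult_right integrable_of_real iP)
      have "(CLINT \<omega>|M. of_real (P \<omega>) * iexp (t * R \<omega>)) - (CLINT \<omega>|M. ?\<phi> * of_real (P \<omega>)) = 0"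
        using 1 by (subst Bochner_Integration.integral_diff[OF i1 i2, symmetric]) (simp add: algebra_simps)
      then have 2: "(CLINT \<omega>|M. of_real (P \<omega>) * iexp (t * R \<omega>)) = ?\<phi> * of_real p"
        unfolding p_def by simp
      have "(CLINT \<omega>|M. of_real (P \<omega> - p) * iexp (t * R \<omega>)) =
          (CLINT \<omega>|M. of_real (P \<omega>) * iexp (t * R \<omega>) - of_real p * iexp (t * R \<omega>))"
        by (intro Bochner_Integration.integral_cong refl) (simp add: left_diff_distrib)
      also have "\<dots> = ?\<phi> * of_real p - of_real p * ?\<phi>"
        by (subst Bochner_Integration.integral_diff[OF i1 integrable_mult_right[OF iexp_int[OF tR]]])
          (simp only: 2 integral_mult_right_zero)
      finally show ?thesis by simp
    qed
    from integral_indicator_eq_0_of_char[OF iPp _ this]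
    have *: "(LINT \<omega>|M. (P \<omega> - p) * indicator C (R \<omega>)) = 0" if "C \<in> sets borel" for C using that by simp
    have iRP: "integrable M (\<lambda>\<omega>. R \<omega> * P \<omega>)"
      by (rule Bochner_Integration.integrable_bound[OF lin_integrable[OF R]])
        (use P01 in \<open>auto simp: abs_mult intro!: mult_left_le\<close>)
    have "(LINT \<omega>|M. R \<omega> * (P \<omega> - p)) = 0"
      by (rule integral_mult_eq_0_of_indicators[OF iPp _ _ *])
        (use iRP lin_integrable[OF R] in \<open>auto simp: right_diff_distrib\<close>)
    then have "(LINT \<omega>|M. R \<omega> * P \<omega>) = 0"
      using iRP lin_integrable[OF R] lin_mean[OF R] by (simp add: right_diff_distrib)
    then show ?thesis by (simp only: P_def)
  qed
  interpret S: finite_measure_subalgebra M ?S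
    by unfold_locales (rule subalgebra_generated_by[OF XN])
  show ?thesis
  proof (rule S.real_cond_exp_charact)
    fix A assume A: "A \<in> sets ?S"
    have "(LINT \<omega>|M. R \<omega> * indicator A \<omega>) = 0"
      by (rule integral_indicator_generated_by_eq_0[OF fin lin_integrable[OF R] XN rect A])
    then show "(LINT \<omega>:A|M. R \<omega>) = (LINT \<omega>:A|M. 0)"
      by (simp add: set_lebesgue_integral_def mult.commute)
  qed (use lin_integrable[OF R] in auto)
qed

text \<open>The weights come from projecting \<open>X i\<close> on its neighbours. The residual has
  conditional expectation zero given the neighbours; by the Markov property it is then orthogonal to
  all events of the other variables, hence uncorrelated with each \<open>X k\<close>.\<close>

lemma linear_markov:
  assumes markov: "markov_on M borel X W E" and i: "i \<in> W"
    and nb: "neighbors E i \<subseteq> W - {i}"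
  shows "\<exists>c. \<forall>k\<in>W - {i}. ip (X i) (X k) = (\<Sum>j\<in>neighbors E i. c j * ip (X j) (X k))"
proof -
  let ?N = "neighbors E i"
  have N: "?N \<subseteq> W" using nb by auto
  obtain c where c: "\<And>k. k \<in> ?N \<Longrightarrow> ip (\<lambda>\<omega>. X i \<omega> - (\<Sum>j\<in>?N. c j * X j \<omega>)) (X k) = 0"
    using ex_projection[OF N lin_X[OF i]] by blast
  define Z where "Z = (\<lambda>\<omega>. \<Sum>j\<in>?N. c j * X j \<omega>)"
  have Z: "Z \<in> lin" unfolding Z_def by (rule lin_sum[OF N])
  have R: "(\<lambda>\<omega>. X i \<omega> - Z \<omega>) \<in> lin" by (rule lin_diff[OF lin_X[OF i] Z])
  have XA: "\<And>j. j \<in> A \<Longrightarrow> X j \<in> borel_measurable M" if "A \<subseteq> W" for A using that X_measurable by auto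
  have "ip (X i) (X k) = (\<Sum>j\<in>?N. c j * ip (X j) (X k))" if k: "k \<in> W - {i}" for k
  proof -
    have kl: "X k \<in> lin" using k lin_X by auto
    have "(LINT \<omega>|M. X k \<omega> * (X i \<omega> - Z \<omega>)) = 0"
    proof (rule integral_mult_eq_0_of_indicators)
      fix C :: "real set" assume C: "C \<in> sets borel"
      have "(LINT \<omega>|M. (X i \<omega> - Z \<omega>) * indicator (X k -` C \<inter> space M) \<omega>) = 0"
      proof (rule integral_indicator_eq_0_of_cond_indep)
        show "subalgebra M (generated_by M borel X {i})" "subalgebra M (generated_by M borel X (W - {i}))"
          "subalgebra M (generated_by M borel X ?N)"
          by (rule subalgebra_generated_by; use XA[of "{i}"] XA[of "W - {i}"] XA[of ?N] i N in auto)+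
        show "cond_indep M (generated_by M borel X {i}) (generated_by M borel X (W - {i})) (generated_by M borel X ?N)"
          using markov i by (auto simp: markov_on_def)
        show "integrable M (X i)" "integrable M Z" using lin_integrable lin_X i Z by auto
        show "X i -` B \<inter> space M \<in> sets (generated_by M borel X {i})" if "B \<in> sets borel" for B
          by (rule vimage_generated_by) (use that X_measurable i in auto)
        show "X k -` C \<inter> space M \<in> sets (generated_by M borel X (W - {i}))"
          by (rule vimage_generated_by) (use C X_measurable k in auto)
        show "Z \<in> borel_measurable (generated_by M borel X ?N)"
          unfolding Z_def
          by (intro borel_measurable_sum borel_measurable_times borel_measurable_const measurable_generated_by)
            (use X_measurable N in auto)
        show "AE \<omega> in M. real_cond_exp M (generated_by M borel X ?N) (\<lambda>\<omega>. X i \<omega> - Z \<omega>) \<omega> = 0"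
          by (rule cond_exp_residual_eq_0[OF N R]) (use c in \<open>simp add: Z_def\<close>)
      qed
      moreover have "(LINT \<omega>|M. (X i \<omega> - Z \<omega>) * indicator (X k -` C \<inter> space M) \<omega>) =
          (LINT \<omega>|M. (X i \<omega> - Z \<omega>) * indicator C (X k \<omega>))"
        by (intro Bochner_Integration.integral_cong) (auto simp: indicator_def)
      ultimately show "(LINT \<omega>|M. (X i \<omega> - Z \<omega>) * indicator C (X k \<omega>)) = 0" by simp
    qed (use lin_integrable[OF R] lin_measurable[OF kl] lin_integrable_mult[OF kl R] in auto)
    then have "ip (\<lambda>\<omega>. X i \<omega> - Z \<omega>) (X k) = 0" by (simp add: ip_def mult.commute)
    then show ?thesis
      using ip_diff[OF lin_X[OF i] Z kl] ip_sum[OF N kl, of c] by (simp add: Z_def)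
  qed
  then show ?thesis by blast
qed

lemma covariance_eq: "i \<in> W \<Longrightarrow> j \<in> W \<Longrightarrow> covariance M (X i) (X j) = ip (X i) (X j)"
  using lin_mean lin_X by (simp add: covariance_def ip_def)

end

lemma (in tree) gaussian_metric_tree:
  assumes G: "gaussian_model M X W E" and l: "0 < l"
    and edge: "\<And>i j. {i, j} \<in> E \<Longrightarrow> l \<le> gaussian_dist M X i j"
    and card: "2 \<le> card W"
  shows "metric_tree W E (\<lambda>u v. if u = v then 0 else gaussian_dist M X u v)"
proof -
  interpret gaussian_vector M X W
    using G finite_vertices by (auto simp: gaussian_model_def gaussian_vector_def gaussian_vector_axioms_def)
  let ?C = "\<lambda>u v. ip (X u) (X v)"
  define r where "r u v = \<bar>correlation M (X u) (X v)\<bar>" for u v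
  have r: "r u v = \<bar>?C u v / sqrt (?C u u * ?C v v)\<bar>" if "u \<in> W" "v \<in> W" for u v
    using that by (simp add: r_def correlation_def covariance_eq)
  have r_sym: "r u v = r v u" for u v
    by (simp add: r_def correlation_def covariance_def mult.commute)
  have r_edge: "0 < r u v \<and> r u v < 1" if "{u, v} \<in> E" for u v
  proof -
    \<comment> \<open>The positive lower bound excludes correlation \<plusminus>1 and, since
      \<open>ln 0 = 0\<close>, also correlation 0 and the value 0 of a division by a zero
      variance.\<close>
    have "0 < - ln (r u v)" using edge[OF that] l by (simp add: gaussian_dist_def r_def)
    moreover have "0 \<le> r u v" by (simp add: r_def)
    ultimately show ?thesis by (cases "r u v = 0") auto
  qed
  have C_edge: "?C u u \<noteq> 0 \<and> ?C u v \<noteq> 0 \<and> (?C u v)\<^sup>2 < ?C u u * ?C v v" if "{u, v} \<in> E" for u v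
  proof -
    have uv: "u \<in> W" "v \<in> W" using edge_in[OF that] by auto
    note re = r_edge[OF that, unfolded r[OF uv]]
    then have 0: "?C u u * ?C v v \<noteq> 0" "?C u v \<noteq> 0" by auto
    then have p: "0 < ?C u u * ?C v v" using ip_nonneg[of "X u"] ip_nonneg[of "X v"]
      by (metis less_eq_real_def mult_nonneg_nonneg)
    have "\<bar>?C u v\<bar> < sqrt (?C u u * ?C v v)" using re p by (simp add: abs_divide)
    then have "\<bar>?C u v\<bar>\<^sup>2 < (sqrt (?C u u * ?C v v))\<^sup>2" by (intro power_strict_mono) auto
    then show ?thesis using 0 p by auto
  qed
  \<comment> \<open>With at least two vertices, every vertex has an edge, and a nonzero correlation
    on that edge forces a positive variance.\<close>
  have pos: "0 < ?C u u" if u: "u \<in> W" for u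
  proof -
    have "W \<noteq> {u}" using card by auto
    then obtain v where "v \<in> W" "u \<noteq> v" using u by blast
    then have "?C u u \<noteq> 0" using C_edge[OF path_Cons(2)[OF u]] by blast
    then show ?thesis using ip_nonneg[of "X u"] by simp
  qed
  have "metric_tree W E (\<lambda>u v. if u = v then 0 else - ln (r u v))"
  proof (rule metric_tree_of_multiplicative[OF r_sym r_edge])
    fix u v assume uv: "u \<in> W" "v \<in> W" "u \<noteq> v" "next_vertex u v \<noteq> v"
    have "\<bar>?C u v / sqrt (?C u u * ?C v v)\<bar> =
        \<bar>?C u (next_vertex u v) / sqrt (?C u u * ?C (next_vertex u v) (next_vertex u v))\<bar> *
        \<bar>?C (next_vertex u v) v / sqrt (?C (next_vertex u v) (next_vertex u v) * ?C v v)\<bar>"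
    proof (rule multiplicative_of_linear_markov[where C = ?C, OF ip_sym pos _ _ _ uv])
      fix N c k assume N: "N \<subseteq> W" "k \<in> W" and 0: "\<And>k. k \<in> N \<Longrightarrow> (\<Sum>j\<in>N. c j * ?C j k) = 0"
      let ?Z = "\<lambda>\<omega>. \<Sum>j\<in>N. c j * X j \<omega>"
      have Z: "?Z \<in> lin" by (rule lin_sum[OF N(1)])
      have Zk: "ip ?Z (X k) = (\<Sum>j\<in>N. c j * ?C j k)" if "k \<in> W" for k
        by (rule ip_sum[OF N(1) lin_X[OF that]])
      have "ip (X j) ?Z = 0" if "j \<in> N" for j
        using ip_sym[of "X j" ?Z] Zk[of j] 0[OF that] that N(1) by auto
      then have "ip ?Z ?Z = 0" by (simp add: ip_sum[OF N(1) Z])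
      then show "(\<Sum>j\<in>N. c j * ?C j k) = 0" using ip_null[OF Z] Zk[OF N(2)] ip_sym by metis
    next
      fix i assume "i \<in> W"
      then show "\<exists>c. \<forall>k\<in>W - {i}. ?C i k = (\<Sum>j\<in>neighbors E i. c j * ?C j k)"
        using G edge_in by (intro linear_markov) (auto simp: gaussian_model_def neighbors_def)
    qed (use C_edge in auto)
    then show "r u v = r u (next_vertex u v) * r (next_vertex u v) v"
      using uv path_Cons(1)[OF uv(1-3)] by (simp add: r)
  qed
  then show ?thesis by (simp add: r_def gaussian_dist_def cong: if_cong)
qed

section \<open>Discrete models\<close>

locale discrete_vector = prob_space M for M :: "'s measure" +
  fixes K :: nat and X :: "'v \<Rightarrow> 's \<Rightarrow> nat" and W :: "'v set"
  assumes finite_W: "finite W"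
    and X_measurable: "\<And>i. i \<in> W \<Longrightarrow> X i \<in> M \<rightarrow>\<^sub>M count_space {1..K}"
begin

definition marginal :: "'v set \<Rightarrow> ('v \<Rightarrow> nat) \<Rightarrow> real" where
  "marginal U x = measure M {\<omega> \<in> space M. \<forall>i\<in>U. X i \<omega> = x i}"

lemma marginal_cong: "(\<And>i. i \<in> U \<Longrightarrow> x i = y i) \<Longrightarrow> marginal U x = marginal U y"
  by (simp add: marginal_def)

lemma marginal_event: "U \<subseteq> W \<Longrightarrow> {\<omega> \<in> space M. \<forall>i\<in>U. X i \<omega> = x i} \<in> sets M"
proof -
  assume U: "U \<subseteq> W"
  have "{\<omega> \<in> space M. X i \<omega> = x i} \<in> sets M" if "i \<in> U" for i
  proof -
    have "X i -` ({x i} \<inter> {1..K}) \<inter> space M \<in> sets M"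
      using X_measurable[of i] U that by (intro measurable_sets) auto
    moreover have "X i \<omega> \<in> {1..K}" if "\<omega> \<in> space M" for \<omega>
      using measurable_space[OF X_measurable[of i] that] U \<open>i \<in> U\<close> by auto
    then have "X i -` ({x i} \<inter> {1..K}) \<inter> space M = {\<omega> \<in> space M. X i \<omega> = x i}" by force
    ultimately show ?thesis by simp
  qed
  then show ?thesis using finite_subset[OF U finite_W] by (intro sets.sets_Collect_finite_All) auto
qed

lemma marginal_sum:
  assumes "U \<subseteq> W" "i \<in> W" "i \<notin> U"
  shows "marginal U x = (\<Sum>a\<in>{1..K}. marginal (insert i U) (x(i := a)))"
proof -
  let ?S = "\<lambda>a. {\<omega> \<in> space M. \<forall>k\<in>insert i U. X k \<omega> = (x(i := a)) k}"
  have ev: "?S ` {1..K} \<subseteq> sets M" using marginal_event[of "insert i U"] assms by blast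
  have "{\<omega> \<in> space M. \<forall>k\<in>U. X k \<omega> = x k} = (\<Union>a\<in>{1..K}. ?S a)"
    using measurable_space[OF X_measurable[OF assms(2)]] assms(3) by auto
  then have "marginal U x = measure M (\<Union>a\<in>{1..K}. ?S a)" by (simp add: marginal_def)
  also have "\<dots> = (\<Sum>a\<in>{1..K}. measure M (?S a))"
    by (rule finite_measure_finite_Union[OF _ ev]) (auto simp: disjoint_family_on_def)
  finally show ?thesis unfolding marginal_def .
qed

lemma marginal_nonneg: "0 \<le> marginal U x"
  by (simp add: marginal_def)

text \<open>
  \<open>\<kappa> / s\<close> is the transition kernel from \<open>X j\<close> to \<open>X i\<close>, written without division because \<open>s\<close>
  may vanish.
\<close>

lemma marginal_kernel:
  assumes U: "U \<subseteq> W" and i: "i \<in> W" "i \<notin> U" and D: "D \<subseteq> U - {j}"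
    and ker: "\<And>x a. x \<in> W \<rightarrow> {1..K} \<Longrightarrow> a \<in> {1..K} \<Longrightarrow>
      marginal (insert i U) (x(i := a)) * s (x j) = \<kappa> a (x j) * marginal U x"
    and x: "x \<in> W \<rightarrow> {1..K}" "a \<in> {1..K}" and ij: "i \<noteq> j"
  shows "marginal (insert i (U - D)) (x(i := a)) * s (x j) = \<kappa> a (x j) * marginal (U - D) x"
proof -
  have "finite D" using D U finite_W by (meson Diff_subset finite_subset)
  then show ?thesis using D x
  proof (induction D arbitrary: x rule: finite_induct)
    case empty
    show ?case using ker[OF empty.prems(2,3)] by (simp only: Diff_empty)
  next
    case (insert w D)
    let ?U = "U - insert w D"
    have w: "w \<in> U" "w \<noteq> j" "w \<noteq> i" "w \<in> W" using insert.prems U i by auto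
    have ins: "insert w ?U = U - D" using w insert.hyps by auto
    have "marginal (insert i ?U) (x(i := a)) * s (x j) =
        (\<Sum>c\<in>{1..K}. marginal (insert i (U - D)) ((x(w := c))(i := a))) * s (x j)"
      using w i U by (subst marginal_sum[of _ w]) (auto simp: insert_commute ins fun_upd_twist)
    \<comment> \<open>The summed coordinate \<open>w\<close> differs from \<open>j\<close>, so
      \<open>s\<close> and \<open>\<kappa>\<close> do not change with it and can be moved across the
      sum.\<close>
    also have "\<dots> = (\<Sum>c\<in>{1..K}. marginal (insert i (U - D)) ((x(w := c))(i := a)) * s ((x(w := c)) j))"
      using w by (simp add: sum_distrib_right)
    also have "\<dots> = (\<Sum>c\<in>{1..K}. \<kappa> a (x j) * marginal (U - D) (x(w := c)))"
    proof (rule sum.cong[OF refl])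
      fix c assume "c \<in> {1..K}"
      then have "marginal (insert i (U - D)) ((x(w := c))(i := a)) * s ((x(w := c)) j) =
          \<kappa> a ((x(w := c)) j) * marginal (U - D) (x(w := c))"
        using insert.prems by (intro insert.IH) auto
      then show "marginal (insert i (U - D)) ((x(w := c))(i := a)) * s ((x(w := c)) j) =
          \<kappa> a (x j) * marginal (U - D) (x(w := c))"
        using w by simp
    qed
    also have "\<dots> = \<kappa> a (x j) * marginal ?U x"
      using w U by (subst (2) marginal_sum[of _ w]) (auto simp: ins sum_distrib_left)
    finally show ?case .
  qed
qed

text \<open>Used in contrapositive form: a positive single-vertex marginal at \<open>j\<close> shows
  that the normaliser of the kernel at \<open>j\<close> does not vanish.\<close>

lemma marginal_eq_0_antimono:
  assumes U: "U \<subseteq> W" and D: "D \<subseteq> U - {j}"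
    and 0: "\<And>x. x \<in> W \<rightarrow> {1..K} \<Longrightarrow> x j = b \<Longrightarrow> marginal U x = 0"
    and x: "x \<in> W \<rightarrow> {1..K}" "x j = b"
  shows "marginal (U - D) x = 0"
proof -
  have "finite D" using D U finite_W by (meson Diff_subset finite_subset)
  then show ?thesis using D x
  proof (induction D arbitrary: x rule: finite_induct)
    case empty
    then show ?case using 0 by simp
  next
    case (insert w D)
    let ?U = "U - insert w D"
    have ins: "insert w ?U = U - D" using insert by auto
    have "marginal (U - D) (x(w := c)) = 0" if "c \<in> {1..K}" for c
      using insert.prems that by (intro insert.IH) auto
    then show ?case using insert.prems U by (subst marginal_sum[of _ w]) (auto simp: ins)
  qed
qed

lemma joint_matrix_marginal:
  assumes "a < K" "b < K" "i \<noteq> j"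
  shows "joint_matrix M K X i j $$ (a, b) = marginal {i, j} (x(i := Suc a, j := Suc b))"
  using assms by (simp add: joint_matrix_def marginal_def)

lemma matrix_carrier [simp]:
  "joint_matrix M K X i j \<in> carrier_mat K K" "marginal_matrix M K X i \<in> carrier_mat K K"
  by (simp_all add: joint_matrix_def marginal_matrix_def)

lemma joint_matrix_sym: "Determinant.det (joint_matrix M K X i j) = Determinant.det (joint_matrix M K X j i)"
proof -
  have "joint_matrix M K X i j = transpose_mat (joint_matrix M K X j i)"
    by (rule eq_matI) (auto simp: joint_matrix_def conj_commute)
  then show ?thesis using det_transpose[of "joint_matrix M K X j i" K] by simp
qed

lemma det_marginal_matrix:
  "Determinant.det (marginal_matrix M K X i) = (\<Prod>a<K. marginal {i} (\<lambda>_. Suc a))"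
proof -
  have "Determinant.det (marginal_matrix M K X i) = prod_list (diag_mat (marginal_matrix M K X i))"
    by (rule det_lower_triangular[of K]) (auto simp: marginal_matrix_def)
  also have "\<dots> = (\<Prod>a<K. marginal {i} (\<lambda>_. Suc a))"
    by (simp add: diag_mat_def marginal_matrix_def marginal_def prod.list_conv_set_nth atLeast0LessThan)
  finally show ?thesis .
qed

text \<open>Let \<open>Q\<close> be the matrix of transition probabilities from \<open>X j\<close>
  to \<open>X i\<close>. The joint matrix of \<open>i, j\<close> is \<open>Q\<close> times the
  diagonal marginal matrix of \<open>j\<close>, and the joint matrix of \<open>i, k\<close> is
  \<open>Q\<close> times that of \<open>j, k\<close>. Taking determinants and eliminating the one of
  \<open>Q\<close> gives the identity.\<close>

lemma det_joint_of_kernel: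
  assumes ijk: "i \<in> W" "j \<in> W" "k \<in> W" "i \<noteq> j" "i \<noteq> k" "j \<noteq> k"
    and pos: "\<And>b. b \<in> {1..K} \<Longrightarrow> s b \<noteq> 0"
    and ker: "\<And>U x a. U = {j} \<or> U = {j, k} \<Longrightarrow> x \<in> W \<rightarrow> {1..K} \<Longrightarrow> a \<in> {1..K} \<Longrightarrow>
      marginal (insert i U) (x(i := a)) * s (x j) = \<kappa> a (x j) * marginal U x"
  shows "Determinant.det (joint_matrix M K X i k) * Determinant.det (marginal_matrix M K X j) =
    Determinant.det (joint_matrix M K X i j) * Determinant.det (joint_matrix M K X j k)"
proof -
  define Q where "Q = Matrix.mat K K (\<lambda>(a, b). \<kappa> (Suc a) (Suc b) / s (Suc b))"
  have Q: "Q \<in> carrier_mat K K" by (simp add: Q_def)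
  have entry: "(Q * B) $$ (a, b) = (\<Sum>c<K. Q $$ (a, c) * B $$ (c, b))"
    if "a < K" "b < K" "B \<in> carrier_mat K K" for a b B
    using that Q by (auto simp: scalar_prod_def atLeast0LessThan intro!: sum.cong)
  have "joint_matrix M K X i j = Q * marginal_matrix M K X j"
  proof (rule eq_matI)
    fix a b assume "a < dim_row (Q * marginal_matrix M K X j)" "b < dim_col (Q * marginal_matrix M K X j)"
    then have ab: "a < K" "b < K" by (auto simp: Q_def marginal_matrix_def)
    let ?x = "(\<lambda>_. Suc b)"
    have "(Q * marginal_matrix M K X j) $$ (a, b) =
        (\<Sum>c<K. Q $$ (a, c) * (if c = b then marginal {j} ?x else 0))"
      using ab by (subst entry) (auto simp: marginal_matrix_def marginal_def intro!: sum.cong)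
    also have "\<dots> = \<kappa> (Suc a) (Suc b) / s (Suc b) * marginal {j} ?x"
      using ab by (simp add: if_distrib[of "\<lambda>t. _ * t"] Q_def cong: if_cong)
    also have "\<dots> = marginal {i, j} (?x(i := Suc a))"
      using ker[of "{j}" ?x "Suc a"] pos[of "Suc b"] ab by (simp add: field_simps)
    also have "\<dots> = joint_matrix M K X i j $$ (a, b)"
      using ab ijk by (subst joint_matrix_marginal[where x = ?x]) (auto intro!: marginal_cong)
    finally show "joint_matrix M K X i j $$ (a, b) = (Q * marginal_matrix M K X j) $$ (a, b)" by simp
  qed (auto simp: Q_def joint_matrix_def marginal_matrix_def)
  then have 1: "Determinant.det (joint_matrix M K X i j) =
      Determinant.det Q * Determinant.det (marginal_matrix M K X j)"
    using det_mult[OF Q matrix_carrier(2)] by simp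
  have "joint_matrix M K X i k = Q * joint_matrix M K X j k"
  proof (rule eq_matI)
    fix a c assume "a < dim_row (Q * joint_matrix M K X j k)" "c < dim_col (Q * joint_matrix M K X j k)"
    then have ac: "a < K" "c < K" by (auto simp: Q_def joint_matrix_def)
    let ?x = "(\<lambda>_. Suc c)"
    have "joint_matrix M K X i k $$ (a, c) = marginal {i, k} (?x(i := Suc a))"
      using ac ijk by (subst joint_matrix_marginal[where x = ?x]) (auto intro!: marginal_cong)
    also have "\<dots> = (\<Sum>b\<in>{1..K}. marginal (insert j {i, k}) (?x(i := Suc a, j := b)))"
      by (rule marginal_sum) (use ijk in auto)
    also have "\<dots> = (\<Sum>b\<in>{1..K}. \<kappa> (Suc a) b / s b * marginal {j, k} (?x(j := b)))"
    proof (rule sum.cong[OF refl])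
      fix b assume b: "b \<in> {1..K}"
      have "marginal (insert i {j, k}) ((?x(j := b))(i := Suc a)) * s ((?x(j := b)) j) =
          \<kappa> (Suc a) ((?x(j := b)) j) * marginal {j, k} (?x(j := b))"
        by (rule ker) (use b ac in auto)
      then show "marginal (insert j {i, k}) (?x(i := Suc a, j := b)) =
          \<kappa> (Suc a) b / s b * marginal {j, k} (?x(j := b))"
        using pos[OF b] ijk by (simp add: field_simps insert_commute fun_upd_twist)
    qed
    \<comment> \<open>Shift from the alphabet \<open>{1..K}\<close> to matrix indices below
      \<open>K\<close>.\<close>
    also have "\<dots> = (\<Sum>b<K. \<kappa> (Suc a) (Suc b) / s (Suc b) * marginal {j, k} (?x(j := Suc b)))"
      by (rule sum.reindex_bij_witness[of _ Suc "\<lambda>b. b - 1"]) auto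
    also have "\<dots> = (\<Sum>b<K. Q $$ (a, b) * joint_matrix M K X j k $$ (b, c))"
    proof (rule sum.cong[OF refl])
      fix b assume "b \<in> {..<K}"
      then have "joint_matrix M K X j k $$ (b, c) = marginal {j, k} (?x(j := Suc b))"
        using ac ijk by (subst joint_matrix_marginal[where x = ?x]) (auto intro!: marginal_cong)
      then show "\<kappa> (Suc a) (Suc b) / s (Suc b) * marginal {j, k} (?x(j := Suc b)) =
          Q $$ (a, b) * joint_matrix M K X j k $$ (b, c)"
        using \<open>b \<in> {..<K}\<close> ac by (simp add: Q_def)
    qed
    also have "\<dots> = (Q * joint_matrix M K X j k) $$ (a, c)"
      using ac by (simp add: entry)
    finally show "joint_matrix M K X i k $$ (a, c) = (Q * joint_matrix M K X j k) $$ (a, c)" .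
  qed (auto simp: Q_def joint_matrix_def)
  then have 2: "Determinant.det (joint_matrix M K X i k) =
      Determinant.det Q * Determinant.det (joint_matrix M K X j k)"
    using det_mult[OF Q matrix_carrier(1)] by simp
  show ?thesis using 1 2 by simp
qed

end

lemma (in tree) discrete_metric_tree:
  assumes G: "discrete_model M K X W E" and l: "0 < l"
    and edge: "\<And>i j. {i, j} \<in> E \<Longrightarrow> l \<le> discrete_dist M K X i j"
    and card: "2 \<le> card W"
  shows "metric_tree W E (\<lambda>u v. if u = v then 0 else discrete_dist M K X u v)"
proof -
  interpret discrete_vector M K X W
    using G finite_vertices by (auto simp: discrete_model_def discrete_vector_def discrete_vector_axioms_def)
  let ?A = "{1..K}"
  let ?J = "\<lambda>u v. Determinant.det (joint_matrix M K X u v)"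
  let ?m = "\<lambda>u. Determinant.det (marginal_matrix M K X u)"
  define r where "r u v = \<bar>?J u v\<bar> / sqrt (?m u * ?m v)" for u v
  have m_nonneg: "0 \<le> ?m u" for u
    unfolding det_marginal_matrix by (intro prod_nonneg) (simp add: marginal_nonneg)
  have r_sym: "r u v = r v u" for u v
    by (simp add: r_def joint_matrix_sym[of u v] mult.commute)
  have r_edge: "0 < r u v \<and> r u v < 1" if "{u, v} \<in> E" for u v
  proof -
    have "0 < - ln (r u v)" using edge[OF that] l by (simp add: discrete_dist_def r_def)
    moreover have "0 \<le> r u v" using m_nonneg by (simp add: r_def)
    ultimately show ?thesis by (cases "r u v = 0") auto
  qed
  \<comment> \<open>A zero determinant would make the quotient \<open>r\<close> zero on every edge
    at \<open>u\<close>, and there is such an edge. As the determinant is the product of the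
    marginals, every value has positive probability at \<open>u\<close>.\<close>
  have m_pos: "0 < ?m u" if u: "u \<in> W" for u
  proof -
    have "W \<noteq> {u}" using card by auto
    then obtain v where "v \<in> W" "u \<noteq> v" using u by blast
    then have "r u (next_vertex u v) \<noteq> 0" using r_edge[OF path_Cons(2)[OF u]] by force
    then have "?m u \<noteq> 0" by (auto simp: r_def)
    then show ?thesis using m_nonneg[of u] by simp
  qed
  have pos: "marginal {u} x \<noteq> 0" if "u \<in> W" "x u \<in> ?A" for u x
  proof -
    have "\<forall>a<K. marginal {u} (\<lambda>_. Suc a) \<noteq> 0"
      using m_pos[OF that(1)] unfolding det_marginal_matrix
      by (metis finite_lessThan lessThan_iff less_irrefl prod_zero_iff)
    then have "marginal {u} (\<lambda>_. Suc (x u - 1)) \<noteq> 0" using that(2) by (elim allE[of _ "x u - 1"]) auto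
    then show ?thesis using that(2) by (simp add: marginal_def)
  qed
  define E' where "E' U = {e \<in> E. e \<subseteq> U}" for U
  \<comment> \<open>Summing out a leaf leaves a function of the value at its neighbour. The vertex
    potentials \<open>\<phi>\<close> make room for it, so that the factorized form is
    preserved.\<close>
  define P where "P U \<longleftrightarrow> (\<exists>\<phi> \<psi>. \<forall>x\<in>W \<rightarrow> ?A.
      marginal U x = (\<Prod>v\<in>U. \<phi> v (x v)) * (\<Prod>e\<in>E' U. \<psi> e (restrict x e)))" for U
  have "metric_tree W E (\<lambda>u v. if u = v then 0 else - ln (r u v))"
  proof (rule metric_tree_of_multiplicative[OF r_sym r_edge])
    fix u v assume uv: "u \<in> W" "v \<in> W" "u \<noteq> v" "next_vertex u v \<noteq> v"
    show "r u v = r u (next_vertex u v) * r (next_vertex u v) v"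
    proof (rule leaf_elimination[where P = P, OF r_sym _ _ uv])
      obtain \<psi> where \<psi>: "\<And>x. x \<in> W \<rightarrow> ?A \<Longrightarrow> marginal W x = (\<Prod>e\<in>E. \<psi> e (restrict x e))"
        using G unfolding discrete_model_def factorizes_on_def marginal_def by blast
      have "E' W = E" using edgeE by (auto simp: E'_def)
      then show "P W" unfolding P_def using \<psi> by (intro exI[of _ "\<lambda>_ _. 1"] exI[of _ \<psi>]) simp
    next
      fix U i j assume U: "subtree U" and ij: "leaf U i j" and PU: "P U"
      note l = leafD[OF ij]
      have UW: "U \<subseteq> W" using U by (simp add: subtree_def)
      have finU: "finite U" by (rule subtree_finite[OF U])
      obtain \<phi> \<psi> where \<phi>\<psi>: "\<And>x. x \<in> W \<rightarrow> ?A \<Longrightarrow>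
          marginal U x = (\<Prod>v\<in>U. \<phi> v (x v)) * (\<Prod>e\<in>E' U. \<psi> e (restrict x e))"
        using PU unfolding P_def by blast
      define U' where "U' = U - {i}"
      have U': "U = insert i U'" "i \<notin> U'" "U' \<subseteq> W" "j \<in> U'" "finite U'" "i \<in> W"
        using l(1,2,4) UW finU by (auto simp: U'_def)
      have EU: "E' U = insert {i, j} (E' U')" "{i, j} \<notin> E' U'" "finite (E' U')"
      proof -
        have "e = {i, j}" if e: "e \<in> E" "e \<subseteq> U" "i \<in> e" for e
        proof -
          obtain q where q: "e = {i, q}" using edgeE[OF e(1)] e(3) by auto
          then have "q = j" using l(5)[of q] e by auto
          then show ?thesis using q by simp
        qed
        then show "E' U = insert {i, j} (E' U')" using l(1-4) unfolding E'_def U'_def by blast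
        show "{i, j} \<notin> E' U'" "finite (E' U')" using finite_edges by (auto simp: E'_def U'_def)
      qed
      define Q where "Q x = (\<Prod>v\<in>U'. \<phi> v (x v)) * (\<Prod>e\<in>E' U'. \<psi> e (restrict x e))" for x
      \<comment> \<open>\<open>\<kappa>\<close> collects the factors that see the leaf,
        \<open>Q\<close> the remaining ones. The sum \<open>s\<close> of \<open>\<kappa>\<close>
        over the leaf is the message that the leaf sends to \<open>j\<close>.\<close>
      define \<kappa> where "\<kappa> a b = \<phi> i a * \<psi> {i, j} (restrict ((\<lambda>_. b)(i := a)) {i, j})" for a b
      define s where "s b = (\<Sum>a\<in>?A. \<kappa> a b)" for b
      have ins: "marginal (insert i U') (x(i := a)) = \<kappa> a (x j) * Q x" if "x \<in> W \<rightarrow> ?A" "a \<in> ?A" for x a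
      proof -
        have "x(i := a) \<in> W \<rightarrow> ?A" using that by auto
        from \<phi>\<psi>[OF this] have "marginal (insert i U') (x(i := a)) =
            (\<Prod>v\<in>insert i U'. \<phi> v ((x(i := a)) v)) * (\<Prod>e\<in>insert {i, j} (E' U'). \<psi> e (restrict (x(i := a)) e))"
          using U'(1) EU(1) by simp
        moreover have "(\<Prod>v\<in>insert i U'. \<phi> v ((x(i := a)) v)) = \<phi> i a * (\<Prod>v\<in>U'. \<phi> v (x v))"
          using U' by (subst prod.insert) (auto intro!: prod.cong)
        moreover have "(\<Prod>e\<in>insert {i, j} (E' U'). \<psi> e (restrict (x(i := a)) e)) =
            \<psi> {i, j} (restrict ((\<lambda>_. x j)(i := a)) {i, j}) * (\<Prod>e\<in>E' U'. \<psi> e (restrict x e))"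
        proof -
          have 1: "restrict (x(i := a)) {i, j} = restrict ((\<lambda>_. x j)(i := a)) {i, j}" by auto
          have 2: "restrict (x(i := a)) e = restrict x e" if "e \<in> E' U'" for e
            using that U'(2) by (intro restrict_ext) (auto simp: E'_def)
          show ?thesis using EU by (subst prod.insert) (simp_all only: 1 2 simp_thms cong: prod.cong)
        qed
        ultimately show ?thesis by (simp add: \<kappa>_def Q_def)
      qed
      have Qs: "marginal U' x = s (x j) * Q x" if "x \<in> W \<rightarrow> ?A" for x
        using ins[OF that] U' by (subst marginal_sum[of _ i]) (auto simp: s_def sum_distrib_right)
      have "P U'"
        unfolding P_def
      proof (intro exI ballI)
        fix x assume x: "x \<in> W \<rightarrow> ?A"
        \<comment> \<open>The message is absorbed into the vertex potential of
          \<open>j\<close>.\<close>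
        have "(\<Prod>v\<in>U'. (\<phi>(j := \<lambda>b. s b * \<phi> j b)) v (x v)) = s (x j) * (\<Prod>v\<in>U'. \<phi> v (x v))"
        proof -
          have "(\<Prod>v\<in>U' - {j}. (\<phi>(j := \<lambda>b. s b * \<phi> j b)) v (x v)) = (\<Prod>v\<in>U' - {j}. \<phi> v (x v))"
            by (rule prod.cong) auto
          then show ?thesis using U'(4,5) by (simp add: prod.remove[of U' j])
        qed
        then show "marginal U' x = (\<Prod>v\<in>U'. (\<phi>(j := \<lambda>b. s b * \<phi> j b)) v (x v)) * (\<Prod>e\<in>E' U'. \<psi> e (restrict x e))"
          using Qs[OF x] by (simp add: Q_def mult.assoc)
      qed
      moreover have "r i k = r i j * r j k" if k: "k \<in> U - {i, j}" for k
      proof -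
        have kU: "k \<in> U'" "k \<noteq> j" "k \<noteq> i" "k \<in> W" "j \<in> W" using k UW l(2) by (auto simp: U'_def)
        have base: "marginal (insert i U') (x(i := a)) * s (x j) = \<kappa> a (x j) * marginal U' x"
          if "x \<in> W \<rightarrow> ?A" "a \<in> ?A" for x a
          using ins[OF that] Qs[OF that(1)] by simp
        have ker: "marginal (insert i S) (x(i := a)) * s (x j) = \<kappa> a (x j) * marginal S x"
          if S: "S = {j} \<or> S = {j, k}" and x: "x \<in> W \<rightarrow> ?A" "a \<in> ?A" for S x a
        proof -
          have "U' - (U' - S) = S" using S kU U'(4) by auto
          moreover have "U' - S \<subseteq> U' - {j}" using S by auto
          ultimately show ?thesis
            using marginal_kernel[OF U'(3,6,2) _ base x l(4)] by metis
        qed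
        \<comment> \<open>If \<open>s b = 0\<close>, every configuration of \<open>U'\<close> with
          value \<open>b\<close> at \<open>j\<close> has probability zero, and so would the value
          \<open>b\<close> itself.\<close>
        have s0: "s b \<noteq> 0" if b: "b \<in> ?A" for b
        proof
          assume 0: "s b = 0"
          have "marginal (U' - (U' - {j})) (\<lambda>_. b) = 0"
            by (rule marginal_eq_0_antimono[where b = b, OF U'(3)]) (use Qs 0 b in auto)
          moreover have "U' - (U' - {j}) = {j}" using U'(4) by auto
          ultimately show False using pos[of j "\<lambda>_. b"] kU b by simp
        qed
        have "?J i k * ?m j = ?J i j * ?J j k"
          by (rule det_joint_of_kernel[OF U'(6) kU(5,4) l(4) kU(3)[symmetric] kU(2)[symmetric] s0 ker])
        then have J: "?J i k = ?J i j * ?J j k / ?m j" using m_pos[OF kU(5)] by (simp add: field_simps)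
        show ?thesis
          using m_pos[OF kU(5)] m_pos[OF kU(4)] m_pos[OF U'(6)]
          by (simp add: r_def J abs_mult real_sqrt_mult field_simps)
      qed
      ultimately show "P (U - {i}) \<and> (\<forall>k\<in>U - {i, j}. r i k = r i j * r j k)" by (simp add: U'_def)
    qed
  qed
  then show ?thesis by (simp add: r_def discrete_dist_def cong: if_cong)
qed

section \<open>The relationship test on a subtree\<close>

text \<open>
  \<open>U\<close> is the part of the tree that is still to be recovered and \<open>Y\<close> the set of active vertices in
  it; the vertices in \<open>U - Y\<close> are hidden vertices not yet found, which have not lost a neighbour.
\<close>

locale active_subtree = metric_tree +
  fixes U Y :: "'a set"
  assumes U: "subtree U" and Y: "Y \<subseteq> U"
    and unfound: "\<And>w. w \<in> U - Y \<Longrightarrow> 3 \<le> card (neighbors E w) \<and> neighbors E w \<subseteq> U"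
begin

lemma UW: "u \<in> U \<Longrightarrow> u \<in> W" and YU: "y \<in> Y \<Longrightarrow> y \<in> U" and YW: "y \<in> Y \<Longrightarrow> y \<in> W"
  using U Y by (auto simp: subtree_def)

lemma ex_third_neighbor:
  assumes "w \<in> U - Y"
  obtains z where "{w, z} \<in> E" "z \<in> U" "z \<noteq> a" "z \<noteq> b"
proof -
  have "\<not> neighbors E w \<subseteq> {a, b}"
    using unfound[OF assms] card_mono[of "{a, b}" "neighbors E w"] card_insert_le_m1[of 2 "{b}" a] by auto
  then obtain z where "z \<in> neighbors E w" "z \<noteq> a" "z \<noteq> b" by blast
  then show ?thesis using unfound[OF assms] that[of z] by (auto simp: neighbors_iff)
qed

text \<open>The vertex of the branch that is farthest from \<open>u\<close> is active: an inactive
  one has a neighbour other than the step back to \<open>u\<close>, and this neighbour is farther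
  away in the same branch.\<close>

lemma ex_active_beyond:
  assumes u: "u \<in> U" and q: "q \<in> U" "{u, q} \<in> E"
  obtains y where "y \<in> Y" "y \<noteq> u" "next_vertex u y = q"
proof -
  let ?B = "{y \<in> U. y \<noteq> u \<and> next_vertex u y = q}"
  have fin: "finite ?B" using subtree_finite[OF U] by simp
  have "q \<in> ?B" using q edge_in[OF q(2)] next_vertex_neighbor[OF q(2)] by auto
  then have ne: "(\<lambda>y. hops y u) ` ?B \<noteq> {}" by blast
  obtain y where y: "y \<in> ?B" "hops y u = Max ((\<lambda>y. hops y u) ` ?B)"
    using Max_in[OF finite_imageI[OF fin] ne] by auto
  have "y \<in> Y"
  proof (rule ccontr)
    assume "y \<notin> Y"
    then obtain z where z: "{y, z} \<in> E" "z \<in> U" "z \<noteq> next_vertex y u"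
      using ex_third_neighbor[of y] y(1) by blast
    have nz: "next_vertex z u = y" "z \<noteq> u" "hops z u = Suc (hops y u)"
      using next_back[OF z(1) UW[OF u] _ z(3)] hops_farther[OF z(1) UW[OF u] _ z(3)] y(1) by auto
    have "next_vertex u z = next_vertex u y"
      using next_vertex_extend[of z u y] nz z(2) u y(1) UW by auto
    then have "z \<in> ?B" using z(2) nz y(1) by auto
    then have "hops z u \<le> hops y u" using y(2) fin by simp
    then show False using nz by simp
  qed
  then show ?thesis using that y(1) by auto
qed

lemma d_next: "u \<in> U \<Longrightarrow> v \<in> U \<Longrightarrow> u \<noteq> v \<Longrightarrow> d u v = d u (next_vertex u v) + d (next_vertex u v) v"
  using additive UW by blast

text \<open>The witness \<open>k\<close> sees both \<open>i\<close> and \<open>j\<close> through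
  \<open>x\<close>, so the test value at \<open>k\<close> is \<open>d i x - d j x\<close>. An active
  \<open>x\<close> is its own witness; any other \<open>x\<close> has a third branch, which contains
  an active vertex.\<close>

lemma ex_active_at:
  assumes x: "x \<in> U" "x \<noteq> i" "x \<noteq> j" and ij: "i \<in> Y" "j \<in> Y" and n: "next_vertex x i \<noteq> next_vertex x j"
  obtains k where "k \<in> Y - {i, j}" "d i k = d i x + d x k" "d j k = d j x + d x k"
proof (cases "x \<in> Y")
  case True
  then show ?thesis using that[of x] x by auto
next
  case False
  then obtain z where z: "{x, z} \<in> E" "z \<in> U" "z \<noteq> next_vertex x i" "z \<noteq> next_vertex x j"
    using ex_third_neighbor[of x] x(1) by blast
  obtain k where k: "k \<in> Y" "k \<noteq> x" "next_vertex x k = z" using ex_active_beyond[OF x(1) z(2,1)] .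
  show ?thesis
  proof (rule that[of k])
    show "k \<in> Y - {i, j}" using k z by auto
    show "d i k = d i x + d x k" using d_through[of i x k] x ij k z YW UW by metis
    show "d j k = d j x + d x k" using d_through[of j x k] x ij k z YW UW by metis
  qed
qed

text \<open>The value \<open>d i j\<close> occurs only where \<open>i\<close> sees \<open>k\<close>
  through \<open>j\<close>. If the next vertex \<open>p\<close> were not \<open>j\<close>, a witness
  at \<open>p\<close> would give the smaller value \<open>d i p - d j p\<close>; a second branch at
  \<open>i\<close> would contain an active vertex with value \<open>- d i j\<close>.\<close>

lemma leaf_of_first:
  assumes ij: "i \<in> Y" "j \<in> Y" "i \<noteq> j" and all: "\<And>k. k \<in> Y - {i, j} \<Longrightarrow> d i k - d j k = d i j"
  shows "leaf U i j"
proof -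
  have iU: "i \<in> U" "j \<in> U" and iW: "i \<in> W" "j \<in> W" using ij YU YW by auto
  have pos: "0 < d i j" by (rule d_pos[OF iW ij(3)])
  let ?p = "next_vertex i j"
  have p: "?p \<in> U" "{i, ?p} \<in> E" using subtree_next[OF U iU ij(3)] by auto
  have pj: "?p = j"
  proof (rule ccontr)
    assume ne: "?p \<noteq> j"
    have "next_vertex ?p i = i" using next_vertex_neighbor p by (simp add: insert_commute)
    moreover have "next_vertex ?p j \<noteq> i" using next_next_ne[OF iW ij(3) ne] .
    ultimately obtain k where k: "k \<in> Y - {i, j}" "d i k = d i ?p + d ?p k" "d j k = d j ?p + d ?p k"
      using ex_active_at[OF p(1) _ ne ij(1,2)] edge_in[OF p(2)] by metis
    have "d i j = d i ?p + d ?p j" by (rule d_next[OF iU ij(3)])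
    then show False using all[OF k(1)] k d_sym[of j ?p] d_pos[OF UW[OF p(1)] iW(2) ne] by simp
  qed
  have "q = j" if q: "{i, q} \<in> E" "q \<in> U" for q
  proof (rule ccontr)
    assume "q \<noteq> j"
    obtain y where y: "y \<in> Y" "y \<noteq> i" "next_vertex i y = q" using ex_active_beyond[OF iU(1) q(2,1)] .
    have yj: "y \<noteq> j" using y pj \<open>q \<noteq> j\<close> by auto
    have "d j y = d j i + d i y"
      by (rule d_through) (use iW y YW pj \<open>q \<noteq> j\<close> ij in auto)
    then show False using all[of y] y yj d_sym[of j i] pos by simp
  qed
  then have "neighbors E i \<inter> U \<subseteq> {j}" by (auto simp only: neighbors_def)
  then show ?thesis using p pj iU by (auto simp: leaf_def neighbors_iff)
qed

lemma leaf_d: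
  assumes "leaf U i x" "k \<in> U" "k \<noteq> i"
  shows "d i k = d i x + d x k"
  using leaf_next[OF U assms] d_next[OF leafD(1)[OF assms(1)] assms(2)] assms(3) by auto

lemma first_test_iff:
  assumes ij: "i \<in> Y" "j \<in> Y" "i \<noteq> j"
  shows "(\<forall>k\<in>Y - {i, j}. d i k - d j k = d i j) \<longleftrightarrow> leaf U i j"
proof
  show "leaf U i j" if "\<forall>k\<in>Y - {i, j}. d i k - d j k = d i j"
    using leaf_of_first[OF ij] that by auto
  show "\<forall>k\<in>Y - {i, j}. d i k - d j k = d i j" if "leaf U i j"
    using leaf_d[OF that] YU by auto
qed

lemma second_test_iff:
  assumes ij: "i \<in> Y" "j \<in> Y" "i \<noteq> j"
  shows "(\<forall>k\<in>Y - {i, j}. d i k - d j k = - d i j) \<longleftrightarrow> leaf U j i"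
proof -
  have "(\<forall>k\<in>Y - {i, j}. d i k - d j k = - d i j) \<longleftrightarrow> (\<forall>k\<in>Y - {j, i}. d j k - d i k = d j i)"
    unfolding d_sym[of j i] insert_commute[of j i] by (intro ball_cong refl) linarith
  then show ?thesis using first_test_iff[of j i] ij by auto
qed

text \<open>A second branch at \<open>i\<close> contains an active vertex where the value is
  \<open>- d i j\<close>. Constancy then makes \<open>j\<close> a leaf at \<open>i\<close>, the
  excluded case.\<close>

lemma leaf_of_constant:
  assumes ij: "i \<in> Y" "j \<in> Y" "i \<noteq> j" and c: "\<And>k. k \<in> Y - {i, j} \<Longrightarrow> d i k - d j k = c"
    and nl: "\<not> leaf U i j" "\<not> leaf U j i"
  shows "next_vertex i j \<noteq> j" "leaf U i (next_vertex i j)"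
proof -
  have iU: "i \<in> U" "j \<in> U" and iW: "i \<in> W" "j \<in> W" using ij YU YW by auto
  let ?p = "next_vertex i j"
  have p: "?p \<in> U" "{i, ?p} \<in> E" using subtree_next[OF U iU ij(3)] by auto
  have "q = ?p" if q: "{i, q} \<in> E" "q \<in> U" for q
  proof (rule ccontr)
    assume ne: "q \<noteq> ?p"
    obtain y where y: "y \<in> Y" "y \<noteq> i" "next_vertex i y = q" using ex_active_beyond[OF iU(1) q(2,1)] .
    have yj: "y \<noteq> j" using y ne by auto
    have "d j y = d j i + d i y"
      by (rule d_through) (use iW y YW ne ij in auto)
    then have "c = - d i j" using c[of y] y yj d_sym[of j i] by simp
    then show False using second_test_iff[OF ij] c nl by auto
  qed
  then have "neighbors E i \<inter> U \<subseteq> {?p}" by (auto simp only: neighbors_def)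
  then show lf: "leaf U i ?p" using p iU by (auto simp: leaf_def neighbors_iff)
  then show "?p \<noteq> j" using nl by auto
qed

definition root :: "'a \<Rightarrow> 'a" where
  "root u = (if \<exists>j. leaf U u j then THE j. leaf U u j else u)"

lemma leaf_unique: "leaf U u j \<Longrightarrow> leaf U u k \<Longrightarrow> j = k"
  by (auto simp: leaf_def)

lemma root_leaf: "leaf U u j \<Longrightarrow> root u = j"
  unfolding root_def using leaf_unique by (auto intro!: the_equality)

lemma root_not_leaf: "(\<And>j. \<not> leaf U u j) \<Longrightarrow> root u = u"
  by (simp add: root_def)

text \<open>Witnesses at the two parents \<open>p\<close> and \<open>q\<close> give the same
  constant, and both parents lie between \<open>i\<close> and \<open>j\<close>. So difference and
  sum of the distances to \<open>i\<close> and \<open>j\<close> agree for \<open>p\<close> and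
  \<open>q\<close>, which forces \<open>d i p = d i q\<close>; but \<open>q\<close> lies beyond
  \<open>p\<close>, seen from \<open>i\<close>.\<close>

lemma leaf_of_sibling_constant:
  assumes ij: "i \<in> Y" "j \<in> Y" "i \<noteq> j" and c: "\<And>k. k \<in> Y - {i, j} \<Longrightarrow> d i k - d j k = c"
    and nl: "\<not> leaf U i j" "\<not> leaf U j i"
  shows "next_vertex i j = next_vertex j i"
proof (rule ccontr)
  let ?p = "next_vertex i j" and ?q = "next_vertex j i"
  assume ne: "?p \<noteq> ?q"
  have iU: "i \<in> U" "j \<in> U" and iW: "i \<in> W" "j \<in> W" using ij YU YW by auto
  note p = leaf_of_constant[OF ij c nl]
  have c': "d j k - d i k = - c" if "k \<in> Y - {j, i}" for k using c[of k] that by auto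
  note q = leaf_of_constant[OF ij(2,1) ij(3)[symmetric] c' nl(2,1)]
  have at: "d i x - d j x = c" "d i j = d i x + d j x"
    if x: "x \<in> U" "x \<noteq> i" "x \<noteq> j" "next_vertex x i \<noteq> next_vertex x j" for x
  proof -
    obtain k where k: "k \<in> Y - {i, j}" "d i k = d i x + d x k" "d j k = d j x + d x k"
      using ex_active_at[OF x(1-3) ij(1,2) x(4)] .
    then show "d i x - d j x = c" using c[OF k(1)] by simp
    show "d i j = d i x + d j x"
      using d_through[OF iW(1) UW[OF x(1)] iW(2)] x d_sym[of j x] by auto
  qed
  have p1: "?p \<in> U" "{i, ?p} \<in> E" "?p \<noteq> i" using leafD(1-4)[OF p(2)] by auto
  have q1: "?q \<in> U" "{j, ?q} \<in> E" "?q \<noteq> j" using leafD(1-4)[OF q(2)] by auto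
  have "next_vertex ?p i = i" using next_vertex_neighbor[of ?p i] p1 by (simp add: insert_commute)
  then have P: "d i ?p - d j ?p = c" "d i j = d i ?p + d j ?p"
    using at[OF p1(1,3) p(1)] next_next_ne[OF iW ij(3) p(1)] by auto
  have "next_vertex ?q j = j" using next_vertex_neighbor[of ?q j] q1 by (simp add: insert_commute)
  then have Q: "d i ?q - d j ?q = c" "d i j = d i ?q + d j ?q"
    using at[OF q1(1) q(1) q1(3)] next_next_ne[OF iW(2,1) ij(3)[symmetric] q(1)] by auto
  have "d i ?q = d i ?p + d ?p ?q" by (rule leaf_d[OF p(2) q1(1) q(1)])
  then show False using P Q d_pos[OF UW[OF p1(1)] UW[OF q1(1)] ne] by simp
qed

lemma active_distances_sibling:
  assumes "leaf U i x" "leaf U j x" "k \<in> U" "k \<noteq> i" "k \<noteq> j"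
  shows "d i k - d j k = d i x - d j x"
  using leaf_d[OF assms(1,3,4)] leaf_d[OF assms(2,3,5)] by simp

end

section \<open>Rounds with at least three active vertices\<close>

locale active_subtree3 = active_subtree +
  assumes three: "3 \<le> card Y"
begin

lemma ex_third_active: obtains k where "k \<in> Y" "k \<noteq> a" "k \<noteq> b"
proof -
  have "\<not> Y \<subseteq> {a, b}"
    using three card_mono[of "{a, b}" Y] card_insert_le_m1[of 2 "{b}" a] by auto
  then show ?thesis using that by auto
qed

text \<open>Two leaves at each other would both see a third active vertex only through the other
  one. Hence the root of a leaf is its own root, and \<open>root\<close> is idempotent.\<close>

lemma leaf_parent_not_leaf:
  assumes ij: "leaf U i j"
  shows "\<not> leaf U j q"
proof
  assume jq: "leaf U j q"
  have "q = i" using leafD(5)[OF jq, of i] leafD(1-4)[OF ij] by (auto simp: insert_commute)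
  obtain k where k: "k \<in> Y" "k \<noteq> i" "k \<noteq> j" by (rule ex_third_active)
  have "d i k = d i j + d j k" using leaf_d[OF ij YU[OF k(1)] k(2)] .
  moreover have "d j k = d j i + d i k" using leaf_d[OF jq YU[OF k(1)] k(3)] \<open>q = i\<close> by simp
  ultimately show False using d_pos[of i j] leafD(1-4)[OF ij] UW d_sym[of i j] by fastforce
qed

lemma root_parent: "leaf U i j \<Longrightarrow> root j = j"
  using root_not_leaf leaf_parent_not_leaf by blast

lemma root_in: "u \<in> U \<Longrightarrow> root u \<in> U"
  using root_leaf root_not_leaf leafD(2) by metis

lemma root_eq_iff:
  assumes "i \<noteq> j"
  shows "root i = root j \<longleftrightarrow> leaf U i j \<or> leaf U j i \<or> (\<exists>x. leaf U i x \<and> leaf U j x)"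
proof
  assume eq: "root i = root j"
  show "leaf U i j \<or> leaf U j i \<or> (\<exists>x. leaf U i x \<and> leaf U j x)"
    using eq assms root_leaf root_not_leaf by metis
next
  assume "leaf U i j \<or> leaf U j i \<or> (\<exists>x. leaf U i x \<and> leaf U j x)"
  then show "root i = root j" using root_leaf root_parent by metis
qed

text \<open>The leaf verdicts are the special constants \<open>d i j\<close> and
  \<open>- d i j\<close>, so the three positive verdicts together amount to constancy. This makes
  them an equivalence relation, which the grouping relies on.\<close>

lemma constant_test_iff:
  assumes ij: "i \<in> Y" "j \<in> Y" "i \<noteq> j"
  shows "(\<exists>c. \<forall>k\<in>Y - {i, j}. d i k - d j k = c) \<longleftrightarrow> root i = root j"
proof
  assume "\<exists>c. \<forall>k\<in>Y - {i, j}. d i k - d j k = c"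
  then obtain c where c: "\<And>k. k \<in> Y - {i, j} \<Longrightarrow> d i k - d j k = c" by blast
  have c': "d j k - d i k = - c" if "k \<in> Y - {j, i}" for k using c[of k] that by auto
  show "root i = root j"
  proof (cases "leaf U i j \<or> leaf U j i")
    case True
    then show ?thesis using root_eq_iff[OF ij(3)] by blast
  next
    case False
    then have nl: "\<not> leaf U i j" "\<not> leaf U j i" by auto
    show ?thesis
      using leaf_of_constant(2)[OF ij c nl] leaf_of_constant(2)[OF ij(2,1) ij(3)[symmetric] c' nl(2,1)]
        leaf_of_sibling_constant[OF ij c nl] root_leaf by metis
  qed
next
  assume "root i = root j"
  then consider "leaf U i j" | "leaf U j i" | x where "leaf U i x" "leaf U j x"
    using root_eq_iff[OF ij(3)] by blast
  then show "\<exists>c. \<forall>k\<in>Y - {i, j}. d i k - d j k = c"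
  proof cases
    case 1
    then show ?thesis using first_test_iff[OF ij] by blast
  next
    case 2
    then show ?thesis using second_test_iff[OF ij] by blast
  next
    case 3
    then show ?thesis using active_distances_sibling YU by blast
  qed
qed

text \<open>The block of \<open>u\<close> has at least two elements.\<close>

definition shared :: "'a \<Rightarrow> bool" where
  "shared u \<longleftrightarrow> (\<exists>k\<in>Y. k \<noteq> u \<and> root k = root u)"

text \<open>The vertices whose edge to the root is found in this round. A leaf alone in its block
  stays, since no test has related it to another active vertex.\<close>

definition removed :: "'a set" where
  "removed = {u \<in> Y. shared u \<and> root u \<noteq> u}"

definition next_active :: "'a set" where
  "next_active = {u \<in> Y. \<not> shared u} \<union> root ` {u \<in> Y. shared u}"

lemma root_idem: "root (root u) = root u"
  using root_leaf root_not_leaf root_parent by metis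

lemma leaf_iff_root: "root u \<noteq> u \<Longrightarrow> leaf U u (root u)"
  using root_leaf root_not_leaf by metis

lemma subtree_next_round: "subtree (U - removed)"
proof (rule subtree_remove_leaves[OF U])
  show "\<exists>j. leaf U i j" if "i \<in> removed" for i using that leaf_iff_root by (auto simp: removed_def)
  obtain y where "y \<in> Y" using three by fastforce
  then have "root y \<in> U" using root_in YU by auto
  then show "U - removed \<noteq> {}" using root_idem by (auto simp: removed_def)
qed

lemma next_active_subset: "next_active \<subseteq> U - removed"
proof
  fix u assume "u \<in> next_active"
  then consider "u \<in> Y" "\<not> shared u" | y where "y \<in> Y" "u = root y" by (auto simp: next_active_def)
  then show "u \<in> U - removed"
    using root_in root_idem YU by cases (auto simp: removed_def)
qed

lemma active_cases: "u \<in> Y \<Longrightarrow> u \<in> removed \<or> u \<in> next_active"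
  unfolding removed_def next_active_def by (cases "shared u") force+

lemma parent_active:
  assumes "i \<in> removed" "leaf U i w"
  shows "w \<in> next_active"
  using assms root_leaf[OF assms(2)] by (auto simp: removed_def next_active_def)

text \<open>Within \<open>U\<close> a removed leaf is adjacent only to its root, and the root
  becomes active. So a vertex that is still inactive has kept all its neighbours.\<close>

lemma active_subtree_next_round: "active_subtree W E d (U - removed) next_active"
proof
  show "subtree (U - removed)" by (rule subtree_next_round)
  show "next_active \<subseteq> U - removed" by (rule next_active_subset)
next
  fix w assume w: "w \<in> (U - removed) - next_active"
  then have wY: "w \<in> U - Y" using active_cases by auto
  have "i \<notin> removed" if "i \<in> neighbors E w" for i
  proof
    assume i: "i \<in> removed"
    then obtain j where j: "leaf U i j" using leaf_iff_root by (auto simp: removed_def)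
    have "w = j" using leafD(5)[OF j] that wY by (auto simp: neighbors_iff insert_commute)
    then show False using parent_active[OF i j] w by simp
  qed
  then show "3 \<le> card (neighbors E w) \<and> neighbors E w \<subseteq> U - removed"
    using unfound[OF wY] by auto
qed

lemma diam_set: "finite V \<Longrightarrow> finite {hops u v | u v. u \<in> V \<and> v \<in> V}"
  by (rule finite_subset[of _ "(\<lambda>(u, v). hops u v) ` (V \<times> V)"]) auto

text \<open>
  An end \<open>u\<close> of a longest path of \<open>U\<close> is a leaf, and so are all neighbours of its parent except
  the next vertex of the path. Hence the block of \<open>u\<close> is not a singleton.
\<close>

lemma longest_path_end_removed:
  assumes uv: "u \<in> U" "v \<in> U" and max: "\<And>a b. a \<in> U \<Longrightarrow> b \<in> U \<Longrightarrow> hops a b \<le> hops u v"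
  shows "u \<in> removed"
proof -
  obtain a where a: "a \<in> Y" using three by fastforce
  obtain b where b: "b \<in> Y" "b \<noteq> a" by (rule ex_third_active)
  have "0 < hops a b" using hops_next[of a b] a b YW by auto
  then have ne: "u \<noteq> v" using max[of a b] a b YU hops_self[OF UW[OF uv(1)]] by force
  have end_leaf: "leaf U w (next_vertex w v)" if "w \<in> U" "w \<noteq> v" "hops w v = hops u v" for w
    using farthest_is_leaf[OF U that(1) uv(2) that(2)] max[OF _ uv(2)] that(3) by simp
  define x where "x = next_vertex u v"
  have lu: "leaf U u x" unfolding x_def by (rule end_leaf[OF uv(1) ne refl])
  have x: "x \<in> U" "{u, x} \<in> E" "u \<noteq> x" using leafD(1-4)[OF lu] by auto
  have uY: "y \<in> Y" if lf: "leaf U y q" for y q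
  proof (rule ccontr)
    assume "y \<notin> Y"
    then obtain z where "{y, z} \<in> E" "z \<in> U" "z \<noteq> q" using ex_third_neighbor[of y] leafD(1)[OF lf] by blast
    then show False using leafD(5)[OF lf] by blast
  qed
  have hx: "hops u v = Suc (hops x v)"
    unfolding x_def by (rule hops_next[OF UW[OF uv(1)] UW[OF uv(2)] ne])
  \<comment> \<open>Otherwise a longest path would have a single edge, whereas a third active vertex
    is reached from \<open>u\<close> through \<open>x\<close> in at least two hops.\<close>
  have xv: "x \<noteq> v"
  proof
    assume "x = v"
    then have h: "hops u v = 1" using hx UW[OF uv(2)] by simp
    obtain k where k: "k \<in> Y" "k \<noteq> u" "k \<noteq> x" by (rule ex_third_active)
    have "hops u k = Suc (hops x k)"
      using hops_next[of u k] leaf_next[OF U lu YU[OF k(1)] k(2)] UW uv k YU by auto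
    moreover have "0 < hops x k" using hops_next[of x k] k x YW UW by auto
    ultimately show False using max[OF uv(1) YU[OF k(1)]] h by simp
  qed
  have "shared u"
  proof (cases "x \<in> Y")
    case True
    then show ?thesis using x(3) root_leaf[OF lu] root_parent[OF lu] by (auto simp: shared_def)
  next
    case False
    then obtain q where q: "{x, q} \<in> E" "q \<in> U" "q \<noteq> u" "q \<noteq> next_vertex x v"
      using ex_third_neighbor[of x] x(1) by blast
    have "next_vertex q v = x" "q \<noteq> v" "hops q v = hops u v"
      using next_back[OF q(1) UW[OF uv(2)] xv q(4)] hops_farther[OF q(1) UW[OF uv(2)] xv q(4)] hx by auto
    then have "leaf U q x" using end_leaf[OF q(2)] by auto
    then show ?thesis using q(3) uY root_leaf[OF lu] root_leaf unfolding shared_def by metis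
  qed
  then show ?thesis using uY[OF lu] root_leaf[OF lu] x(3) by (auto simp: removed_def)
qed

text \<open>Hops are measured in the whole tree and do not change when leaves are removed. Two
  remaining vertices at the old maximal distance would be the ends of a longest path of
  \<open>U\<close>, but such an end has been removed.\<close>

lemma diam_next_round: "diam (U - removed) E < diam U E"
proof -
  let ?S = "\<lambda>V. {hops u v | u v. u \<in> V \<and> v \<in> V}"
  have fin: "finite (?S U)" "finite (?S (U - removed))"
    by (rule diam_set, use subtree_finite[OF U] in simp)+
  have ne: "?S (U - removed) \<noteq> {}" using subtree_next_round by (auto simp: subtree_def)
  obtain u v where uv: "u \<in> U - removed" "v \<in> U - removed" "diam (U - removed) E = hops u v"
    using Max_in[OF fin(2) ne] unfolding diam_def by auto
  have "hops u v < diam U E"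
  proof (rule ccontr)
    assume "\<not> ?thesis"
    then have "hops a b \<le> hops u v" if "a \<in> U" "b \<in> U" for a b
      using Max_ge[OF fin(1), of "hops a b"] that unfolding diam_def by force
    then have "u \<in> removed" using uv by (intro longest_path_end_removed[of u v]) auto
    then show False using uv by simp
  qed
  then show ?thesis using uv by simp
qed

end

section \<open>The last active vertices\<close>

context active_subtree
begin

text \<open>An inactive vertex has at least three branches with an active vertex in each, and
  different branches contain different ones.\<close>

lemma all_active:
  assumes "card Y < 3"
  shows "U = Y"
proof (rule ccontr)
  assume "U \<noteq> Y"
  then obtain w where w: "w \<in> U - Y" using Y by auto
  have N: "3 \<le> card (neighbors E w)" "neighbors E w \<subseteq> U" using unfound[OF w] by auto
  have "neighbors E w \<subseteq> next_vertex w ` Y"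
  proof
    fix q assume "q \<in> neighbors E w"
    then show "q \<in> next_vertex w ` Y" using ex_active_beyond[of w q] w N by (force simp: neighbors_iff)
  qed
  moreover have "finite Y" using Y subtree_finite[OF U] finite_subset by auto
  ultimately have "card (neighbors E w) \<le> card Y" using surj_card_le by blast
  then show False using N assms by simp
qed

lemma two_active:
  assumes "Y = {a, b}" "a \<noteq> b"
  shows "{a, b} \<in> E"
proof -
  have "U = {a, b}" using all_active assms by (simp add: card_insert_if)
  then have "next_vertex a b \<in> {a, b}" "{a, next_vertex a b} \<in> E"
    using subtree_next[OF U] assms by auto
  then show ?thesis using edge_in[of a a] by auto
qed

end

section \<open>Counted computations\<close>

text \<open>An upper bound on the cost, uniform in the initial counter. Branches of different cost
  then share one bound by \<open>computes_mono\<close>.\<close>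

definition computes :: "'a counted \<Rightarrow> 'a \<Rightarrow> nat \<Rightarrow> bool" where
  "computes c x b \<longleftrightarrow> (\<forall>t. \<exists>t'\<le>t + b. run_state c t = (x, t'))"

lemma computes_return: "computes (State_Monad.return x) x 0"
  by (simp add: computes_def)

lemma computes_tick: "computes (tick x) x 1"
  by (simp add: computes_def tick_def State_Monad.update_def)

lemma computes_mono: "computes c x b \<Longrightarrow> b \<le> b' \<Longrightarrow> computes c x b'"
  unfolding computes_def by (meson add_left_mono order_trans)

lemma computes_bind:
  assumes "computes m x a" "computes (f x) y b"
  shows "computes (State_Monad.bind m f) y (a + b)"
  unfolding computes_def
proof
  fix t
  obtain t1 where t1: "t1 \<le> t + a" "run_state m t = (x, t1)" using assms(1) by (auto simp: computes_def)
  obtain t2 where "t2 \<le> t1 + b" "run_state (f x) t1 = (y, t2)" using assms(2) by (auto simp: computes_def)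
  then show "\<exists>t'\<le>t + (a + b). run_state (State_Monad.bind m f) t = (y, t')" using t1 by auto
qed

lemma computes_traverse_list:
  assumes "\<And>k. k \<in> set ks \<Longrightarrow> computes (f k) (g k) b"
  shows "computes (State_Monad.traverse_list f ks) (map g ks) (b * length ks)"
  using assms
proof (induction ks)
  case Nil
  then show ?case by (simp add: computes_return)
next
  case (Cons k ks)
  have "computes (State_Monad.traverse_list f (k # ks)) (map g (k # ks)) (b + (b * length ks + 0))"
    unfolding traverse_list.simps list.map
    by (intro computes_bind[OF Cons.prems] computes_bind[OF Cons.IH] computes_return Cons.prems) auto
  then show ?case by simp
qed

lemma computes_for_all:
  assumes "\<And>k. k \<in> set ks \<Longrightarrow> computes (p k) (q k) 1"
  shows "computes (for_all p ks) (\<forall>k\<in>set ks. q k) (length ks)"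
proof -
  have "computes (for_all p ks) (list_all id (map q ks)) (1 * length ks + 0)"
    unfolding for_all_def
    by (intro computes_bind[OF computes_traverse_list[OF assms]] computes_return)
  then show ?thesis by (simp add: list_all_iff)
qed

lemma computes_tabulate:
  assumes "\<And>k. k \<in> set ks \<Longrightarrow> computes (f k) (g k) b"
  obtains T where "computes (tabulate f ks) T (b * length ks)" "\<And>k. k \<in> set ks \<Longrightarrow> T k = g k"
proof
  show "computes (tabulate f ks) (\<lambda>k. the (map_of (zip ks (map g ks)) k)) (b * length ks)"
    using computes_bind[OF computes_traverse_list[OF assms] computes_return] by (simp add: tabulate_def)
  show "the (map_of (zip ks (map g ks)) k) = g k" if "k \<in> set ks" for k
    using that by (simp add: map_of_zip_map)
qed

lemma computes_iterate:
  assumes "\<And>k x. k \<in> set ks \<Longrightarrow> computes (f k x) (g k x) b"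
  shows "computes (iterate f ks x) (fold g ks x) (b * length ks)"
  using assms
proof (induction ks arbitrary: x)
  case Nil
  then show ?case by (simp add: computes_return)
next
  case (Cons k ks)
  have "computes (iterate f (k # ks) x) (fold g (k # ks) x) (b + b * length ks)"
    unfolding iterate.simps fold_simps
    by (intro computes_bind[OF Cons.prems] Cons.IH) (use Cons.prems in auto)
  then show ?case by simp
qed

section \<open>Values and cost of one round\<close>

definition verdict_of ::
  "'v dist_table \<Rightarrow> ('v node \<times> 'v node \<times> 'v node \<Rightarrow> real) \<Rightarrow> 'v node list \<Rightarrow> 'v node \<Rightarrow> 'v node \<Rightarrow> verdict" where
  "verdict_of d \<Phi> Y i j =
     (let ks = filter (\<lambda>k. k \<noteq> i \<and> k \<noteq> j) Y in
      if \<forall>k\<in>set ks. \<Phi> (i, j, k) = d i j then FirstLeafOfSecond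
      else if \<forall>k\<in>set ks. \<Phi> (i, j, k) = - d i j then SecondLeafOfFirst
      else if \<forall>k\<in>set ks. \<Phi> (i, j, k) = \<Phi> (i, j, hd ks) then LeafSiblings else Neither)"

text \<open>At most three passes over the other nodes, and one subtraction for
  \<open>- d i j\<close>.\<close>

lemma computes_test_node_relationships:
  "computes (test_node_relationships d \<Phi> Y i j) (verdict_of d \<Phi> Y i j) (3 * length Y + 1)"
proof -
  define ks where "ks = filter (\<lambda>k. k \<noteq> i \<and> k \<noteq> j) Y"
  have all: "computes (for_all (\<lambda>k. real_eq (\<Phi> (i, j, k)) a) ks) (\<forall>k\<in>set ks. \<Phi> (i, j, k) = a) (length ks)" for a
    by (rule computes_for_all) (simp only: real_eq_def computes_tick)
  have sub: "computes (real_sub 0 (d i j)) (- d i j) 1"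
    using computes_tick[of "0 - d i j"] by (simp add: real_sub_def)
  have 3: "computes
    (do {
       c \<leftarrow> for_all (\<lambda>k. real_eq (\<Phi> (i, j, k)) (\<Phi> (i, j, hd ks))) ks;
       State_Monad.return (if c then LeafSiblings else Neither)
     })
    (if \<forall>k\<in>set ks. \<Phi> (i, j, k) = \<Phi> (i, j, hd ks) then LeafSiblings else Neither) (length ks + 0)"
    by (rule computes_bind[OF all computes_return])
  have 2: "computes
    (do {
       m \<leftarrow> real_sub 0 (d i j);
       q \<leftarrow> for_all (\<lambda>k. real_eq (\<Phi> (i, j, k)) m) ks;
       if q then State_Monad.return SecondLeafOfFirst
       else do {
         c \<leftarrow> for_all (\<lambda>k. real_eq (\<Phi> (i, j, k)) (\<Phi> (i, j, hd ks))) ks;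
         State_Monad.return (if c then LeafSiblings else Neither)
       }
     })
    (if \<forall>k\<in>set ks. \<Phi> (i, j, k) = - d i j then SecondLeafOfFirst
     else if \<forall>k\<in>set ks. \<Phi> (i, j, k) = \<Phi> (i, j, hd ks) then LeafSiblings else Neither)
    (1 + (length ks + (length ks + 0)))"
    by (rule computes_bind[OF sub computes_bind[OF all]])
      (use 3 computes_mono[OF computes_return] in \<open>auto split: if_splits\<close>)
  have 1: "computes (test_node_relationships d \<Phi> Y i j) (verdict_of d \<Phi> Y i j)
      (length ks + (1 + (length ks + (length ks + 0))))"
    unfolding test_node_relationships_def verdict_of_def Let_def ks_def[symmetric]
    by (rule computes_bind[OF all]) (use 2 computes_mono[OF computes_return] in \<open>auto split: if_splits\<close>)
  have "length ks \<le> length Y" by (simp add: ks_def)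
  then show ?thesis by (intro computes_mono[OF 1]) simp
qed

abbreviation child_keys :: "('v node \<times> 'v node list) list \<Rightarrow> ('v node \<times> 'v node \<times> 'v node) list" where
  "child_keys C \<equiv> [(h, i, j). (h, B) \<leftarrow> C, i \<leftarrow> B, j \<leftarrow> B, i \<noteq> j]"

abbreviation other_keys ::
  "'v node list \<Rightarrow> ('v node \<times> 'v node list) list \<Rightarrow> ('v node \<times> 'v node list \<times> 'v node) list" where
  "other_keys Y' C \<equiv> [(h, B, l). (h, B) \<leftarrow> C, l \<leftarrow> Y', l \<noteq> h]"

definition child_step ::
  "('v node list \<Rightarrow> 'v node) \<Rightarrow> ('v node \<times> 'v node \<times> 'v node \<Rightarrow> real) \<Rightarrow> 'v node list \<Rightarrow>
   'v node \<times> 'v node \<times> 'v node \<Rightarrow> 'v dist_table \<Rightarrow> 'v dist_table" where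
  "child_step pick \<Phi> Y = (\<lambda>(h, i, j) d.
     set_dist i h ((d i j + \<Phi> (i, j, pick (filter (\<lambda>k. k \<noteq> i \<and> k \<noteq> j) Y))) / 2) d)"

definition other_step ::
  "('v node list \<Rightarrow> 'v node) \<Rightarrow> 'v node list \<Rightarrow> ('v node \<times> 'v node list) list \<Rightarrow>
   'v node \<times> 'v node list \<times> 'v node \<Rightarrow> 'v dist_table \<Rightarrow> 'v dist_table" where
  "other_step pick Y C = (\<lambda>(h, B, l) d.
     let i = pick B in
     if l \<in> set Y then set_dist h l (d i l - d i h) d
     else let k = pick (the (map_of C l)) in set_dist h l (d i k - d i h - d l k) d)"

lemma computes_child_distances:
  "computes (child_distances pick \<Phi> Y C d) (fold (child_step pick \<Phi> Y) (child_keys C) d)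
     (2 * length (child_keys C))"
  unfolding child_distances_def
proof (rule computes_iterate, goal_cases)
  case (1 k x)
  obtain h i j where k: "k = (h, i, j)" by (cases k)
  have "computes (do {
        s \<leftarrow> real_add (x i j) a; y \<leftarrow> real_div s 2; State_Monad.return (set_dist i h y x)
      }) (set_dist i h ((x i j + a) / 2) x) (1 + (1 + 0))" for a
    unfolding real_add_def real_div_def by (intro computes_bind[OF computes_tick] computes_return)
  then show ?case unfolding k child_step_def Let_def prod.case by (rule computes_mono) simp
qed

lemma computes_other_distances:
  "computes (other_distances pick Y Y' C d) (fold (other_step pick Y C) (other_keys Y' C) d)
     (2 * length (other_keys Y' C))"
  unfolding other_distances_def
proof (rule computes_iterate, goal_cases)
  case (1 k x)
  obtain h B l where k: "k = (h, B, l)" by (cases k)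
  have 1: "computes (do { y \<leftarrow> real_sub a b; State_Monad.return (set_dist h l y x) })
      (set_dist h l (a - b) x) (1 + 0)" for a b
    unfolding real_sub_def by (intro computes_bind[OF computes_tick] computes_return)
  have 2: "computes (do { y \<leftarrow> real_sub a b; z \<leftarrow> real_sub y c; State_Monad.return (set_dist h l z x) })
      (set_dist h l (a - b - c) x) (1 + (1 + 0))" for a b c
    unfolding real_sub_def by (intro computes_bind[OF computes_tick] computes_return)
  show ?case
    unfolding k other_step_def Let_def prod.case
    by (auto intro!: computes_mono[OF 1] computes_mono[OF 2])
qed

lemma length_concat_map_le: "(\<And>x. x \<in> set xs \<Longrightarrow> length (f x) \<le> b) \<Longrightarrow> length (concat (map f xs)) \<le> length xs * b"
  by (induction xs) (auto intro: add_mono)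

lemma length_child_keys:
  assumes "\<And>h B. (h, B) \<in> set C \<Longrightarrow> length B \<le> n"
  shows "length (child_keys C) \<le> length C * (n * n)"
proof (rule length_concat_map_le)
  fix x assume x: "x \<in> set C"
  obtain h B where hB: "x = (h, B)" by (cases x)
  have B: "length B \<le> n" using assms x hB by auto
  have "length (concat (map (\<lambda>i. concat (map (\<lambda>j. if i \<noteq> j then [(h, i, j)] else []) B)) B)) \<le>
      length B * (length B * 1)"
    by (intro length_concat_map_le) auto
  also have "\<dots> \<le> n * n" using B by (simp add: mult_le_mono)
  finally show "length (case x of (h, B) \<Rightarrow> concat (map (\<lambda>i. concat (map (\<lambda>j. if i \<noteq> j then [(h, i, j)] else []) B)) B)) \<le> n * n"
    by (simp add: hB)
qed

lemma length_other_keys: "length (other_keys Y' C) \<le> length C * length Y'"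
proof (rule length_concat_map_le)
  fix x assume "x \<in> set C"
  obtain h B where hB: "x = (h, B)" by (cases x)
  have "length (concat (map (\<lambda>l. if l \<noteq> h then [(h, B, l)] else []) Y')) \<le> length Y' * 1"
    by (intro length_concat_map_le) auto
  then show "length (case x of (h, B) \<Rightarrow> concat (map (\<lambda>l. if l \<noteq> h then [(h, B, l)] else []) Y')) \<le> length Y'"
    by (simp add: hB)
qed

text \<open>The tables are obtained rather than named, because only their entries at listed keys are
  specified.\<close>

lemma computes_rg_round:
  obtains \<Phi> \<tau> where
    "\<And>i j k. i \<in> set (active s) \<Longrightarrow> j \<in> set (active s) \<Longrightarrow> k \<in> set (active s) \<Longrightarrow>
      \<Phi> (i, j, k) = distances s i k - distances s j k"
    "\<And>i j. i \<in> set (active s) \<Longrightarrow> j \<in> set (active s) \<Longrightarrow> i \<noteq> j \<Longrightarrow>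
      \<tau> (i, j) = verdict_of (distances s) \<Phi> (active s) i j"
    "\<And>Y' F C n. fold (group_block \<tau>) (partition_blocks (\<lambda>i j. \<tau> (i, j) \<noteq> Neither) (active s))
        ([], edges s, [], next_hidden s) = (Y', F, C, n) \<Longrightarrow>
      computes (rg_round pick s)
        \<lparr>active = Y',
         distances = fold (other_step pick (active s) C) (other_keys Y' C)
           (fold (child_step pick \<Phi> (active s)) (child_keys C) (distances s)),
         edges = F, next_hidden = n\<rparr>
        (length (active s) ^ 3 + (3 * length (active s) + 1) * (length (active s))\<^sup>2 +
         2 * length (child_keys C) + 2 * length (other_keys Y' C))"
proof -
  let ?Y = "active s" and ?d = "distances s"
  define k3 where "k3 = [(i, j, k). i \<leftarrow> ?Y, j \<leftarrow> ?Y, k \<leftarrow> ?Y]"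
  define k2 where "k2 = [(i, j). i \<leftarrow> ?Y, j \<leftarrow> ?Y, i \<noteq> j]"
  have l3: "length k3 \<le> length ?Y ^ 3"
  proof -
    have "length k3 \<le> length ?Y * (length ?Y * (length ?Y * 1))"
      unfolding k3_def by (intro length_concat_map_le) auto
    then show ?thesis by (simp add: power3_eq_cube mult.assoc)
  qed
  have l2: "length k2 \<le> (length ?Y)\<^sup>2"
  proof -
    have "length k2 \<le> length ?Y * (length ?Y * 1)"
      unfolding k2_def by (intro length_concat_map_le) auto
    then show ?thesis by (simp add: power2_eq_square)
  qed
  have c3: "computes (case x of (i, j, k) \<Rightarrow> real_sub (?d i k) (?d j k)) (case x of (i, j, k) \<Rightarrow> ?d i k - ?d j k) 1"
    for x by (cases x) (simp only: real_sub_def computes_tick prod.case)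
  obtain \<Phi> where \<Phi>: "computes (tabulate (\<lambda>(i, j, k). real_sub (?d i k) (?d j k)) k3) \<Phi> (1 * length k3)"
    "\<And>x. x \<in> set k3 \<Longrightarrow> \<Phi> x = (case x of (i, j, k) \<Rightarrow> ?d i k - ?d j k)"
    by (rule computes_tabulate[of k3 "\<lambda>(i, j, k). real_sub (?d i k) (?d j k)", OF c3]) blast
  have c2: "computes (case x of (i, j) \<Rightarrow> test_node_relationships ?d \<Phi> ?Y i j)
      (case x of (i, j) \<Rightarrow> verdict_of ?d \<Phi> ?Y i j) (3 * length ?Y + 1)" for x
    by (cases x) (simp only: computes_test_node_relationships prod.case)
  obtain \<tau> where \<tau>: "computes (tabulate (\<lambda>(i, j). test_node_relationships ?d \<Phi> ?Y i j) k2) \<tau>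
      ((3 * length ?Y + 1) * length k2)"
    "\<And>x. x \<in> set k2 \<Longrightarrow> \<tau> x = (case x of (i, j) \<Rightarrow> verdict_of ?d \<Phi> ?Y i j)"
    by (rule computes_tabulate[of k2 "\<lambda>(i, j). test_node_relationships ?d \<Phi> ?Y i j", OF c2]) blast
  show ?thesis
  proof (rule that[of \<Phi> \<tau>])
    show "\<Phi> (i, j, k) = ?d i k - ?d j k" if "i \<in> set ?Y" "j \<in> set ?Y" "k \<in> set ?Y" for i j k
      using \<Phi>(2)[of "(i, j, k)"] that by (auto simp: k3_def)
    show "\<tau> (i, j) = verdict_of ?d \<Phi> ?Y i j" if "i \<in> set ?Y" "j \<in> set ?Y" "i \<noteq> j" for i j
      using \<tau>(2)[of "(i, j)"] that by (auto simp: k2_def)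
    fix Y' F C n
    assume f: "fold (group_block \<tau>) (partition_blocks (\<lambda>i j. \<tau> (i, j) \<noteq> Neither) ?Y)
        ([], edges s, [], next_hidden s) = (Y', F, C, n)"
    have "computes (rg_round pick s)
        \<lparr>active = Y',
         distances = fold (other_step pick ?Y C) (other_keys Y' C)
           (fold (child_step pick \<Phi> ?Y) (child_keys C) ?d),
         edges = F, next_hidden = n\<rparr>
        (1 * length k3 + ((3 * length ?Y + 1) * length k2 +
          (2 * length (child_keys C) + (2 * length (other_keys Y' C) + 0))))"
      unfolding rg_round_def Let_def k3_def[symmetric] k2_def[symmetric]
      by (intro computes_bind[OF \<Phi>(1)] computes_bind[OF \<tau>(1)])
        (simp only: f prod.case, intro computes_bind[OF computes_child_distances]
          computes_bind[OF computes_other_distances] computes_return)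
    moreover have "(3 * length ?Y + 1) * length k2 \<le> (3 * length ?Y + 1) * (length ?Y)\<^sup>2"
      using l2 by (rule mult_le_mono2)
    ultimately show "computes (rg_round pick s)
        \<lparr>active = Y',
         distances = fold (other_step pick ?Y C) (other_keys Y' C)
           (fold (child_step pick \<Phi> ?Y) (child_keys C) ?d),
         edges = F, next_hidden = n\<rparr>
        (length ?Y ^ 3 + (3 * length ?Y + 1) * (length ?Y)\<^sup>2 +
         2 * length (child_keys C) + 2 * length (other_keys Y' C))"
      using l3 by (elim computes_mono) linarith
  qed
qed

section \<open>Grouping\<close>

text \<open>An arbitrary relation need not have a coarsest such partition. If it is the kernel of a
  function off the diagonal, the classes are admissible and every admissible partition refines them;
  antisymmetry of refinement makes the description definite.\<close>

lemma coarsest_leaf_partition_kernel: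
  assumes R: "\<And>i j. i \<in> A \<Longrightarrow> j \<in> A \<Longrightarrow> i \<noteq> j \<Longrightarrow> R i j \<longleftrightarrow> \<rho> i = \<rho> j"
  shows "coarsest_leaf_partition R A = (\<lambda>i. {j \<in> A. \<rho> j = \<rho> i}) ` A"
proof -
  let ?P = "(\<lambda>i. {j \<in> A. \<rho> j = \<rho> i}) ` A"
  have P: "leaf_partition R A ?P"
    unfolding leaf_partition_def
  proof
    show "partition_on A ?P" by (rule partition_onI) (auto simp: disjnt_def)
    show "\<forall>B\<in>?P. \<forall>i\<in>B. \<forall>j\<in>B. i \<noteq> j \<longrightarrow> R i j" using R by auto
  qed
  have max: "refines A Q ?P" if Q: "leaf_partition R A Q" for Q
    unfolding refines_def
  proof (intro conjI ballI)
    show "partition_on A Q" "partition_on A ?P" using P Q by (auto simp: leaf_partition_def)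
    fix B assume B: "B \<in> Q"
    then have BA: "B \<subseteq> A" "B \<noteq> {}" using Q by (auto simp: leaf_partition_def partition_on_def)
    then obtain i where i: "i \<in> B" by blast
    have "B \<subseteq> {j \<in> A. \<rho> j = \<rho> i}"
    proof
      fix j assume j: "j \<in> B"
      show "j \<in> {j \<in> A. \<rho> j = \<rho> i}"
      proof (cases "j = i")
        case False
        then have "R j i" using Q B i j by (auto simp: leaf_partition_def)
        then show ?thesis using R[of j i] False i j BA by auto
      qed (use i BA in auto)
    qed
    then show "\<exists>Y\<in>?P. B \<subseteq> Y" using i BA by blast
  qed
  show ?thesis
    unfolding coarsest_leaf_partition_def
  proof (rule the_equality)
    show "leaf_partition R A ?P \<and> (\<forall>Q. leaf_partition R A Q \<longrightarrow> refines A Q ?P)" using P max by blast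
    show "Q = ?P" if "leaf_partition R A Q \<and> (\<forall>Q'. leaf_partition R A Q' \<longrightarrow> refines A Q' Q)" for Q
      using that P max refines_asym by blast
  qed
qed

lemma partition_blocks_kernel:
  assumes "\<And>i j. i \<in> set Y \<Longrightarrow> j \<in> set Y \<Longrightarrow> i \<noteq> j \<Longrightarrow> R i j \<longleftrightarrow> \<rho> i = \<rho> j"
  shows "partition_blocks R Y = remdups (map (\<lambda>i. filter (\<lambda>j. \<rho> j = \<rho> i) Y) Y)"
proof -
  have c: "coarsest_leaf_partition R (set Y) = (\<lambda>i. {j \<in> set Y. \<rho> j = \<rho> i}) ` set Y"
    by (rule coarsest_leaf_partition_kernel[OF assms])
  have "map (\<lambda>i. filter (\<lambda>j. \<exists>B\<in>(\<lambda>i. {j \<in> set Y. \<rho> j = \<rho> i}) ` set Y. i \<in> B \<and> j \<in> B) Y) Y =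
      map (\<lambda>i. filter (\<lambda>j. \<rho> j = \<rho> i) Y) Y"
    by (intro map_cong filter_cong refl) auto
  then show ?thesis unfolding partition_blocks_def Let_def c by (simp only:)
qed

context
  fixes \<tau> :: "'v node \<times> 'v node \<Rightarrow> verdict" and F0 :: "'v node set set" and n0 :: nat
begin

definition parents :: "'v node list \<Rightarrow> 'v node list" where
  "parents B = filter (\<lambda>u. \<exists>i\<in>set B. declared_parent \<tau> u i) B"

text \<open>The accumulator after the blocks \<open>Bs\<close>, described mostly without reference
  to their order. Entries are put in front of \<open>C\<close>, so the consecutive new names appear
  in reverse.\<close>

definition grouped ::
  "'v node list list \<Rightarrow> 'v node list \<times> 'v node set set \<times> ('v node \<times> 'v node list) list \<times> nat \<Rightarrow> bool" where
  "grouped Bs = (\<lambda>(Y', F, C, n).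
     n0 \<le> n \<and> map fst C = map Hidden (rev [n0..<n]) \<and> distinct Y' \<and>
     length Y' \<le> length Bs \<and> length C \<le> length Bs \<and>
     snd ` set C = {B \<in> set Bs. 2 \<le> length B \<and> parents B = []} \<and> distinct (map snd C) \<and>
     set Y' = (\<Union>B\<in>{B \<in> set Bs. length B < 2}. set B) \<union> (\<Union>B\<in>{B \<in> set Bs. 2 \<le> length B}. set (parents B)) \<union>
       fst ` set C \<and>
     F = F0 \<union> (\<Union>B\<in>{B \<in> set Bs. 2 \<le> length B}. \<Union>u\<in>set (parents B). (\<lambda>v. {u, v}) ` (set B - {u})) \<union>
       (\<Union>(h, B)\<in>set C. (\<lambda>v. {h, v}) ` set B))"

text \<open>Induction from the end of the list, because \<open>fold\<close> treats the last block
  last. Disjoint blocks and fresh hidden names keep the new active list distinct.\<close>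

lemma grouped_fold:
  assumes "distinct Bs"
    and disj: "\<And>B B'. B \<in> set Bs \<Longrightarrow> B' \<in> set Bs \<Longrightarrow> B \<noteq> B' \<Longrightarrow> set B \<inter> set B' = {}"
    and dist: "\<And>B. B \<in> set Bs \<Longrightarrow> distinct B"
    and one: "\<And>B. B \<in> set Bs \<Longrightarrow> 2 \<le> length B \<Longrightarrow> length (parents B) \<le> 1"
    and fresh: "\<And>B k. B \<in> set Bs \<Longrightarrow> Hidden k \<in> set B \<Longrightarrow> k < n0"
  shows "grouped Bs (fold (group_block \<tau>) Bs ([], F0, [], n0))"
  using assms
proof (induction Bs rule: rev_induct)
  case Nil
  then show ?case by (simp add: grouped_def)
next
  case (snoc B Bs)
  have IH: "grouped Bs (fold (group_block \<tau>) Bs ([], F0, [], n0))"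
  proof (rule snoc.IH)
    show "distinct Bs" using snoc.prems(1) by simp
    show "set B \<inter> set B' = {}" if "B \<in> set Bs" "B' \<in> set Bs" "B \<noteq> B'" for B B'
      using snoc.prems(2)[of B B'] that by simp
    show "distinct B" if "B \<in> set Bs" for B using snoc.prems(3)[of B] that by simp
    show "length (parents B) \<le> 1" if "B \<in> set Bs" "2 \<le> length B" for B
      using snoc.prems(4)[of B] that by simp
    show "k < n0" if "B \<in> set Bs" "Hidden k \<in> set B" for B k
      using snoc.prems(5)[of B k] that by simp
  qed
  obtain Y' F C n where acc: "fold (group_block \<tau>) Bs ([], F0, [], n0) = (Y', F, C, n)"
    by (rule prod_cases4)
  note g = IH[unfolded acc grouped_def prod.case]
  have B: "B \<notin> set Bs" "distinct B" "\<And>B'. B' \<in> set Bs \<Longrightarrow> set B \<inter> set B' = {}"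
    using snoc.prems(1) snoc.prems(3)[of B] snoc.prems(2)[of B] by auto
  have sub: "set Y' \<subseteq> (\<Union>B\<in>set Bs. set B) \<union> fst ` set C" using g by (auto simp: parents_def)
  have keys: "fst ` set C = Hidden ` {n0..<n}" using g by (metis list.set_map set_rev set_upt)
  have BY: "set B \<inter> set Y' = {}"
  proof (rule disjoint_iff[THEN iffD2], intro allI impI notI)
    fix x assume x: "x \<in> set B" "x \<in> set Y'"
    then consider B' where "B' \<in> set Bs" "x \<in> set B'" | k where "x = Hidden k" "n0 \<le> k"
      using sub keys by auto
    then show False
    proof cases
      case (1 B')
      then show False using B(3)[of B'] x(1) by blast
    next
      case (2 k)
      then show False using snoc.prems(5)[of B k] x(1) by simp
    qed
  qed
  consider "length B < 2" | u where "2 \<le> length B" "parents B = [u]" | "2 \<le> length B" "parents B = []"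
    using snoc.prems(4)[of B] by (cases "length B < 2"; cases "parents B") auto
  then have "grouped (Bs @ [B]) (group_block \<tau> B (Y', F, C, n))"
  proof cases
    case 1
    then have e: "group_block \<tau> B (Y', F, C, n) = (B @ Y', F, C, n)" by (simp add: group_block_def)
    have "{B' \<in> set (Bs @ [B]). length B' < 2} = insert B {B' \<in> set Bs. length B' < 2}"
      "{B' \<in> set (Bs @ [B]). 2 \<le> length B'} = {B' \<in> set Bs. 2 \<le> length B'}"
      "{B' \<in> set (Bs @ [B]). 2 \<le> length B' \<and> parents B' = []} = {B' \<in> set Bs. 2 \<le> length B' \<and> parents B' = []}"
      using 1 by auto
    note s = this
    show ?thesis unfolding e grouped_def prod.case s using g B(2) BY 1 by (simp add: Un_ac)
  next
    case (2 u)
    then have e: "group_block \<tau> B (Y', F, C, n) = (u # Y', F \<union> (\<lambda>v. {u, v}) ` (set B - {u}), C, n)"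
      by (simp add: group_block_def parents_def)
    have "u \<in> set B" using 2 by (metis filter_is_subset list.set_intros(1) parents_def subsetD)
    then have uY: "u \<notin> set Y'" using BY by auto
    have "{B' \<in> set (Bs @ [B]). length B' < 2} = {B' \<in> set Bs. length B' < 2}"
      "{B' \<in> set (Bs @ [B]). 2 \<le> length B'} = insert B {B' \<in> set Bs. 2 \<le> length B'}"
      "{B' \<in> set (Bs @ [B]). 2 \<le> length B' \<and> parents B' = []} = {B' \<in> set Bs. 2 \<le> length B' \<and> parents B' = []}"
      using 2 by auto
    note s = this
    show ?thesis unfolding e grouped_def prod.case s using g 2(2) uY by (simp add: Un_ac)
  next
    case 3
    then have e: "group_block \<tau> B (Y', F, C, n) =
        (Hidden n # Y', F \<union> (\<lambda>v. {Hidden n, v}) ` set B, (Hidden n, B) # C, Suc n)"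
      by (simp add: group_block_def parents_def)
    have nY: "Hidden n \<notin> set Y'"
    proof
      assume "Hidden n \<in> set Y'"
      then consider B' where "B' \<in> set Bs" "Hidden n \<in> set B'" | "Hidden n \<in> Hidden ` {n0..<n}"
        using sub keys by auto
      then show False
      proof cases
        case (1 B')
        then show False using snoc.prems(5)[of B' n] g by simp
      qed auto
    qed
    have BC: "B \<notin> snd ` set C" using g B(1) by auto
    have k: "map fst ((Hidden n, B) # C) = map Hidden (rev [n0..<Suc n])" using g by simp
    have "{B' \<in> set (Bs @ [B]). length B' < 2} = {B' \<in> set Bs. length B' < 2}"
      "{B' \<in> set (Bs @ [B]). 2 \<le> length B'} = insert B {B' \<in> set Bs. 2 \<le> length B'}"
      "{B' \<in> set (Bs @ [B]). 2 \<le> length B' \<and> parents B' = []} =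
        insert B {B' \<in> set Bs. 2 \<le> length B' \<and> parents B' = []}"
      using 3 by auto
    note s = this
    show ?thesis unfolding e grouped_def prod.case s using g nY BC k 3(2) by (simp add: Un_ac)
  qed
  then show ?case by (simp add: acc)
qed

end

definition correct_pairs :: "('n \<Rightarrow> 'n \<Rightarrow> real) \<Rightarrow> ('n \<Rightarrow> 'n \<Rightarrow> real) \<Rightarrow> ('n \<times> 'n) set" where
  "correct_pairs T d = {(a, b). d a b = T a b}"

text \<open>Every write stores the true value, so it cannot spoil an entry, and overlapping writes
  are harmless. Since each step relies only on the entries in \<open>S\<close>, the order of the
  writes does not matter.\<close>

lemma correct_pairs_fold_set_dist:
  assumes sym: "\<And>a b. T a b = T b a"
    and base: "S \<subseteq> correct_pairs T d"
    and step: "\<And>k d. k \<in> set ks \<Longrightarrow> S \<subseteq> correct_pairs T d \<Longrightarrow>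
      f k d = set_dist (\<alpha> k) (\<beta> k) (T (\<alpha> k) (\<beta> k)) d"
  shows "S \<union> (\<Union>k\<in>set ks. {(\<alpha> k, \<beta> k), (\<beta> k, \<alpha> k)}) \<subseteq> correct_pairs T (fold f ks d)"
  using step
proof (induction ks rule: rev_induct)
  case Nil
  then show ?case using base by simp
next
  case (snoc k ks)
  let ?d = "fold f ks d"
  have IH: "S \<union> (\<Union>k\<in>set ks. {(\<alpha> k, \<beta> k), (\<beta> k, \<alpha> k)}) \<subseteq> correct_pairs T ?d"
    using snoc by auto
  then have "f k ?d = set_dist (\<alpha> k) (\<beta> k) (T (\<alpha> k) (\<beta> k)) ?d" using snoc.prems by auto
  moreover have "correct_pairs T ?d \<union> {(\<alpha> k, \<beta> k), (\<beta> k, \<alpha> k)} \<subseteq>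
      correct_pairs T (set_dist (\<alpha> k) (\<beta> k) (T (\<alpha> k) (\<beta> k)) ?d)"
    using sym by (auto simp: correct_pairs_def set_dist_def)
  ultimately show ?case using IH by auto
qed

section \<open>One round of recursive grouping\<close>

locale recovery = metric_tree "V \<union> H" E d for V H :: "'a set" and E and d :: "'a \<Rightarrow> 'a \<Rightarrow> real" +
  assumes disjoint: "V \<inter> H = {}"
    and hidden_degree: "\<And>h. h \<in> H \<Longrightarrow> 3 \<le> card (neighbors E h)"
begin

definition names :: "nat \<Rightarrow> 'a node set" where
  "names n = Observed ` V \<union> Hidden ` {..<n}"

text \<open>
  \<open>\<phi>\<close> maps the nodes of the algorithm to the vertices of the tree, and \<open>U\<close> spans the part of the
  tree whose edges have not been found.
\<close>

definition invariant :: "'a rg_state \<Rightarrow> ('a node \<Rightarrow> 'a) \<Rightarrow> 'a set \<Rightarrow> bool" where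
  "invariant s \<phi> U \<longleftrightarrow>
     inj_on \<phi> (names (next_hidden s)) \<and> (\<forall>v\<in>V. \<phi> (Observed v) = v) \<and>
     \<phi> ` names (next_hidden s) \<subseteq> V \<union> H \<and>
     distinct (active s) \<and> set (active s) \<subseteq> names (next_hidden s) \<and>
     length (active s) \<le> card V \<and>
     active_subtree (V \<union> H) E d U (\<phi> ` set (active s)) \<and>
     (V \<union> H) - U \<subseteq> \<phi> ` names (next_hidden s) \<and>
     U \<inter> \<phi> ` names (next_hidden s) \<subseteq> \<phi> ` set (active s) \<and>
     \<Union> (edges s) \<subseteq> names (next_hidden s) \<and>
     (`) \<phi> ` edges s = {e \<in> E. \<not> e \<subseteq> U} \<and>
     (\<forall>a\<in>set (active s). \<forall>b\<in>set (active s). a \<noteq> b \<longrightarrow> distances s a b = d (\<phi> a) (\<phi> b))"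

end

locale active_round = recovery +
  fixes s :: "'a rg_state" and \<phi> :: "'a node \<Rightarrow> 'a" and U :: "'a set"
    and \<Phi> :: "'a node \<times> 'a node \<times> 'a node \<Rightarrow> real" and \<tau> :: "'a node \<times> 'a node \<Rightarrow> verdict"
  assumes inv: "invariant s \<phi> U"
    and three_active: "3 \<le> length (active s)"
    and \<Phi>: "\<And>i j k. i \<in> set (active s) \<Longrightarrow> j \<in> set (active s) \<Longrightarrow> k \<in> set (active s) \<Longrightarrow>
      \<Phi> (i, j, k) = distances s i k - distances s j k"
    and \<tau>: "\<And>i j. i \<in> set (active s) \<Longrightarrow> j \<in> set (active s) \<Longrightarrow> i \<noteq> j \<Longrightarrow>
      \<tau> (i, j) = verdict_of (distances s) \<Phi> (active s) i j"
begin

abbreviation Y :: "'a node list" where "Y \<equiv> active s"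
abbreviation D :: "'a dist_table" where "D \<equiv> distances s"

lemma inj: "inj_on \<phi> (names (next_hidden s))"
  and obs: "\<forall>v\<in>V. \<phi> (Observed v) = v"
  and img: "\<phi> ` names (next_hidden s) \<subseteq> V \<union> H"
  and distinct_Y: "distinct Y" and Y_names: "set Y \<subseteq> names (next_hidden s)"
  and length_Y: "length Y \<le> card V"
  and act: "active_subtree (V \<union> H) E d U (\<phi> ` set Y)"
  and outside: "(V \<union> H) - U \<subseteq> \<phi> ` names (next_hidden s)"
  and inside: "U \<inter> \<phi> ` names (next_hidden s) \<subseteq> \<phi> ` set Y"
  and edge_names: "\<Union> (edges s) \<subseteq> names (next_hidden s)"
  and edges_found: "(`) \<phi> ` edges s = {e \<in> E. \<not> e \<subseteq> U}"
  and D_ball: "\<forall>a\<in>set Y. \<forall>b\<in>set Y. a \<noteq> b \<longrightarrow> D a b = d (\<phi> a) (\<phi> b)"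
  using inv unfolding invariant_def by - (elim conjE, assumption)+

lemma D: "a \<in> set Y \<Longrightarrow> b \<in> set Y \<Longrightarrow> a \<noteq> b \<Longrightarrow> D a b = d (\<phi> a) (\<phi> b)"
  using D_ball by blast

lemma inj_Y: "inj_on \<phi> (set Y)"
  using inj Y_names inj_on_subset by blast

lemma \<phi>_eq: "a \<in> set Y \<Longrightarrow> b \<in> set Y \<Longrightarrow> \<phi> a = \<phi> b \<longleftrightarrow> a = b"
  using inj_Y by (auto simp: inj_on_def)

end

sublocale active_round \<subseteq> A: active_subtree3 "V \<union> H" E d U "\<phi> ` set (active s)"
proof -
  interpret active_subtree "V \<union> H" E d U "\<phi> ` set (active s)" by (rule act)
  show "active_subtree3 (V \<union> H) E d U (\<phi> ` set (active s))"
    by unfold_locales (use three_active inj_Y distinct_Y in \<open>simp add: card_image distinct_card\<close>)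
qed

section \<open>Verdicts and blocks\<close>

context active_round
begin

abbreviation rt :: "'a node \<Rightarrow> 'a" where "rt a \<equiv> A.root (\<phi> a)"

lemma ball_others:
  assumes "i \<in> set Y" "j \<in> set Y"
  shows "(\<forall>k\<in>set (filter (\<lambda>k. k \<noteq> i \<and> k \<noteq> j) Y). P (\<phi> k)) \<longleftrightarrow> (\<forall>k\<in>\<phi> ` set Y - {\<phi> i, \<phi> j}. P k)"
  using assms \<phi>_eq by auto

lemma others_nonempty: "filter (\<lambda>k. k \<noteq> i \<and> k \<noteq> j) Y \<noteq> []"
proof
  assume "filter (\<lambda>k. k \<noteq> i \<and> k \<noteq> j) Y = []"
  then have "set Y \<subseteq> {i, j}" by (auto simp: filter_empty_conv)
  then have "card (set Y) \<le> card {i, j}" by (intro card_mono) auto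
  also have "\<dots> \<le> 2" by (simp add: card_insert_le_m1)
  finally show False using three_active distinct_Y by (simp add: distinct_card)
qed

lemma verdict:
  assumes ij: "i \<in> set Y" "j \<in> set Y" "i \<noteq> j"
  shows "\<tau> (i, j) = FirstLeafOfSecond \<longleftrightarrow> leaf U (\<phi> i) (\<phi> j)"
    "\<tau> (i, j) = SecondLeafOfFirst \<longleftrightarrow> \<not> leaf U (\<phi> i) (\<phi> j) \<and> leaf U (\<phi> j) (\<phi> i)"
    "\<tau> (i, j) \<noteq> Neither \<longleftrightarrow> rt i = rt j"
proof -
  let ?ks = "filter (\<lambda>k. k \<noteq> i \<and> k \<noteq> j) Y"
  have P: "\<phi> i \<in> \<phi> ` set Y" "\<phi> j \<in> \<phi> ` set Y" "\<phi> i \<noteq> \<phi> j" using ij \<phi>_eq by auto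
  have val: "\<Phi> (i, j, k) = d (\<phi> i) (\<phi> k) - d (\<phi> j) (\<phi> k)" if "k \<in> set ?ks" for k
    using that ij \<Phi>[of i j k] D[of i k] D[of j k] by auto
  have all: "(\<forall>k\<in>set ?ks. \<Phi> (i, j, k) = a) \<longleftrightarrow>
      (\<forall>k\<in>\<phi> ` set Y - {\<phi> i, \<phi> j}. d (\<phi> i) k - d (\<phi> j) k = a)" for a
    using ball_others[OF ij(1,2), of "\<lambda>k. d (\<phi> i) k - d (\<phi> j) k = a"] val by auto
  have 1: "(\<forall>k\<in>set ?ks. \<Phi> (i, j, k) = D i j) \<longleftrightarrow> leaf U (\<phi> i) (\<phi> j)"
    unfolding all D[OF ij] by (rule A.first_test_iff[OF P])
  have 2: "(\<forall>k\<in>set ?ks. \<Phi> (i, j, k) = - D i j) \<longleftrightarrow> leaf U (\<phi> j) (\<phi> i)"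
    unfolding all D[OF ij] by (rule A.second_test_iff[OF P])
  have hd: "hd ?ks \<in> set ?ks" using others_nonempty by (rule hd_in_set)
  have "(\<forall>k\<in>set ?ks. \<Phi> (i, j, k) = \<Phi> (i, j, hd ?ks)) \<longleftrightarrow> (\<exists>c. \<forall>k\<in>set ?ks. \<Phi> (i, j, k) = c)"
  proof
    assume "\<exists>c. \<forall>k\<in>set ?ks. \<Phi> (i, j, k) = c"
    then obtain c where c: "\<forall>k\<in>set ?ks. \<Phi> (i, j, k) = c" ..
    have "\<Phi> (i, j, hd ?ks) = c" by (rule bspec[OF c hd])
    then show "\<forall>k\<in>set ?ks. \<Phi> (i, j, k) = \<Phi> (i, j, hd ?ks)" using c by (simp only:)
  qed (rule exI)
  then have 3: "(\<forall>k\<in>set ?ks. \<Phi> (i, j, k) = \<Phi> (i, j, hd ?ks)) \<longleftrightarrow> rt i = rt j"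
    unfolding all using A.constant_test_iff[OF P] by simp
  have r: "leaf U (\<phi> i) (\<phi> j) \<or> leaf U (\<phi> j) (\<phi> i) \<Longrightarrow> rt i = rt j"
    using A.root_eq_iff[OF P(3)] by blast
  have v: "\<tau> (i, j) = (if leaf U (\<phi> i) (\<phi> j) then FirstLeafOfSecond
      else if leaf U (\<phi> j) (\<phi> i) then SecondLeafOfFirst else if rt i = rt j then LeafSiblings else Neither)"
    unfolding \<tau>[OF ij] verdict_of_def Let_def 1 2 3 ..
  show "\<tau> (i, j) = FirstLeafOfSecond \<longleftrightarrow> leaf U (\<phi> i) (\<phi> j)"
    "\<tau> (i, j) = SecondLeafOfFirst \<longleftrightarrow> \<not> leaf U (\<phi> i) (\<phi> j) \<and> leaf U (\<phi> j) (\<phi> i)"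
    "\<tau> (i, j) \<noteq> Neither \<longleftrightarrow> rt i = rt j"
    using v r by auto
qed

text \<open>The first test could mask the second one only if both nodes were leaves at each other,
  which \<open>leaf_parent_not_leaf\<close> excludes.\<close>

lemma declared_parent_iff:
  assumes "u \<in> set Y" "i \<in> set Y"
  shows "declared_parent \<tau> u i \<longleftrightarrow> u \<noteq> i \<and> leaf U (\<phi> i) (\<phi> u)"
proof (cases "u = i")
  case False
  then show ?thesis using verdict[of i u] verdict[of u i] assms A.leaf_parent_not_leaf
    unfolding declared_parent_def by blast
qed (simp add: declared_parent_def)

definition block :: "'a node \<Rightarrow> 'a node list" where
  "block i = filter (\<lambda>j. rt j = rt i) Y"

definition blocks :: "'a node list list" where
  "blocks = remdups (map block Y)"

lemma partition_blocks: "partition_blocks (\<lambda>i j. \<tau> (i, j) \<noteq> Neither) Y = blocks"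
  unfolding blocks_def block_def[abs_def]
  by (rule partition_blocks_kernel) (rule verdict(3))

lemma mem_block: "j \<in> set (block i) \<longleftrightarrow> j \<in> set Y \<and> rt j = rt i"
  by (auto simp: block_def)

lemma set_blocks: "set blocks = block ` set Y"
  by (simp add: blocks_def)

lemma block_cong: "rt i = rt j \<Longrightarrow> block i = block j"
  by (simp add: block_def)

lemma block_in: "i \<in> set Y \<Longrightarrow> block i \<in> set blocks"
  by (simp add: set_blocks)

lemma block_of_member:
  assumes "B \<in> set blocks" "i \<in> set B"
  shows "i \<in> set Y \<and> B = block i"
proof -
  obtain j where "B = block j" using assms(1) unfolding set_blocks by blast
  then show ?thesis using assms(2) mem_block[of i j] block_cong[of i j] by simp
qed

lemma distinct_block: "distinct (block i)"
  by (simp add: block_def distinct_Y)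

lemma length_block_iff:
  assumes i: "i \<in> set Y"
  shows "2 \<le> length (block i) \<longleftrightarrow> A.shared (\<phi> i)"
proof -
  have ib: "i \<in> set (block i)" using i by (simp add: mem_block)
  have "length (block i) = card (set (block i))" using distinct_block by (simp add: distinct_card)
  also have "\<dots> = Suc (card (set (block i) - {i}))" using ib by (simp add: card_Suc_Diff1 del: card_Diff_insert)
  finally have "2 \<le> length (block i) \<longleftrightarrow> 0 < card (set (block i) - {i})" by linarith
  also have "\<dots> \<longleftrightarrow> set (block i) - {i} \<noteq> {}" by (simp add: card_gt_0_iff)
  also have "\<dots> \<longleftrightarrow> A.shared (\<phi> i)" using \<phi>_eq i by (auto simp: A.shared_def mem_block)
  finally show ?thesis .
qed

text \<open>If the root of a shared block is active, every other member is a leaf at it and is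
  declared so. If it is not, all members are siblings and the block has no declared parent.\<close>

lemma mem_parents:
  assumes i: "i \<in> set Y" and sh: "A.shared (\<phi> i)"
  shows "u \<in> set (parents \<tau> (block i)) \<longleftrightarrow> u \<in> set Y \<and> \<phi> u = rt i"
proof
  assume "u \<in> set (parents \<tau> (block i))"
  then obtain j where u: "u \<in> set Y" "rt u = rt i" and j: "j \<in> set Y" "rt j = rt i" "declared_parent \<tau> u j"
    by (auto simp: parents_def mem_block)
  then have "leaf U (\<phi> j) (\<phi> u)" using declared_parent_iff by blast
  then show "u \<in> set Y \<and> \<phi> u = rt i" using A.root_leaf j u by auto
next
  assume u: "u \<in> set Y \<and> \<phi> u = rt i"
  then have ru: "rt u = rt i" using A.root_idem by metis
  \<comment> \<open>A parent is declared only relative to another member. If \<open>i\<close> is the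
    root itself, that member comes from the block being shared.\<close>
  have "\<exists>j\<in>set Y. j \<noteq> u \<and> rt j = rt i"
  proof (cases "i = u")
    case True
    then show ?thesis using sh by (auto simp: A.shared_def)
  qed (use i in auto)
  then obtain j where j: "j \<in> set Y" "j \<noteq> u" "rt j = rt i" by blast
  then have "rt j \<noteq> \<phi> j" using u \<phi>_eq by metis
  then have "leaf U (\<phi> j) (\<phi> u)" using A.leaf_iff_root j u by metis
  then have "declared_parent \<tau> u j" using declared_parent_iff u j by blast
  then show "u \<in> set (parents \<tau> (block i))" using u ru j by (auto simp: parents_def mem_block)
qed

lemma fold_group_block:
  "grouped \<tau> (edges s) (next_hidden s) blocks
     (fold (group_block \<tau>) (partition_blocks (\<lambda>i j. \<tau> (i, j) \<noteq> Neither) Y) ([], edges s, [], next_hidden s))"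
  unfolding partition_blocks
proof (rule grouped_fold)
  show "distinct blocks" by (simp add: blocks_def)
  show "set B \<inter> set B' = {}" if "B \<in> set blocks" "B' \<in> set blocks" "B \<noteq> B'" for B B'
    using block_of_member that by blast
  show "distinct B" if "B \<in> set blocks" for B using that distinct_block by (auto simp: set_blocks)
  show "length (parents \<tau> B) \<le> 1" if B: "B \<in> set blocks" "2 \<le> length B" for B
  proof -
    obtain i where i: "i \<in> set Y" "B = block i" using B(1) by (auto simp: set_blocks)
    have sh: "A.shared (\<phi> i)" using length_block_iff[OF i(1)] B(2) i(2) by simp
    have "a = b" if "a \<in> set (parents \<tau> B)" "b \<in> set (parents \<tau> B)" for a b
      using that \<phi>_eq[of a b] by (simp add: i(2) mem_parents[OF i(1) sh])
    then have "card (set (parents \<tau> B)) \<le> 1" using card_le_Suc0_iff_eq[of "set (parents \<tau> B)"] by simp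
    moreover have "distinct (parents \<tau> B)" using distinct_block i(2) by (simp add: parents_def)
    ultimately show ?thesis by (simp add: distinct_card)
  qed
  show "k < next_hidden s" if "B \<in> set blocks" "Hidden k \<in> set B" for B k
    using block_of_member[OF that] Y_names by (auto simp: names_def)
qed

end

section \<open>The tree after one round\<close>

locale grouped_round = active_round +
  fixes pick :: "'a node list \<Rightarrow> 'a node"
    and Y' :: "'a node list" and F :: "'a node set set"
    and C :: "('a node \<times> 'a node list) list" and n :: nat
  assumes pick: "\<And>ks. ks \<noteq> [] \<Longrightarrow> pick ks \<in> set ks"
    and grp: "grouped \<tau> (edges s) (next_hidden s) blocks (Y', F, C, n)"
begin

abbreviation n0 :: nat where "n0 \<equiv> next_hidden s"

lemma n0_le: "n0 \<le> n" and keys: "map fst C = map Hidden (rev [n0..<n])"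
  and distinct_Y': "distinct Y'" and length_Y'_blocks: "length Y' \<le> length blocks"
  and length_C_blocks: "length C \<le> length blocks"
  and snd_C: "snd ` set C = {B \<in> set blocks. 2 \<le> length B \<and> parents \<tau> B = []}"
  and distinct_snd: "distinct (map snd C)"
  and set_Y': "set Y' = (\<Union>B\<in>{B \<in> set blocks. length B < 2}. set B) \<union>
     (\<Union>B\<in>{B \<in> set blocks. 2 \<le> length B}. set (parents \<tau> B)) \<union> fst ` set C"
  and F: "F = edges s \<union>
     (\<Union>B\<in>{B \<in> set blocks. 2 \<le> length B}. \<Union>u\<in>set (parents \<tau> B). (\<lambda>v. {u, v}) ` (set B - {u})) \<union>
     (\<Union>(h, B)\<in>set C. (\<lambda>v. {h, v}) ` set B)"
  using grp unfolding grouped_def by auto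

lemma length_blocks: "length blocks \<le> length Y"
  unfolding blocks_def using length_remdups_leq[of "map block Y"] by simp

lemma fst_C: "fst ` set C = Hidden ` {n0..<n}"
proof -
  have "fst ` set C = set (map fst C)" by simp
  then show ?thesis unfolding keys by simp
qed

lemma distinct_fst: "distinct (map fst C)"
  unfolding keys by (simp add: distinct_map inj_on_def)

lemma names_n: "names n = names n0 \<union> fst ` set C"
proof -
  have "{..<n} = {..<n0} \<union> {n0..<n}" using n0_le by auto
  then show ?thesis by (simp add: names_def fst_C image_Un Un_assoc)
qed

lemma fresh: "h \<in> fst ` set C \<Longrightarrow> h \<notin> names n0"
  by (auto simp: names_def fst_C)

text \<open>A new name stands for the common root of its children. All of them have the same root,
  so the head of the block represents it.\<close>

definition \<phi>' :: "'a node \<Rightarrow> 'a" where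
  "\<phi>' x = (case map_of C x of Some B \<Rightarrow> rt (hd B) | None \<Rightarrow> \<phi> x)"

lemma \<phi>'_old: "x \<in> names n0 \<Longrightarrow> \<phi>' x = \<phi> x"
proof -
  assume "x \<in> names n0"
  then have "map_of C x = None" using fresh unfolding map_of_eq_None_iff by blast
  then show ?thesis by (simp add: \<phi>'_def)
qed

lemma \<phi>'_Y: "x \<in> set Y \<Longrightarrow> \<phi>' x = \<phi> x"
  using \<phi>'_old Y_names by blast

lemma new_block:
  assumes hB: "(h, B) \<in> set C" and i: "i \<in> set B"
  shows "i \<in> set Y" "B = block i" "A.shared (\<phi> i)" "\<phi>' h = rt i" "rt i \<notin> \<phi> ` set Y" "map_of C h = Some B"
proof -
  have "B \<in> snd ` set C" using hB by force
  then have B: "B \<in> set blocks" "2 \<le> length B" "parents \<tau> B = []" by (auto simp: snd_C)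
  show iY: "i \<in> set Y" "B = block i" using block_of_member[OF B(1) i] by auto
  then show sh: "A.shared (\<phi> i)" using length_block_iff B(2) by blast
  show m: "map_of C h = Some B" using hB distinct_fst by (rule map_of_is_SomeI[rotated])
  have "hd B \<in> set B" using i by (cases B) auto
  then have "rt (hd B) = rt i" using mem_block iY(2) by blast
  then show "\<phi>' h = rt i" by (simp add: \<phi>'_def m)
  show "rt i \<notin> \<phi> ` set Y"
  proof
    assume "rt i \<in> \<phi> ` set Y"
    then obtain u where "u \<in> set Y" "\<phi> u = rt i" by (metis imageE)
    then have "u \<in> set (parents \<tau> B)" unfolding iY(2) using mem_parents[OF iY(1) sh] by blast
    then show False using B(3) by simp
  qed
qed

lemma C_block: "(h, B) \<in> set C \<Longrightarrow> B \<in> set blocks \<and> 2 \<le> length B \<and> distinct B"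
  using snd_C distinct_block by (force simp: set_blocks)

lemma C_nonempty: "(h, B) \<in> set C \<Longrightarrow> B \<noteq> []"
  using C_block by fastforce

text \<open>A block without declared parent has an inactive root. By the invariant, a vertex of
  \<open>U\<close> that has a name is active; so the new name denotes a vertex that had
  none.\<close>

lemma \<phi>'_new:
  assumes "h \<in> fst ` set C"
  shows "\<phi>' h \<in> U - \<phi> ` names n0"
proof -
  obtain B where hB: "(h, B) \<in> set C" using assms by auto
  obtain i where i: "i \<in> set B" using C_nonempty[OF hB] by (cases B) auto
  note nb = new_block[OF hB i]
  have "rt i \<in> U" using A.root_in A.YU nb(1) by blast
  then show ?thesis using nb inside by auto
qed

lemma inj_\<phi>': "inj_on \<phi>' (names n)"
  unfolding names_n
proof (rule inj_onI)
  fix x y assume x: "x \<in> names n0 \<union> fst ` set C" and y: "y \<in> names n0 \<union> fst ` set C" and eq: "\<phi>' x = \<phi>' y"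
  show "x = y"
  proof (cases "x \<in> names n0"; cases "y \<in> names n0")
    assume "x \<in> names n0" "y \<in> names n0"
    then show ?thesis using eq inj \<phi>'_old by (auto simp: inj_on_def)
  next
    assume "x \<in> names n0" "y \<notin> names n0"
    then show ?thesis using eq \<phi>'_old[of x] \<phi>'_new[of y] y by (metis DiffD2 UnE image_eqI)
  next
    assume "x \<notin> names n0" "y \<in> names n0"
    then show ?thesis using eq \<phi>'_old[of y] \<phi>'_new[of x] x by (metis DiffD2 UnE image_eqI)
  next
    \<comment> \<open>Equal images are equal roots and give equal blocks, and each block received at
      most one new name.\<close>
    assume "x \<notin> names n0" "y \<notin> names n0"
    then obtain B B' where B: "(x, B) \<in> set C" "(y, B') \<in> set C" using x y by force
    obtain i j where ij: "i \<in> set B" "j \<in> set B'" using C_nonempty B by (meson last_in_set)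
    have "rt i = rt j" using new_block(4)[OF B(1) ij(1)] new_block(4)[OF B(2) ij(2)] eq by simp
    then have "block i = block j" by (rule block_cong)
    then have "snd (x, B) = snd (y, B')"
      unfolding snd_conv using new_block(2)[OF B(1) ij(1)] new_block(2)[OF B(2) ij(2)] by metis
    then show "x = y" using B distinct_snd unfolding distinct_map by (metis inj_onD prod.inject)
  qed
qed

lemma set_Y'_cases:
  assumes "a \<in> set Y'"
  obtains (single) "a \<in> set Y" "\<not> A.shared (\<phi> a)"
    | (parent) i where "a \<in> set Y" "i \<in> set Y" "A.shared (\<phi> i)" "\<phi> a = rt i"
    | (new) "a \<in> fst ` set C"
proof -
  from assms consider B where "B \<in> set blocks" "length B < 2" "a \<in> set B"
    | B where "B \<in> set blocks" "2 \<le> length B" "a \<in> set (parents \<tau> B)" | "a \<in> fst ` set C"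
    unfolding set_Y' by blast
  then show thesis
  proof cases
    case 1
    have a: "a \<in> set Y" "B = block a" using block_of_member[OF 1(1,3)] by auto
    then have "\<not> A.shared (\<phi> a)" using length_block_iff[OF a(1)] 1(2) by simp
    then show thesis by (rule single[OF a(1)])
  next
    case 2
    then obtain i where i: "i \<in> set Y" "B = block i" by (auto simp: set_blocks)
    then have sh: "A.shared (\<phi> i)" using length_block_iff 2(2) by blast
    have "a \<in> set Y \<and> \<phi> a = rt i" using mem_parents[OF i(1) sh] 2(3) i(2) by simp
    then show thesis using parent[OF _ i(1) sh] by blast
  next
    case 3
    then show thesis by (rule new)
  qed
qed

lemma Y'_singleI: "a \<in> set Y \<Longrightarrow> \<not> A.shared (\<phi> a) \<Longrightarrow> a \<in> set Y'"
  using block_in[of a] length_block_iff[of a] mem_block[of a a] unfolding set_Y' by force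

lemma Y'_parentI:
  assumes "u \<in> set Y" "i \<in> set Y" "A.shared (\<phi> i)" "\<phi> u = rt i"
  shows "u \<in> set Y'"
proof -
  have "u \<in> set (parents \<tau> (block i))" using mem_parents[OF assms(2,3)] assms by blast
  moreover have "2 \<le> length (block i)" using length_block_iff[OF assms(2)] assms(3) by blast
  ultimately show ?thesis using block_in[OF assms(2)] unfolding set_Y' by blast
qed

lemma new_blockI:
  assumes "i \<in> set Y" "A.shared (\<phi> i)" "rt i \<notin> \<phi> ` set Y"
  obtains h where "(h, block i) \<in> set C"
proof -
  have "u \<notin> set (parents \<tau> (block i))" for u
    using mem_parents[OF assms(1,2)] assms(3) by (metis image_eqI)
  then have "parents \<tau> (block i) = []" by (metis list.set_intros(1) neq_Nil_conv)
  then have "block i \<in> snd ` set C" using block_in[OF assms(1)] length_block_iff[OF assms(1)] assms(2) by (simp add: snd_C)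
  then show thesis using that by auto
qed

lemma Y'_names: "set Y' \<subseteq> names n"
  unfolding names_n using set_Y'_cases Y_names by blast

lemma image_Y': "\<phi>' ` set Y' = A.next_active"
proof
  show "\<phi>' ` set Y' \<subseteq> A.next_active"
  proof
    fix x assume "x \<in> \<phi>' ` set Y'"
    then obtain a where a: "a \<in> set Y'" "x = \<phi>' a" by blast
    from a(1) show "x \<in> A.next_active"
    proof (cases rule: set_Y'_cases)
      case single
      then show ?thesis using a \<phi>'_Y by (auto simp: A.next_active_def)
    next
      case (parent i)
      then show ?thesis using a \<phi>'_Y[of a] by (auto simp: A.next_active_def)
    next
      case new
      then obtain B where B: "(a, B) \<in> set C" by auto
      obtain i where i: "i \<in> set B" using C_nonempty[OF B] by (cases B) auto
      show ?thesis using new_block[OF B i] a by (auto simp: A.next_active_def)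
    qed
  qed
next
  show "A.next_active \<subseteq> \<phi>' ` set Y'"
  proof
    fix x assume "x \<in> A.next_active"
    then consider a where "a \<in> set Y" "x = \<phi> a" "\<not> A.shared (\<phi> a)"
      | i where "i \<in> set Y" "A.shared (\<phi> i)" "x = rt i"
      by (auto simp: A.next_active_def)
    then show "x \<in> \<phi>' ` set Y'"
    proof cases
      case (1 a)
      then show ?thesis using Y'_singleI \<phi>'_Y[of a] by force
    next
      case (2 i)
      show ?thesis
      proof (cases "x \<in> \<phi> ` set Y")
        case True
        then obtain u where u: "u \<in> set Y" "x = \<phi> u" by blast
        then have "u \<in> set Y'" using Y'_parentI 2 by metis
        then show ?thesis using \<phi>'_Y[of u] u by force
      next
        case False
        then obtain h where h: "(h, block i) \<in> set C" using new_blockI 2 by blast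
        have "\<phi>' h = x" using new_block(4)[OF h, of i] 2 by (simp add: mem_block)
        moreover have "h \<in> set Y'" using h unfolding set_Y' by force
        ultimately show ?thesis by blast
      qed
    qed
  qed
qed

lemma removed_iff: "i \<in> set Y \<Longrightarrow> \<phi> i \<in> A.removed \<longleftrightarrow> A.shared (\<phi> i) \<and> rt i \<noteq> \<phi> i"
  by (auto simp: A.removed_def)

text \<open>An edge inside \<open>U\<close> leaves the remaining subtree iff one end is removed, and
  the only such edge at that end leads to its root. Blocks with an active root and blocks with a new
  one add exactly these edges.\<close>

lemma edges_F: "(`) \<phi>' ` F = {e \<in> E. \<not> e \<subseteq> U - A.removed}"
proof -
  have old: "(`) \<phi>' ` edges s = (`) \<phi> ` edges s"
  proof (rule image_cong[OF refl])
    fix e assume "e \<in> edges s"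
    then have "e \<subseteq> names n0" using edge_names by auto
    then show "\<phi>' ` e = \<phi> ` e" using \<phi>'_old by (intro image_cong) auto
  qed
  have rem: "{\<phi> i, rt i} \<in> {e \<in> E. \<not> e \<subseteq> U - A.removed}" if "i \<in> set Y" "\<phi> i \<in> A.removed" for i
  proof -
    have "rt i \<noteq> \<phi> i" using that removed_iff by blast
    then have "{\<phi> i, rt i} \<in> E" by (rule leafD(3)[OF A.leaf_iff_root])
    then show ?thesis using that(2) by blast
  qed
  have "x \<in> {e \<in> E. \<not> e \<subseteq> U - A.removed}" if x: "x \<in> (`) \<phi>' ` F" for x
  proof -
    obtain e where e: "e \<in> F" "x = \<phi>' ` e" using x by blast
    from e(1) consider "e \<in> edges s"
      | B u v where "B \<in> set blocks" "2 \<le> length B" "u \<in> set (parents \<tau> B)" "v \<in> set B" "v \<noteq> u" "e = {u, v}"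
      | h B v where "(h, B) \<in> set C" "v \<in> set B" "e = {h, v}"
      unfolding F by blast
    then show ?thesis
    proof cases
      case 1
      then have "x \<in> {e \<in> E. \<not> e \<subseteq> U}" unfolding e(2) edges_found[symmetric] old[symmetric] by (rule imageI)
      then show ?thesis by blast
    next
      case (2 B u v)
      have v: "v \<in> set Y" "B = block v" using block_of_member[OF 2(1,4)] by auto
      have sh: "A.shared (\<phi> v)" using length_block_iff[OF v(1)] 2(2) v(2) by simp
      have u: "u \<in> set Y" "\<phi> u = rt v" using mem_parents[OF v(1) sh] 2(3) v(2) by auto
      have "rt v \<noteq> \<phi> v" using u v \<phi>_eq 2(5) by metis
      then have "\<phi> v \<in> A.removed" using removed_iff[OF v(1)] sh by blast
      moreover have "x = {\<phi> v, rt v}"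
        using e(2) 2(6) u v(1) \<phi>'_Y by (simp add: insert_commute)
      ultimately show ?thesis using rem[OF v(1)] by simp
    next
      case (3 h B v)
      note nb = new_block[OF 3(1,2)]
      have "rt v \<noteq> \<phi> v" using nb(1,5) by auto
      then have "\<phi> v \<in> A.removed" using removed_iff[OF nb(1)] nb(3) by blast
      moreover have "x = {\<phi> v, rt v}"
        using e(2) 3(3) nb(1,4) \<phi>'_Y[of v] by (simp add: insert_commute)
      ultimately show ?thesis using rem[OF nb(1)] by simp
    qed
  qed
  moreover have "x \<in> (`) \<phi>' ` F" if x: "x \<in> E" "\<not> x \<subseteq> U - A.removed" for x
  proof (cases "x \<subseteq> U")
    case False
    then have "x \<in> (`) \<phi>' ` edges s" unfolding old edges_found using x by simp
    then show ?thesis unfolding F by blast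
  next
    case True
    then obtain w where w: "w \<in> x" "w \<in> A.removed" using x by auto
    then obtain v where v: "v \<in> set Y" "w = \<phi> v" by (auto simp: A.removed_def)
    have r: "A.shared (\<phi> v)" "rt v \<noteq> \<phi> v" using removed_iff[OF v(1)] w v by auto
    obtain q where q: "x = {w, q}" using edgeE[OF x(1)] w(1) by auto
    have "q = rt v" using leafD(5)[OF A.leaf_iff_root[OF r(2)]] x(1) q True v(2) by auto
    then have xe: "x = {rt v, \<phi> v}" using q v by auto
    have vo: "\<phi>' v = \<phi> v" using \<phi>'_Y v by simp
    have len: "2 \<le> length (block v)" using length_block_iff[OF v(1)] r by blast
    show ?thesis
    proof (cases "rt v \<in> \<phi> ` set Y")
      case True
      then obtain u where u: "u \<in> set Y" "rt v = \<phi> u" by blast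
      have "u \<in> set (parents \<tau> (block v))" using mem_parents[OF v(1) r(1)] u by auto
      moreover have "v \<in> set (block v) - {u}" using v r u by (auto simp: mem_block)
      ultimately have "{u, v} \<in> F" unfolding F using block_in[OF v(1)] len by blast
      moreover have "\<phi>' ` {u, v} = x" using xe vo \<phi>'_Y[of u] u by auto
      ultimately show ?thesis by blast
    next
      case False
      then obtain h where h: "(h, block v) \<in> set C" using new_blockI v r by blast
      have vb: "v \<in> set (block v)" using v by (simp add: mem_block)
      then have "{h, v} \<in> F" unfolding F using h by blast
      moreover have "\<phi>' ` {h, v} = x" using xe vo new_block(4)[OF h vb] by auto
      ultimately show ?thesis by blast
    qed
  qed
  ultimately show ?thesis by blast
qed

lemma F_names: "\<Union> F \<subseteq> names n"
proof -
  have b: "set B \<subseteq> names n" if "B \<in> set blocks" for B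
    using block_of_member[OF that] Y_names names_n by blast
  have "e \<subseteq> names n" if "e \<in> F" for e
  proof -
    from that consider "e \<in> edges s"
      | B u v where "B \<in> set blocks" "u \<in> set (parents \<tau> B)" "v \<in> set B" "e = {u, v}"
      | h B v where "(h, B) \<in> set C" "v \<in> set B" "e = {h, v}"
      unfolding F by blast
    then show ?thesis
    proof cases
      case 1
      then show ?thesis using edge_names names_n by blast
    next
      case (2 B u v)
      then show ?thesis using b[OF 2(1)] by (auto simp: parents_def)
    next
      case (3 h B v)
      have "h \<in> fst ` set C" using 3(1) by force
      then show ?thesis using b[of B] C_block[OF 3(1)] 3(2,3) names_n by blast
    qed
  qed
  then show ?thesis by blast
qed

section \<open>Distances to the new hidden nodes\<close>

definition T :: "'a dist_table" where "T a b = d (\<phi>' a) (\<phi>' b)"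

lemma T_sym: "T a b = T b a"
  by (simp add: T_def d_sym)

lemma T_old: "a \<in> set Y \<Longrightarrow> b \<in> set Y \<Longrightarrow> T a b = d (\<phi> a) (\<phi> b)"
  using \<phi>'_Y by (auto simp: T_def)

lemma child_leaf:
  assumes "(h, B) \<in> set C" "i \<in> set B"
  shows "leaf U (\<phi>' i) (\<phi>' h)" "i \<notin> set Y'" "\<phi>' i \<in> A.removed"
proof -
  note nb = new_block[OF assms]
  have io: "\<phi>' i = \<phi> i" using \<phi>'_Y nb by auto
  have ne: "rt i \<noteq> \<phi> i" using nb by auto
  show "leaf U (\<phi>' i) (\<phi>' h)" using A.leaf_iff_root[OF ne] io nb by simp
  show r: "\<phi>' i \<in> A.removed" using removed_iff[OF nb(1)] nb(3) ne io by simp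
  show "i \<notin> set Y'" using image_Y' A.next_active_subset r by blast
qed

text \<open>The source of all update formulas: a child sees everything else in \<open>U\<close>
  through \<open>h\<close>. So the results are the same whichever child or third node
  \<open>pick\<close> returns.\<close>

lemma T_child:
  assumes "(h, B) \<in> set C" "i \<in> set B" "\<phi>' l \<in> U" "\<phi>' l \<noteq> \<phi>' i"
  shows "T i l = T i h + T h l"
  unfolding T_def by (rule A.leaf_d[OF child_leaf(1)[OF assms(1,2)] assms(3,4)])

abbreviation old_pairs :: "('a node \<times> 'a node) set" where
  "old_pairs \<equiv> {(a, b). a \<in> set Y \<and> b \<in> set Y \<and> a \<noteq> b}"

abbreviation child_pairs :: "('a node \<times> 'a node) set" where
  "child_pairs \<equiv> (\<Union>k\<in>set (child_keys C). {(fst (snd k), fst k), (fst k, fst (snd k))})"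

definition D1 :: "'a dist_table" where "D1 = fold (child_step pick \<Phi> Y) (child_keys C) D"

definition D2 :: "'a dist_table" where "D2 = fold (other_step pick Y C) (other_keys Y' C) D1"

lemma mem_child_keys: "(h, i, j) \<in> set (child_keys C) \<longleftrightarrow> (\<exists>B. (h, B) \<in> set C \<and> i \<in> set B \<and> j \<in> set B \<and> i \<noteq> j)"
  by auto

lemma mem_other_keys: "(h, B, l) \<in> set (other_keys Y' C) \<longleftrightarrow> (h, B) \<in> set C \<and> l \<in> set Y' \<and> l \<noteq> h"
  by auto

lemma D1_correct: "old_pairs \<union> child_pairs \<subseteq> correct_pairs T D1"
  unfolding D1_def
proof (rule correct_pairs_fold_set_dist[OF T_sym])
  show "old_pairs \<subseteq> correct_pairs T D" using T_old D by (auto simp: correct_pairs_def)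
next
  fix k and dd :: "'a dist_table"
  assume k: "k \<in> set (child_keys C)" and dd: "old_pairs \<subseteq> correct_pairs T dd"
  obtain h i j where kk: "k = (h, i, j)" by (cases k)
  obtain B where B: "(h, B) \<in> set C" "i \<in> set B" "j \<in> set B" "i \<noteq> j"
    using k unfolding kk mem_child_keys by blast
  have ij: "i \<in> set Y" "j \<in> set Y" using new_block(1) B by blast+
  define m where "m = pick (filter (\<lambda>k. k \<noteq> i \<and> k \<noteq> j) Y)"
  have m: "m \<in> set Y" "m \<noteq> i" "m \<noteq> j" using pick[OF others_nonempty, of i j] by (auto simp: m_def)
  have inU: "\<phi>' x \<in> U" if "x \<in> set Y" for x using that \<phi>'_Y A.YU by force
  have ne: "\<phi>' x \<noteq> \<phi>' y" if "x \<in> set Y" "y \<in> set Y" "x \<noteq> y" for x y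
    using that \<phi>'_Y \<phi>_eq by (metis subsetD)
  have "dd i j = T i j" using dd ij B(4) by (auto simp: correct_pairs_def)
  moreover have "\<Phi> (i, j, m) = T i m - T j m"
    using \<Phi>[OF ij m(1)] D[OF ij(1) m(1)] D[OF ij(2) m(1)] T_old ij m by simp
  moreover have "T i j = T i h + T h j" by (rule T_child[OF B(1,2) inU ne]) (use ij B in auto)
  moreover have "T i m = T i h + T h m" by (rule T_child[OF B(1,2) inU ne]) (use ij m in auto)
  moreover have "T j m = T j h + T h m" by (rule T_child[OF B(1,3) inU ne]) (use ij m in auto)
  \<comment> \<open>By the three splittings at \<open>h\<close>,
    \<open>T i j + T i m - T j m\<close> is twice \<open>T i h\<close>.\<close>
  ultimately have "(dd i j + \<Phi> (i, j, m)) / 2 = T i h" using T_sym[of h j] by simp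
  then show "child_step pick \<Phi> Y k dd = set_dist (fst (snd k)) (fst k) (T (fst (snd k)) (fst k)) dd"
    by (simp add: kk child_step_def m_def)
qed

text \<open>A block in \<open>C\<close> has a second member \<open>j\<close>, so some key
  \<open>(h, i, j)\<close> writes the distance of the child.\<close>

lemma child_pairsI:
  assumes "(h, B) \<in> set C" "i \<in> set B"
  shows "(i, h) \<in> child_pairs" "(h, i) \<in> child_pairs"
proof -
  have "\<exists>j\<in>set B. j \<noteq> i"
  proof (rule ccontr)
    assume "\<not> ?thesis"
    then have "set B \<subseteq> {i}" by auto
    then have "card (set B) \<le> 1" using card_mono[of "{i}" "set B"] by simp
    then show False using C_block[OF assms(1)] by (simp add: distinct_card)
  qed
  then obtain j where "j \<in> set B" "i \<noteq> j" by blast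
  then have k: "(h, i, j) \<in> set (child_keys C)" unfolding mem_child_keys using assms by blast
  show "(i, h) \<in> child_pairs" "(h, i) \<in> child_pairs" by (rule UN_I[OF k], simp only: fst_conv snd_conv insert_iff simp_thms)+
qed

lemma Y'_in_U: "l \<in> set Y' \<Longrightarrow> \<phi>' l \<in> U - A.removed"
  using image_Y' A.next_active_subset by blast

text \<open>This pass reads only distances between old nodes and between a child and its new parent.
  All of them are correct beforehand, so no step depends on another step of the same pass.\<close>

lemma D2_correct: "(old_pairs \<union> child_pairs) \<union>
  (\<Union>k\<in>set (other_keys Y' C). {(fst k, snd (snd k)), (snd (snd k), fst k)}) \<subseteq> correct_pairs T D2"
  unfolding D2_def
proof (rule correct_pairs_fold_set_dist[OF T_sym D1_correct])
  fix k and dd :: "'a dist_table"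
  assume k: "k \<in> set (other_keys Y' C)" and dd: "old_pairs \<union> child_pairs \<subseteq> correct_pairs T dd"
  obtain h B l where kk: "k = (h, B, l)" by (cases k)
  have hB: "(h, B) \<in> set C" and l: "l \<in> set Y'" "l \<noteq> h" using k unfolding kk mem_other_keys by auto
  define i where "i = pick B"
  have i: "i \<in> set B" unfolding i_def by (rule pick[OF C_nonempty[OF hB]])
  have iY: "i \<in> set Y" by (rule new_block(1)[OF hB i])
  have dd_child: "dd a b = T a b" if "(a, b) \<in> child_pairs" for a b
    using subsetD[OF dd UnI2[OF that]] by (simp add: correct_pairs_def)
  have dd_old: "dd a b = T a b" if "a \<in> set Y" "b \<in> set Y" "a \<noteq> b" for a b
  proof -
    have "(a, b) \<in> old_pairs" using that by blast
    from subsetD[OF dd UnI1[OF this]] show ?thesis by (simp add: correct_pairs_def)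
  qed
  have dih: "dd i h = T i h" by (rule dd_child[OF child_pairsI(1)[OF hB i]])
  have Til: "T i l = T i h + T h l"
    by (rule T_child[OF hB i]) (use Y'_in_U[OF l(1)] child_leaf(3)[OF hB i] in auto)
  have "other_step pick Y C k dd = set_dist h l (T h l) dd"
  proof (cases "l \<in> set Y")
    case True
    have "i \<noteq> l" using child_leaf(2)[OF hB i] l by auto
    then have "dd i l = T i l" by (rule dd_old[OF iY True])
    then have "dd i l - dd i h = T h l" using Til dih by simp
    then show ?thesis using True by (simp add: kk other_step_def Let_def i_def)
  next
    \<comment> \<open>Here \<open>l\<close> is new as well. The path from \<open>i\<close> to a
      child \<open>m\<close> of \<open>l\<close> runs through \<open>h\<close> and then
      \<open>l\<close>, so both end pieces are subtracted from \<open>T i m\<close>.\<close>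
    case False
    from l(1) have "l \<in> fst ` set C" by (cases rule: set_Y'_cases) (use False in auto)
    then obtain B' where B': "(l, B') \<in> set C" by auto
    define m where "m = pick B'"
    have m: "m \<in> set B'" unfolding m_def by (rule pick[OF C_nonempty[OF B']])
    have mY: "m \<in> set Y" by (rule new_block(1)[OF B' m])
    have mapl: "map_of C l = Some B'" by (rule new_block(6)[OF B' m])
    have "\<phi>' h \<noteq> \<phi>' l"
      using inj_\<phi>' hB B' l(2) names_n by (metis UnI2 fst_conv image_eqI inj_onD)
    then have "rt i \<noteq> rt m" using new_block(4)[OF hB i] new_block(4)[OF B' m] by simp
    then have im: "i \<noteq> m" by auto
    have \<phi>im: "\<phi>' m \<in> U" "\<phi>' i \<in> U" "\<phi>' m \<noteq> \<phi>' i"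
      using \<phi>'_Y A.YU iY mY im \<phi>_eq by (metis image_eqI subsetD)+
    have "dd i m = T i m" by (rule dd_old[OF iY mY im])
    moreover have "dd l m = T l m" by (rule dd_child[OF child_pairsI(2)[OF B' m]])
    moreover have "T i m = T i h + T h m" by (rule T_child[OF hB i \<phi>im(1,3)])
    moreover have "T m h = T m l + T l h"
    proof (rule T_child[OF B' m])
      have "h \<in> set Y'" using hB unfolding set_Y' by force
      then show "\<phi>' h \<in> U" "\<phi>' h \<noteq> \<phi>' m" using Y'_in_U[of h] child_leaf(3)[OF B' m] by auto
    qed
    ultimately have "dd i m - dd i h - dd l m = T h l"
      using dih T_sym[of m h] T_sym[of l m] T_sym[of l h] by simp
    then show ?thesis using False mapl by (simp add: kk other_step_def Let_def i_def m_def)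
  qed
  then show "other_step pick Y C k dd = set_dist (fst k) (snd (snd k)) (T (fst k) (snd (snd k))) dd"
    by (simp add: kk)
qed

lemma D2:
  assumes ab: "a \<in> set Y'" "b \<in> set Y'" "a \<noteq> b"
  shows "D2 a b = d (\<phi>' a) (\<phi>' b)"
proof -
  have key: "(h, l) \<in> correct_pairs T D2 \<and> (l, h) \<in> correct_pairs T D2"
    if hl: "h \<in> fst ` set C" "l \<in> set Y'" "l \<noteq> h" for h l
  proof -
    obtain B where "(h, B) \<in> set C" using hl(1) by auto
    then have k: "(h, B, l) \<in> set (other_keys Y' C)" unfolding mem_other_keys using hl by blast
    have "(h, l) \<in> (\<Union>k\<in>set (other_keys Y' C). {(fst k, snd (snd k)), (snd (snd k), fst k)})"
      "(l, h) \<in> (\<Union>k\<in>set (other_keys Y' C). {(fst k, snd (snd k)), (snd (snd k), fst k)})"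
      by (rule UN_I[OF k], simp only: fst_conv snd_conv insert_iff simp_thms)+
    then show ?thesis using D2_correct by blast
  qed
  have old: "x \<in> set Y" if "x \<in> set Y'" "x \<notin> fst ` set C" for x
    using that(1) by (cases rule: set_Y'_cases) (use that(2) in auto)
  have "(a, b) \<in> correct_pairs T D2"
  proof (cases "a \<in> fst ` set C \<or> b \<in> fst ` set C")
    case True
    then show ?thesis using key ab by blast
  next
    case False
    then have "(a, b) \<in> old_pairs" using old ab by auto
    then show ?thesis using D2_correct by blast
  qed
  then show ?thesis by (simp add: correct_pairs_def T_def)
qed

lemma invariant_next:
  "invariant \<lparr>active = Y', distances = D2, edges = F, next_hidden = n\<rparr> \<phi>' (U - A.removed)"
  unfolding invariant_def rg_state.simps
proof (intro conjI)
  show "inj_on \<phi>' (names n)" by (rule inj_\<phi>')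
  show "\<forall>v\<in>V. \<phi>' (Observed v) = v" using \<phi>'_old obs by (auto simp: names_def)
  show "\<phi>' ` names n \<subseteq> V \<union> H"
  proof (rule image_subsetI)
    fix x assume "x \<in> names n"
    then consider "x \<in> names n0" | "x \<in> fst ` set C" unfolding names_n by blast
    then show "\<phi>' x \<in> V \<union> H"
    proof cases
      case 1
      then show ?thesis using \<phi>'_old[OF 1] img by (metis image_subset_iff)
    next
      case 2
      then show ?thesis using \<phi>'_new[OF 2] A.UW by blast
    qed
  qed
  show "distinct Y'" by (rule distinct_Y')
  show "set Y' \<subseteq> names n" by (rule Y'_names)
  show "length Y' \<le> card V" using length_Y'_blocks length_blocks length_Y by simp
  show "active_subtree (V \<union> H) E d (U - A.removed) (\<phi>' ` set Y')"
    unfolding image_Y' by (rule A.active_subtree_next_round)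
  have old_img: "\<phi> ` names n0 \<subseteq> \<phi>' ` names n" unfolding names_n using \<phi>'_old by force
  have "A.removed \<subseteq> \<phi> ` names n0" using Y_names by (auto simp: A.removed_def)
  then show "(V \<union> H) - (U - A.removed) \<subseteq> \<phi>' ` names n" using outside old_img by blast
  show "(U - A.removed) \<inter> \<phi>' ` names n \<subseteq> \<phi>' ` set Y'"
  proof
    fix x assume x: "x \<in> (U - A.removed) \<inter> \<phi>' ` names n"
    then obtain a where a: "a \<in> names n0 \<union> fst ` set C" "x = \<phi>' a" unfolding names_n by blast
    show "x \<in> \<phi>' ` set Y'"
    proof (cases "a \<in> names n0")
      case True
      then have "x \<in> \<phi> ` set Y" using x a \<phi>'_old inside by auto
      then show ?thesis unfolding image_Y' using A.active_cases x by blast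
    next
      case False
      then show ?thesis using a unfolding set_Y' by blast
    qed
  qed
  show "\<Union> F \<subseteq> names n" by (rule F_names)
  show "(`) \<phi>' ` F = {e \<in> E. \<not> e \<subseteq> U - A.removed}" by (rule edges_F)
  show "\<forall>a\<in>set Y'. \<forall>b\<in>set Y'. a \<noteq> b \<longrightarrow> D2 a b = d (\<phi>' a) (\<phi>' b)" using D2 by blast
qed

text \<open>With \<open>n\<close> active nodes, the differences cost \<open>n ^ 3\<close>, the tests
  at most \<open>4 * n ^ 3\<close>, and the two passes over distances at most
  \<open>2 * n ^ 3\<close> each; \<open>n \<ge> 3\<close> absorbs the quadratic terms.\<close>

lemma round_cost:
  "length Y ^ 3 + (3 * length Y + 1) * (length Y)\<^sup>2 + 2 * length (child_keys C) + 2 * length (other_keys Y' C)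
     \<le> 9 * card V ^ 3"
proof -
  let ?m = "length Y"
  have B: "length B \<le> ?m" if "(h, B) \<in> set C" for h B
    using C_block[OF that] by (auto simp: set_blocks block_def)
  have C: "length C \<le> ?m" "length Y' \<le> ?m" using length_C_blocks length_Y'_blocks length_blocks by auto
  have "length (child_keys C) \<le> length C * (?m * ?m)" using length_child_keys[of C ?m] B by blast
  also have "\<dots> \<le> ?m * (?m * ?m)" using C by simp
  finally have 1: "length (child_keys C) \<le> ?m ^ 3" by (simp add: power3_eq_cube mult.assoc)
  have sq: "?m\<^sup>2 \<le> ?m ^ 3" using three_active by (intro power_increasing) auto
  have "length (other_keys Y' C) \<le> length C * length Y'" by (rule length_other_keys)
  also have "\<dots> \<le> ?m\<^sup>2" using C by (simp add: power2_eq_square mult_le_mono)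
  finally have 2: "length (other_keys Y' C) \<le> ?m ^ 3" using sq by simp
  have "(3 * ?m + 1) * ?m\<^sup>2 = 3 * ?m ^ 3 + ?m\<^sup>2" by (simp add: algebra_simps power2_eq_square power3_eq_cube)
  then have "?m ^ 3 + (3 * ?m + 1) * ?m\<^sup>2 + 2 * length (child_keys C) + 2 * length (other_keys Y' C) \<le> 9 * ?m ^ 3"
    using 1 2 sq by linarith
  also have "\<dots> \<le> 9 * card V ^ 3" using length_Y by (simp add: power_mono)
  finally show ?thesis .
qed

end

section \<open>The loop and its output\<close>

context recovery
begin

lemma round_invariant:
  assumes inv: "invariant s \<phi> U" and three: "3 \<le> length (active s)"
    and pick: "\<And>ks. ks \<noteq> [] \<Longrightarrow> pick ks \<in> set ks"
  obtains s' \<phi>' U' where "computes (rg_round pick s) s' (9 * card V ^ 3)" "invariant s' \<phi>' U'"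
    "diam U' E < diam U E"
proof -
  obtain \<Phi> \<tau> where
    \<Phi>: "\<And>i j k. i \<in> set (active s) \<Longrightarrow> j \<in> set (active s) \<Longrightarrow> k \<in> set (active s) \<Longrightarrow>
      \<Phi> (i, j, k) = distances s i k - distances s j k" and
    \<tau>: "\<And>i j. i \<in> set (active s) \<Longrightarrow> j \<in> set (active s) \<Longrightarrow> i \<noteq> j \<Longrightarrow>
      \<tau> (i, j) = verdict_of (distances s) \<Phi> (active s) i j" and
    comp: "\<And>Y' F C n. fold (group_block \<tau>) (partition_blocks (\<lambda>i j. \<tau> (i, j) \<noteq> Neither) (active s))
        ([], edges s, [], next_hidden s) = (Y', F, C, n) \<Longrightarrow>
      computes (rg_round pick s)
        \<lparr>active = Y',
         distances = fold (other_step pick (active s) C) (other_keys Y' C)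
           (fold (child_step pick \<Phi> (active s)) (child_keys C) (distances s)),
         edges = F, next_hidden = n\<rparr>
        (length (active s) ^ 3 + (3 * length (active s) + 1) * (length (active s))\<^sup>2 +
         2 * length (child_keys C) + 2 * length (other_keys Y' C))"
    by (rule computes_rg_round[of s pick]) blast
  interpret active_round V H E d s \<phi> U \<Phi> \<tau>
    by unfold_locales (use inv three \<Phi> \<tau> in auto)
  obtain Y' F C n where f: "fold (group_block \<tau>) (partition_blocks (\<lambda>i j. \<tau> (i, j) \<noteq> Neither) (active s))
        ([], edges s, [], next_hidden s) = (Y', F, C, n)" by (rule prod_cases4)
  interpret grouped_round V H E d s \<phi> U \<Phi> \<tau> pick Y' F C n
    by unfold_locales (use pick fold_group_block f in auto)
  show thesis
  proof (rule that)
    show "computes (rg_round pick s) \<lparr>active = Y', distances = D2, edges = F, next_hidden = n\<rparr> (9 * card V ^ 3)"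
      using computes_mono[OF comp[OF f] round_cost] by (simp only: D1_def D2_def)
    show "invariant \<lparr>active = Y', distances = D2, edges = F, next_hidden = n\<rparr> \<phi>' (U - A.removed)"
      by (rule invariant_next)
    show "diam (U - A.removed) E < diam U E" by (rule A.diam_next_round)
  qed
qed

text \<open>The diameter of the unfound part is both the termination measure and the budget: each
  round costs at most \<open>9 * card V ^ 3\<close> and consumes at least one unit of it.\<close>

lemma loop:
  assumes "invariant s \<phi> U" and pick: "\<And>ks. ks \<noteq> [] \<Longrightarrow> pick ks \<in> set ks"
  shows "\<exists>s' t' \<phi>' U'. while_option (\<lambda>(s, t). 3 \<le> length (active s)) (\<lambda>(s, t). run_state (rg_round pick s) t) (s, t)
      = Some (s', t') \<and> invariant s' \<phi>' U' \<and> length (active s') < 3 \<and> t' \<le> t + 9 * card V ^ 3 * diam U E"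
  using assms(1)
proof (induction "diam U E" arbitrary: s \<phi> U t rule: less_induct)
  case less
  let ?b = "\<lambda>(s, t). 3 \<le> length (active s)" and ?c = "\<lambda>(s, t). run_state (rg_round pick s) t"
  show ?case
  proof (cases "3 \<le> length (active s)")
    case False
    then have "while_option ?b ?c (s, t) = Some (s, t)" by (subst while_option_unfold) simp
    then show ?thesis using less.prems False by fastforce
  next
    case True
    obtain s1 \<phi>1 U1 where s1: "computes (rg_round pick s) s1 (9 * card V ^ 3)" "invariant s1 \<phi>1 U1"
      "diam U1 E < diam U E"
      using round_invariant[OF less.prems True pick] by blast
    obtain t1 where t1: "t1 \<le> t + 9 * card V ^ 3" "run_state (rg_round pick s) t = (s1, t1)"
      using s1(1) unfolding computes_def by blast
    obtain s' t' \<phi>' U' where r: "while_option ?b ?c (s1, t1) = Some (s', t')" "invariant s' \<phi>' U'"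
      "length (active s') < 3" "t' \<le> t1 + 9 * card V ^ 3 * diam U1 E"
      using less.hyps[OF s1(3,2)] by blast
    have "while_option ?b ?c (s, t) = Some (s', t')"
      using r(1) True t1(2) by (subst while_option_unfold) simp
    moreover have "t' \<le> t + 9 * card V ^ 3 * diam U E"
    proof -
      have "t' \<le> t + 9 * card V ^ 3 * Suc (diam U1 E)" using r(4) t1(1) by simp
      also have "\<dots> \<le> t + 9 * card V ^ 3 * diam U E" using s1(3) by (intro add_left_mono mult_le_mono2) simp
      finally show ?thesis .
    qed
    ultimately show ?thesis using r(2,3) by blast
  qed
qed

lemma invariant_init:
  assumes D: "\<And>i j. i \<in> V \<Longrightarrow> j \<in> V \<Longrightarrow> i \<noteq> j \<Longrightarrow> D i j = d i j" and vs: "distinct vs" "set vs = V"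
  shows "invariant (rg_init vs D) (\<lambda>a. case a of Observed v \<Rightarrow> v) (V \<union> H)"
proof -
  \<comment> \<open>No hidden name exists yet, so the missing \<open>Hidden\<close> case is never
    reached on \<open>names 0\<close>.\<close>
  let ?\<phi> = "\<lambda>a. case a of Observed v \<Rightarrow> v"
  have img: "?\<phi> ` Observed ` A = A" for A by (force simp: image_iff)
  have "active_subtree (V \<union> H) E d (V \<union> H) V"
    by unfold_locales (use subtree_all disjoint hidden_degree edge_in in \<open>auto simp: neighbors_def\<close>)
  moreover have "{e \<in> E. \<not> e \<subseteq> V \<union> H} = {}" using edgeE by auto
  ultimately show ?thesis
    using D vs unfolding invariant_def rg_init_def
    by (auto simp: names_def img inj_on_def distinct_map distinct_card[symmetric])
qed

text \<open>With fewer than three active nodes nothing is unfound except edges among them: none for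
  a single node, and for two nodes the edge that \<open>rg_output\<close> adds.\<close>

lemma recovers_final:
  assumes inv: "invariant s \<phi> U" and fin: "length (active s) < 3" and vs: "set vs = V"
  shows "recovers (rg_output vs s) V H E"
proof -
  let ?N = "names (next_hidden s)"
  have act: "active_subtree (V \<union> H) E d U (\<phi> ` set (active s))"
    and dist: "distinct (active s)" and sub: "set (active s) \<subseteq> ?N" and inj: "inj_on \<phi> ?N"
    and img: "\<phi> ` ?N \<subseteq> V \<union> H" "(V \<union> H) - U \<subseteq> \<phi> ` ?N" and obs: "\<forall>v\<in>V. \<phi> (Observed v) = v"
    and ed: "(`) \<phi> ` edges s = {e \<in> E. \<not> e \<subseteq> U}"
    using inv unfolding invariant_def by - (elim conjE, assumption)+
  interpret A: active_subtree "V \<union> H" E d U "\<phi> ` set (active s)" by (rule act)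
  have "card (\<phi> ` set (active s)) < 3"
    using fin card_image_le[of "set (active s)" \<phi>] card_length[of "active s"] by simp
  then have UY: "U = \<phi> ` set (active s)" by (rule A.all_active)
  have bij: "bij_betw \<phi> ?N (V \<union> H)"
    unfolding bij_betw_def using inj img UY sub by blast
  have fst: "fst (rg_output vs s) = ?N" by (simp add: rg_output_def names_def vs)
  have "active s \<noteq> []" using UY A.U by (auto simp: subtree_def)
  then consider a where "active s = [a]" | a b where "active s = [a, b]"
    using fin by (cases "active s" rule: remdups_adj.cases) auto
  then have "(`) \<phi> ` snd (rg_output vs s) = E"
  proof cases
    case (1 a)
    then have "\<not> e \<subseteq> U" if "e \<in> E" for e using edgeE[OF that] UY by auto
    then show ?thesis using ed 1 by (auto simp: rg_output_def)
  next
    case (2 a b)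
    then have ne: "\<phi> a \<noteq> \<phi> b" using inj sub dist by (auto simp: inj_on_def)
    have U: "U = {\<phi> a, \<phi> b}" using UY 2 by simp
    have e: "{\<phi> a, \<phi> b} \<in> E" by (rule A.two_active) (use 2 ne in auto)
    have "x = {\<phi> a, \<phi> b}" if "x \<in> E" "x \<subseteq> U" for x using edgeE[OF that(1)] that(2) U by auto
    then have "E = {e \<in> E. \<not> e \<subseteq> U} \<union> {{\<phi> a, \<phi> b}}" using e by blast
    then show ?thesis using ed 2 by (simp add: rg_output_def image_Un)
  qed
  then show ?thesis
    unfolding recovers_def fst using bij obs by (intro exI[of _ \<phi>]) (auto simp: names_def)
qed

lemma recursive_grouping_correct:
  assumes D: "\<And>i j. i \<in> V \<Longrightarrow> j \<in> V \<Longrightarrow> i \<noteq> j \<Longrightarrow> D i j = d i j" and vs: "distinct vs" "set vs = V"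
    and pick: "\<And>ks. ks \<noteq> [] \<Longrightarrow> pick ks \<in> set ks"
  shows "\<exists>G t. recursive_grouping pick vs D = Some (G, t) \<and> recovers G V H E \<and>
    t \<le> 9 * diam (V \<union> H) E * card V ^ 3"
proof -
  obtain s' t' \<phi>' U' where r: "while_option (\<lambda>(s, t). 3 \<le> length (active s))
      (\<lambda>(s, t). run_state (rg_round pick s) t) (rg_init vs D, 0) = Some (s', t')"
    "invariant s' \<phi>' U'" "length (active s') < 3" "t' \<le> 0 + 9 * card V ^ 3 * diam (V \<union> H) E"
    using loop[OF invariant_init[OF D vs] pick] by blast
  show ?thesis
    using r(1,4) recovers_final[OF r(2,3) vs(2)] by (auto simp: recursive_grouping_def mult_ac)
qed

end

section \<open>Correctness and running time of recursive grouping\<close>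

theorem theorem5:
  "\<exists>c :: real. \<forall>(V :: 'v set) H E (M :: 's measure) (X :: 'v \<Rightarrow> 's \<Rightarrow> real) (Z :: 'v \<Rightarrow> 's \<Rightarrow> nat)
      K \<delta> l u D vs pick.
     minimal_latent_tree V H E \<longrightarrow>
     3 \<le> card V \<longrightarrow>
     (gaussian_model M X (V \<union> H) E \<and> \<delta> = gaussian_dist M X \<or>
      discrete_model M K Z (V \<union> H) E \<and> \<delta> = discrete_dist M K Z) \<longrightarrow>
     0 < l \<longrightarrow>
     (\<forall>i j. {i, j} \<in> E \<longrightarrow> l \<le> \<delta> i j \<and> \<delta> i j \<le> u) \<longrightarrow>
     (\<forall>i\<in>V. \<forall>j\<in>V. D i j = \<delta> i j) \<longrightarrow>
     distinct vs \<and> set vs = V \<longrightarrow>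
     (\<forall>ks. ks \<noteq> [] \<longrightarrow> pick ks \<in> set ks) \<longrightarrow>
     (\<exists>G t. recursive_grouping pick vs D = Some (G, t) \<and>
            recovers G V H E \<and>
            real t \<le> c * real (diam (V \<union> H) E) * real (card V) ^ 3)"
proof (rule exI[of _ 9], intro allI impI)
  fix V :: "'v set" and H E and M :: "'s measure" and X :: "'v \<Rightarrow> 's \<Rightarrow> real" and Z :: "'v \<Rightarrow> 's \<Rightarrow> nat"
    and K \<delta> l u D vs and pick :: "'v node list \<Rightarrow> 'v node"
  assume lt: "minimal_latent_tree V H E" and card: "3 \<le> card V"
    and model: "gaussian_model M X (V \<union> H) E \<and> \<delta> = gaussian_dist M X \<or>
      discrete_model M K Z (V \<union> H) E \<and> \<delta> = discrete_dist M K Z"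
    and l: "0 < l" and edge: "\<forall>i j. {i, j} \<in> E \<longrightarrow> l \<le> \<delta> i j \<and> \<delta> i j \<le> u"
    and D: "\<forall>i\<in>V. \<forall>j\<in>V. D i j = \<delta> i j" and vs: "distinct vs \<and> set vs = V"
    and pick: "\<forall>ks. ks \<noteq> [] \<longrightarrow> pick ks \<in> set ks"
  interpret tree "V \<union> H" E
    using lt by unfold_locales (simp add: minimal_latent_tree_def latent_tree_def)
  have "card V \<le> card (V \<union> H)" by (rule card_mono[OF finite_vertices]) simp
  then have "2 \<le> card (V \<union> H)" using card by simp
  \<comment> \<open>The diagonal is set to 0 to obtain a metric; the algorithm's input has to agree
    with it only off the diagonal.\<close>
  then have mt: "metric_tree (V \<union> H) E (\<lambda>u v. if u = v then 0 else \<delta> u v)"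
    using model l edge gaussian_metric_tree[of M X l] discrete_metric_tree[of M K Z l] by blast
  interpret recovery V H E "\<lambda>u v. if u = v then 0 else \<delta> u v"
    unfolding recovery_def recovery_axioms_def
    using mt lt by (simp add: minimal_latent_tree_def latent_tree_def)
  obtain G t where r: "recursive_grouping pick vs D = Some (G, t)" "recovers G V H E"
    "t \<le> 9 * diam (V \<union> H) E * card V ^ 3"
    using recursive_grouping_correct[of D vs pick] D vs pick by auto
  have "real t \<le> real (9 * diam (V \<union> H) E * card V ^ 3)" using r(3) by (rule of_nat_mono)
  then show "\<exists>G t. recursive_grouping pick vs D = Some (G, t) \<and> recovers G V H E \<and>
      real t \<le> 9 * real (diam (V \<union> H) E) * real (card V) ^ 3"
    using r(1,2) by simp
qed

end
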